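(* For every real $q$ with $0<q<1$, $$V(q)=\frac{1}{\sqrt[3]{-1+9\exp\left(\displaystyle\int_q^1\varphi^2(-t)\,\varphi^2(-t^3)\,\frac{dt}{t}\right)}} =\frac12\sqrt[3]{1-\exp\left(-8\displaystyle\int_0^q\psi^2(t)\,\psi^2(t^3)\,dt\right)},$$ where the cube roots are real cube roots.
   Context: For $|q|<1$, Ramanujan's theta functions are $\varphi(q)=\sum_{n=-\infty}^{\infty}q^{n^2}$ and $\psi(q)=\sum_{n=0}^{\infty}q^{n(n+1)/2}$. Ramanujan's cubic continued fraction is $$V(q)=\cfrac{q^{1/3}}{1+\cfrac{q+q^2}{1+\cfrac{q^2+q^4}{1+\cdots}}},\qquad |q|<1,$$ that is, $V(q)=\dfrac{q^{1/3}}{1}\,\dfrac{q+q^2}{+1}\,\dfrac{q^2+q^4}{+1}\,\dfrac{q^3+q^6}{+1}\cdots$ (the $n$-th partial numerator after the first being $q^n+q^{2n}$), where $q^{1/3}$ denotes the real cube root of $q$. *)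

theory Defs
  imports "HOL-Analysis.Analysis"
begin

definition rphi :: "real \<Rightarrow> real" where
  "rphi q = (\<Sum>\<^sub>\<infinity>n::int. q ^ nat (n^2))"

definition rpsi :: "real \<Rightarrow> real" where
  "rpsi q = (\<Sum>n. q ^ (n * (n + 1) div 2))"

fun cf_tail :: "real \<Rightarrow> nat \<Rightarrow> nat \<Rightarrow> real" where
  "cf_tail q n 0 = 1"
| "cf_tail q n (Suc k) = 1 + (q ^ n + q ^ (2 * n)) / cf_tail q (Suc n) k"

definition cubic_cf_approx :: "real \<Rightarrow> nat \<Rightarrow> real" where
  "cubic_cf_approx q N = root 3 q / cf_tail q 1 N"

definition cubic_cf :: "real \<Rightarrow> real" where
  "cubic_cf q = lim (cubic_cf_approx q)"

end

(* Write N(q) = Sum_n (-1)^n q^(3n^2+2n), D(q) = Sum_n (-1)^n q^(3n^2) = phi(-q^3) over all integers n,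
   and u = V^3. A q-series A(x) with A(1) = D and (1 - q) A(q) = N satisfies a three-term recurrence
   whose successive quotients are the tails of the continued fraction, so V = q^(1/3) N/D.

   By the triple product N and D are eta quotients. Dissecting phi and psi modulo 3 and multiplying over
   the three cube roots of q gives 1 - 8u = (phi(-q)/phi(-q^3))^4 and 1 + u as eta quotients. The
   derivative of u is governed by the Wronskian of N and D, a double theta series which factors into
   two theta series of weight 3/2 after the rotation (m,n) -> (m+n, m-n) of the summation lattice.
   Both weight 3/2 series are eta quotients by Jacobi's identity for E^3, and
       u'/(1 - 8u) = psi^2(q) psi^2(q^3),   q u'/(u (1+u)) = phi^2(-q) phi^2(-q^3)
   follow. Integrate the first from 0 (where u = 0) and the second up to 1 (where u tends to 1/8). *)
theory Submission
  imports Defs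
begin

section \<open>The triple product identity\<close>

text \<open>The differential equation for u comes from series manipulations alone, without modular
  transformations. Since u = q (N/D)^3, one has u' = N^2/D^4 * (N D + 3q (N' D - N D')); so u' is an
  eta quotient as soon as the bracket is one, and this is why the Wronskian occurs together with the
  term N D. Both integrands are then read off from the same u', according to whether it is divided
  by 1 - 8u or by u (1 + u). The 8 is the cube of the 2 in the dissection of phi, and the 9 is the
  value of 1 + 1/u at u = 1/8. The cube roots of q force a detour through the complex numbers, so
  products and theta functions are developed over any complete real normed field, while weighted
  series and derivatives stay real. The limit of u as q tends to 1 rests on a comparison of the
  product factors of phi(-q) and phi(-q^3).\<close>

definition qfact :: "'a::{real_normed_field,banach} \<Rightarrow> nat \<Rightarrow> 'a" where
  "qfact p n = (\<Prod>k<n. 1 - p ^ Suc k)"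

text \<open>The product (p; p)_oo, that is, the eta function without its factor p^(1/24);
  \<open>qfact p n\<close> is its n-th partial product.\<close>

definition euler_prod :: "'a::{real_normed_field,banach} \<Rightarrow> 'a" where
  "euler_prod p = (\<Prod>k. 1 - p ^ Suc k)"

lemma qfact_0 [simp]: "qfact p 0 = 1"
  and qfact_Suc: "qfact p (Suc n) = qfact p n * (1 - p ^ Suc n)"
  by (simp_all add: qfact_def)

lemma one_minus_power_nonzero:
  fixes p :: "'a::{real_normed_field,banach}"
  assumes "norm p < 1"
  shows "1 - p ^ Suc k \<noteq> 0"
proof
  assume "1 - p ^ Suc k = 0"
  then have "norm (p ^ Suc k) = 1" by simp
  moreover have "norm (p ^ Suc k) < 1"
    using assms power_Suc_less_one[of "norm p" k] norm_ge_zero[of p]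
    by (metis norm_power not_less_iff_gr_or_eq power_0_Suc power_Suc_less_one zero_less_one less_eq_real_def)
  ultimately show False by simp
qed

lemma qfact_nonzero:
  fixes p :: "'a::{real_normed_field,banach}"
  assumes "norm p < 1"
  shows "qfact p n \<noteq> 0"
  using one_minus_power_nonzero[OF assms] by (simp add: qfact_def)

lemma convergent_prod_euler:
  fixes p :: "'a::{real_normed_field,banach}"
  assumes "norm p < 1"
  shows "convergent_prod (\<lambda>k. 1 - p ^ Suc k)"
proof (intro abs_convergent_prod_imp_convergent_prod summable_imp_abs_convergent_prod)
  show "summable (\<lambda>k. norm (1 - p ^ Suc k - 1))"
    using assms by (simp add: norm_power norm_mult summable_mult summable_geometric)
qed

lemma euler_prod_nonzero:
  fixes p :: "'a::{real_normed_field,banach}"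
  assumes "norm p < 1"
  shows "euler_prod p \<noteq> 0"
  unfolding euler_prod_def
  using convergent_prod_euler[OF assms] one_minus_power_nonzero[OF assms]
  by (intro prodinf_nonzero) auto

lemma qfact_tendsto:
  fixes p :: "'a::{real_normed_field,banach}"
  assumes "norm p < 1"
  shows "qfact p \<longlonglongrightarrow> euler_prod p"
proof -
  have "(\<lambda>n. \<Prod>k\<le>n. 1 - p ^ Suc k) \<longlonglongrightarrow> euler_prod p"
    unfolding euler_prod_def by (rule convergent_prod_LIMSEQ[OF convergent_prod_euler[OF assms]])
  then have "(\<lambda>n. qfact p (Suc n)) \<longlonglongrightarrow> euler_prod p"
    by (simp add: qfact_def lessThan_Suc_atMost)
  then show ?thesis by (rule LIMSEQ_imp_Suc)
qed

lemma euler_prod_of_real: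
  fixes x :: real
  assumes "\<bar>x\<bar> < 1"
  shows "euler_prod (of_real x :: complex) = of_real (euler_prod x)"
proof -
  have "qfact (of_real x :: complex) = (\<lambda>n. of_real (qfact x n))"
    by (simp add: qfact_def fun_eq_iff)
  moreover have "(\<lambda>n. of_real (qfact x n) :: complex) \<longlonglongrightarrow> of_real (euler_prod x)"
    by (intro tendsto_of_real qfact_tendsto) (use assms in auto)
  moreover have "qfact (of_real x :: complex) \<longlonglongrightarrow> euler_prod (of_real x)"
    by (rule qfact_tendsto) (use assms in auto)
  ultimately show ?thesis by (metis LIMSEQ_unique)
qed

text \<open>The limit of \<open>qfact p\<close> is not 0, so the sequence and its inverse both
  converge and are bounded. The common bound later dominates all Gaussian binomials at once.\<close>

lemma qfact_bounds:
  fixes p :: "'a::{real_normed_field,banach}"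
  assumes "norm p < 1"
  obtains B where "B > 0" "\<And>n. norm (qfact p n) \<le> B" "\<And>n. norm (inverse (qfact p n)) \<le> B"
proof -
  have "Bseq (qfact p)"
    using qfact_tendsto[OF assms] convergentI convergent_imp_Bseq by blast
  moreover have "Bseq (\<lambda>n. inverse (qfact p n))"
    using tendsto_inverse[OF qfact_tendsto[OF assms] euler_prod_nonzero[OF assms]]
      convergentI convergent_imp_Bseq by blast
  ultimately obtain B C where "B > 0" "\<And>n. norm (qfact p n) \<le> B" "\<And>n. norm (inverse (qfact p n)) \<le> C"
    unfolding Bseq_def by blast
  then show ?thesis by (intro that[of "max B C"]) (auto simp: le_max_iff_disj)
qed

text \<open>The Gaussian binomial coefficient \<open>2N\<close> over \<open>N - k\<close>.\<close>
definition central_qbinomial :: "'a::{real_normed_field,banach} \<Rightarrow> nat \<Rightarrow> nat \<Rightarrow> 'a" where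
  "central_qbinomial p N k =
     (if k \<le> N then qfact p (2 * N) / (qfact p (N + k) * qfact p (N - k)) else 0)"

text \<open>Two q-Pascal steps in one. Passing from N to N + 1 multiplies the product by (1 + a
  p^N)(1 + b p^N) = 1 + p^(2N+1) + (a + b) p^N with p = a b, so the coefficient at k + 1 is fed by
  the indices k, k + 1 and k + 2 only.\<close>

lemma central_qbinomial_Suc:
  fixes p :: "'a::{real_normed_field,banach}"
  assumes p: "norm p < 1" and k: "Suc k \<le> Suc N"
  shows "central_qbinomial p (Suc N) (Suc k) = (1 + p ^ (2 * N + 1)) * central_qbinomial p N (Suc k)
           + p ^ (N - k) * central_qbinomial p N k
           + p ^ (N + k + 2) * central_qbinomial p N (k + 2)"
proof -
  note nz = qfact_nonzero[OF p] one_minus_power_nonzero[OF p]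
  have exp2: "2 * Suc N = Suc (Suc (2 * N))" by simp
  \<comment> \<open>The two boundary cases are those in which a neighbouring coefficient falls
    outside the range and is 0. In the generic case the claim is an identity of rational functions
    in x = p^(N+k), y = p^m and p.\<close>
  consider "k = N" | "Suc k = N" | m where "N = k + 2 + m"
    using k by (metis Suc_leI add_2_eq_Suc' le_Suc_ex le_less less_antisym Suc_le_mono add_Suc)
  then show ?thesis
  proof cases
    case 1
    then have "k = N" by simp
    moreover have "N + N = 2 * N" by simp
    ultimately show ?thesis
      using nz by (simp add: central_qbinomial_def exp2 mult_2[symmetric] del: mult_Suc_right)
  next
    case 2
    define x where "x = p ^ (2 * k + 2)"
    define G where "G = qfact p (2 * k + 1)"
    have q: "qfact p (2 * Suc N) = G * (1 - x) * (1 - x * p) * (1 - x * p^2)"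
      "qfact p (Suc N + Suc k) = G * (1 - x) * (1 - x * p)" "qfact p (2 * N) = G * (1 - x)"
      "qfact p (N + Suc k) = G * (1 - x)" "qfact p (N + k) = G"
      "qfact p (Suc N - Suc k) = 1 - p" "qfact p (N - k) = 1 - p" "qfact p (N - Suc k) = 1"
      using 2 by (auto simp: G_def x_def qfact_Suc eval_nat_numeral mult_2 mult_ac)
    have nz1: "G \<noteq> 0" "1 - x \<noteq> 0" "1 - x * p \<noteq> 0" "1 - p \<noteq> 0"
      using nz(1) nz(2)[of "2 * k + 1"] nz(2)[of "2 * k + 2"] nz(2)[of 0]
      by (simp_all add: G_def x_def mult_ac)
    have pw: "p ^ (2 * N + 1) = x * p" "p ^ (N - k) = p"
      using 2 by (auto simp: x_def mult_ac)
    have "central_qbinomial p (Suc N) (Suc k) = (1 - x * p^2) / (1 - p)"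
      "central_qbinomial p N (Suc k) = 1" "central_qbinomial p N k = (1 - x) / (1 - p)"
      "central_qbinomial p N (k + 2) = 0"
      unfolding central_qbinomial_def q using 2 nz1 by auto
    moreover have "(1 - x * p^2) / (1 - p) = (1 + x * p) * 1 + p * ((1 - x) / (1 - p)) + p ^ (N + k + 2) * 0"
      using nz1(4) by (simp add: field_simps power2_eq_square)
    ultimately show ?thesis unfolding pw by metis
  next
    case 3
    let ?K = "2 * k + m + 2"
    have e: "2 * N = ?K + m + 2" "N + k = ?K" "N + Suc k = Suc ?K" "Suc N + Suc k = Suc (Suc (?K))"
      "N + (k+2) = Suc (Suc ?K)" "N - k = Suc (Suc m)" "N - Suc k = Suc m" "N - (k + 2) = m"
      "Suc N - Suc k = Suc (Suc m)" "2 * Suc N = Suc (Suc (2*N))" using 3 by auto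
    have f: "Suc k \<le> Suc N" "k \<le> N" "Suc k \<le> N" "k + 2 \<le> N" using 3 by auto
    have "2 * N + 1 = (?K + m) + 3" "N - k = m + 2" "N + k + 2 = ?K + 2" using 3 by auto
    then have pw: "p ^ (2 * N + 1) = p ^ (?K + m) * p ^ 3" "p ^ (N - k) = p ^ m * p^2" "p ^ (N + k + 2) = p ^ ?K * p^2"
      by (simp_all only: power_add)
    define x where "x = p ^ ?K"
    define y where "y = p ^ m"
    have q: "qfact p (2 * Suc N) = qfact p (2 * N) * (1 - x * y * p ^ 3) * (1 - x * y * p ^ 4)"
    proof -
      have "Suc (2 * N) = ?K + m + 3" "Suc (Suc (2 * N)) = ?K + m + 4" using 3 by auto
      then have "p ^ Suc (2 * N) = x * y * p ^ 3" "p ^ Suc (Suc (2 * N)) = x * y * p ^ 4"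
        unfolding x_def y_def by (simp_all only: power_add)
      then show ?thesis unfolding e(10) qfact_Suc by simp
    qed
    have q2: "qfact p (Suc ?K) = qfact p ?K * (1 - x * p)" "qfact p (Suc (Suc ?K)) = qfact p ?K * (1 - x * p) * (1 - x * p^2)"
      "qfact p (Suc m) = qfact p m * (1 - y * p)" "qfact p (Suc (Suc m)) = qfact p m * (1 - y * p) * (1 - y * p^2)"
      by (simp_all add: qfact_Suc x_def y_def eval_nat_numeral mult_ac)
    have nz1: "1 - x * p \<noteq> 0" "1 - x * p^2 \<noteq> 0" "1 - y * p \<noteq> 0" "1 - y * p^2 \<noteq> 0"
      using nz(2)[of ?K] nz(2)[of "Suc ?K"] nz(2)[of m] nz(2)[of "Suc m"]
      by (auto simp: x_def y_def eval_nat_numeral mult_ac)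
    define F where "F = qfact p (2*N) / (qfact p ?K * qfact p m)"
    have c1: "central_qbinomial p (Suc N) (Suc k) = F * ((1 - x * y * p ^ 3) * (1 - x * y * p ^ 4) / ((1 - x * p) * (1 - x * p^2) * ((1 - y * p) * (1 - y * p^2))))"
      unfolding central_qbinomial_def F_def using f by (simp only: e(4,9) q q2 if_True) (simp add: mult_ac)
    have c2: "central_qbinomial p N (Suc k) = F * (1 / ((1 - x * p) * (1 - y * p)))"
      unfolding central_qbinomial_def F_def using f by (simp only: e(3,7) q2 if_True) (simp add: mult_ac)
    have c3: "central_qbinomial p N k = F * (1 / ((1 - y * p) * (1 - y * p^2)))"
      unfolding central_qbinomial_def F_def using f by (simp only: e(2,6) q2 if_True) (simp add: mult_ac)
    have c4: "central_qbinomial p N (k+2) = F * (1 / ((1 - x * p) * (1 - x * p^2)))"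
      unfolding central_qbinomial_def F_def using f by (simp only: e(5,8) q2 if_True) (simp add: mult_ac)
    have "(1 - x * y * p ^ 3) * (1 - x * y * p ^ 4) / ((1 - x * p) * (1 - x * p^2) * ((1 - y * p) * (1 - y * p^2)))
       = (1 + x * y * p ^ 3) * (1 / ((1 - x * p) * (1 - y * p))) + y * p^2 * (1 / ((1 - y * p) * (1 - y * p^2)))
         + x * p^2 * (1 / ((1 - x * p) * (1 - x * p^2)))"
    proof -
      have "(1 - x * y * p ^ 3) * (1 - x * y * p ^ 4) = (1 + x * y * p ^ 3) * ((1 - x * p^2) * (1 - y * p^2)) + y * p^2 * ((1 - x * p) * (1 - x * p^2)) + x * p^2 * ((1 - y * p) * (1 - y * p^2))"
        by (simp add: algebra_simps eval_nat_numeral)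
      moreover have "(u * (B * D) + v * (A * B) + w * (C * D)) / (A * B * (C * D)) = u * (1 / (A * C)) + v * (1 / (C * D)) + w * (1 / (A * B))"
        if "A \<noteq> 0" "B \<noteq> 0" "C \<noteq> 0" "D \<noteq> 0" for A B C D u v w :: 'a
        using that by (simp add: add_divide_distrib)
      ultimately show ?thesis using nz1 by presburger
    qed
    then show ?thesis
      unfolding c1 c2 c3 c4 pw power_add[of p ?K m] x_def[symmetric] y_def[symmetric]
      by (simp add: algebra_simps)
  qed
qed

text \<open>At index 0 the neighbours 1 and -1 carry the same coefficient, hence the factor
  2.\<close>

lemma central_qbinomial_Suc_0:
  fixes p :: "'a::{real_normed_field,banach}"
  assumes p: "norm p < 1"
  shows "central_qbinomial p (Suc N) 0 =
           (1 + p ^ (2 * N + 1)) * central_qbinomial p N 0 + 2 * p ^ (N + 1) * central_qbinomial p N 1"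
proof (cases N)
  case 0
  have "(1 - p) * (1 + p) = 1 - p ^ 2" by (simp add: algebra_simps power2_eq_square)
  then show ?thesis
    using 0 one_minus_power_nonzero[OF p, of 0]
    by (simp add: central_qbinomial_def qfact_def eval_nat_numeral divide_simps) (simp add: algebra_simps)
next
  case (Suc M)
  define y where "y = p ^ N"
  define g where "g = qfact p M"
  define Q where "Q = qfact p (2 * N)"
  have q: "qfact p (2 * Suc N) = Q * (1 - y\<^sup>2 * p) * (1 - y\<^sup>2 * p\<^sup>2)"
  proof -
    have "Suc (2 * N) = N * 2 + 1" "Suc (Suc (2 * N)) = N * 2 + 2" "2 * Suc N = Suc (Suc (2 * N))" by auto
    then have "p ^ Suc (2 * N) = y\<^sup>2 * p" "p ^ Suc (Suc (2 * N)) = y\<^sup>2 * p\<^sup>2" "2 * Suc N = Suc (Suc (2 * N))"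
      unfolding y_def by (simp_all only: power_add power_mult power_one_right)
    then show ?thesis by (simp only: Q_def qfact_Suc mult.assoc)
  qed
  have q2: "qfact p N = g * (1 - y)" "qfact p (Suc N) = g * (1 - y) * (1 - y * p)"
    using Suc by (simp_all add: g_def y_def qfact_Suc mult_ac)
  have nz1: "g \<noteq> 0" "1 - y \<noteq> 0" "1 - y * p \<noteq> 0"
    using Suc qfact_nonzero[OF p] one_minus_power_nonzero[OF p, of M] one_minus_power_nonzero[OF p, of N]
    by (simp_all add: g_def y_def mult_ac)
  define F where "F = Q / (g\<^sup>2 * (1 - y))"
  have c: "central_qbinomial p (Suc N) 0 = F * ((1 - y\<^sup>2 * p) * (1 - y\<^sup>2 * p\<^sup>2) / ((1 - y) * (1 - y * p)\<^sup>2))"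
    "central_qbinomial p N 0 = F * (1 / (1 - y))"
    "central_qbinomial p N 1 = F * (1 / (1 - y * p))"
  proof -
    have "qfact p (N + 0) = g * (1 - y)" "qfact p (N - 0) = g * (1 - y)" "qfact p (N + 1) = g * (1 - y) * (1 - y * p)"
      "qfact p (N - 1) = g" "qfact p (Suc N + 0) = g * (1 - y) * (1 - y * p)" "qfact p (Suc N - 0) = g * (1 - y) * (1 - y * p)"
      "0 \<le> Suc N" "0 \<le> N" "1 \<le> N"
      using q2 Suc by (simp_all add: g_def)
    then show "central_qbinomial p (Suc N) 0 = F * ((1 - y\<^sup>2 * p) * (1 - y\<^sup>2 * p\<^sup>2) / ((1 - y) * (1 - y * p)\<^sup>2))"
    "central_qbinomial p N 0 = F * (1 / (1 - y))"
    "central_qbinomial p N 1 = F * (1 / (1 - y * p))"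
      using nz1 unfolding central_qbinomial_def F_def q Q_def[symmetric]
      by (simp_all only: if_True times_divide_times_eq power2_eq_square mult_1_right mult_1_left mult_ac)
  qed
  have "(1 - y\<^sup>2 * p) * (1 - y\<^sup>2 * p\<^sup>2) / ((1 - y) * (1 - y * p)\<^sup>2)
      = (1 + y\<^sup>2 * p) * (1 / (1 - y)) + 2 * (y * p) * (1 / (1 - y * p))"
  proof -
    have "(1 - y\<^sup>2 * p) * (1 - y\<^sup>2 * p\<^sup>2) = ((1 + y\<^sup>2 * p) * (1 - y * p) + 2 * (y * p) * (1 - y)) * (1 - y * p)"
      by (simp add: algebra_simps eval_nat_numeral)
    then show ?thesis using nz1 by (simp add: divide_simps power2_eq_square)
  qed
  moreover have "p ^ (2 * N + 1) = y\<^sup>2 * p" "p ^ (N + 1) = y * p"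
    by (simp_all add: y_def power_mult[symmetric] mult_ac)
  ultimately show ?thesis by (simp only: c distrib_left mult_ac)
qed

text \<open>The terms of index \<open>k\<close> and \<open>-k\<close> of the bilateral series \<open>ftheta a b\<close> below, combined.\<close>
definition triple_term :: "'a::{real_normed_field,banach} \<Rightarrow> 'a \<Rightarrow> nat \<Rightarrow> 'a" where
  "triple_term a b k = (a * b) ^ (k choose 2) * (a ^ k + b ^ k)"

lemma Suc_choose_two: "Suc k choose 2 = (k choose 2) + k"
  by (simp add: eval_nat_numeral)

text \<open>The finite form of the triple product, by induction on N: (a + b) p^N times a term
  splits into multiples of its two neighbours, and the coefficient recurrences collect what arrives
  at each index.\<close>

lemma finite_triple_product:
  fixes a b :: "'a::{real_normed_field,banach}"
  defines "p \<equiv> a * b"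
  assumes p: "norm p < 1"
  shows "(\<Prod>k<N. (1 + a * p ^ k) * (1 + b * p ^ k)) =
           central_qbinomial p N 0 + (\<Sum>k<N. central_qbinomial p N (Suc k) * triple_term a b (Suc k))"
proof (induction N)
  case 0
  show ?case by (simp add: central_qbinomial_def)
next
  case (Suc N)
  let ?c = "central_qbinomial p N" and ?T = "triple_term a b"
  have T: "(a + b) * ?T (Suc k) * p ^ N = p ^ (N - Suc k) * ?T (k + 2) + p ^ (N + k + 1) * ?T k" if "k < N" for k
  proof -
    have e: "p ^ N = p ^ (N - Suc k) * p ^ Suc k" using that by (simp add: power_add[symmetric] del: power_Suc)
    have "(a + b) * ?T (Suc k) * p ^ N = p ^ (Suc k choose 2) * p ^ N * (a ^ (k+2) + b ^ (k+2) + p * (a ^ k + b ^ k))"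
      by (simp add: triple_term_def p_def algebra_simps)
    also have "\<dots> = p ^ (N - Suc k) * (p ^ (Suc k choose 2) * p ^ Suc k * (a ^ (k+2) + b ^ (k+2))) + p ^ N * p ^ Suc k * (p ^ (k choose 2) * (a ^ k + b ^ k))"
    proof -
      have "p ^ (Suc k choose 2) = p ^ (k choose 2) * p ^ k" by (simp add: Suc_choose_two power_add mult_ac)
      then show ?thesis by (simp only: e power_Suc) (simp add: algebra_simps)
    qed
    also have "\<dots> = p ^ (N - Suc k) * ?T (k + 2) + p ^ (N + k + 1) * ?T k"
      by (simp add: triple_term_def p_def[symmetric] Suc_choose_two power_add mult_ac)
    finally show ?thesis .
  qed
  \<comment> \<open>Coefficients beyond N vanish, so that the sums may be lengthened to the range of
    the next stage.\<close>
  have z: "?c (Suc N) = 0" "?c (N + 2) = 0" by (simp_all add: central_qbinomial_def)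
  \<comment> \<open>The value 2 arises because a^0 and b^0 are both counted; it produces the factor
    2 in the recurrence at index 0.\<close>
  have T01: "?T 0 = 2" "?T (Suc 0) = a + b"
    by (simp_all add: triple_term_def eval_nat_numeral)
  have up: "?c 0 * p ^ N * ?T 1 + (\<Sum>k<N. ?c (Suc k) * (p ^ (N - Suc k) * ?T (k + 2))) = (\<Sum>k<Suc N. p ^ (N - k) * ?c k * ?T (Suc k))"
    by (subst sum.lessThan_Suc_shift) (simp add: mult_ac)
  have "(\<Sum>k<N. ?c (Suc k) * (p ^ (N + k + 1) * ?T k)) = (\<Sum>k<Suc (Suc N). ?c (Suc k) * (p ^ (N + k + 1) * ?T k))"
    using z by simp
  also have "\<dots> = 2 * p ^ (N + 1) * ?c 1 + (\<Sum>k<Suc N. p ^ (N + k + 2) * ?c (k + 2) * ?T (Suc k))"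
    by (subst sum.lessThan_Suc_shift) (simp add: T01 mult_ac)
  finally have down: "(\<Sum>k<N. ?c (Suc k) * (p ^ (N + k + 1) * ?T k)) = \<dots>" .
  have lin: "(a * p ^ N + b * p ^ N) * (?c 0 + (\<Sum>k<N. ?c (Suc k) * ?T (Suc k))) =
      2 * p ^ (N + 1) * ?c 1 + (\<Sum>k<Suc N. (p ^ (N - k) * ?c k + p ^ (N + k + 2) * ?c (k + 2)) * ?T (Suc k))"
  proof -
    have "(a * p ^ N + b * p ^ N) * (?c 0 + (\<Sum>k<N. ?c (Suc k) * ?T (Suc k))) =
       ?c 0 * p ^ N * ?T 1 + (\<Sum>k<N. ?c (Suc k) * ((a + b) * ?T (Suc k) * p ^ N))"
      by (simp add: T01 distrib_left distrib_right sum_distrib_left sum.distrib mult_ac)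
    also have "(\<Sum>k<N. ?c (Suc k) * ((a + b) * ?T (Suc k) * p ^ N)) =
       (\<Sum>k<N. ?c (Suc k) * (p ^ (N - Suc k) * ?T (k + 2))) + (\<Sum>k<N. ?c (Suc k) * (p ^ (N + k + 1) * ?T k))"
      unfolding sum.distrib[symmetric] by (intro sum.cong refl) (simp add: T distrib_left)
    finally show ?thesis unfolding down using up by (simp add: distrib_right sum.distrib add_ac)
  qed
  have ext: "?c 0 + (\<Sum>k<N. ?c (Suc k) * ?T (Suc k)) = ?c 0 + (\<Sum>k<Suc N. ?c (Suc k) * ?T (Suc k))"
    using z by simp
  have "(\<Prod>k<Suc N. (1 + a * p ^ k) * (1 + b * p ^ k)) =
     (?c 0 + (\<Sum>k<N. ?c (Suc k) * ?T (Suc k))) * (1 + p ^ (2 * N + 1) + (a * p ^ N + b * p ^ N))"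
  proof -
    have "(1 + a * x) * (1 + b * x) = 1 + x * x * (a * b) + (a * x + b * x)" for x by (simp add: algebra_simps)
    moreover have "p ^ N * p ^ N * (a * b) = p ^ (2 * N + 1)" by (simp add: p_def mult_2 power_add)
    ultimately have "(1 + a * p ^ N) * (1 + b * p ^ N) = 1 + p ^ (2 * N + 1) + (a * p ^ N + b * p ^ N)" by simp
    then show ?thesis unfolding prod.lessThan_Suc Suc.IH by (rule arg_cong)
  qed
  also have "\<dots> = (1 + p ^ (2 * N + 1)) * (?c 0 + (\<Sum>k<Suc N. ?c (Suc k) * ?T (Suc k))) +
     (2 * p ^ (N + 1) * ?c 1 + (\<Sum>k<Suc N. (p ^ (N - k) * ?c k + p ^ (N + k + 2) * ?c (k + 2)) * ?T (Suc k)))"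
    unfolding lin[symmetric] ext by (simp only: distrib_left mult.commute)
  also have "\<dots> = central_qbinomial p (Suc N) 0 + (\<Sum>k<Suc N. central_qbinomial p (Suc N) (Suc k) * ?T (Suc k))"
  proof -
    have "(\<Sum>k<Suc N. central_qbinomial p (Suc N) (Suc k) * ?T (Suc k)) =
       (\<Sum>k<Suc N. (1 + p ^ (2 * N + 1)) * (?c (Suc k) * ?T (Suc k)) + (p ^ (N - k) * ?c k + p ^ (N + k + 2) * ?c (k + 2)) * ?T (Suc k))"
      by (intro sum.cong refl, subst central_qbinomial_Suc[OF p]) (auto simp: algebra_simps)
    then show ?thesis
      unfolding central_qbinomial_Suc_0[OF p] sum.distrib sum_distrib_left[symmetric] by (simp only: distrib_left add_ac)
  qed
  finally show ?case .
qed

section \<open>Passage to the limit in the finite triple product\<close>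

lemma central_qbinomial_bounded:
  fixes p :: "'a::{real_normed_field,banach}"
  assumes "norm p < 1"
  obtains B where "B > 0" "\<And>N k. norm (central_qbinomial p N k) \<le> B"
proof -
  obtain C where C: "C > 0" "\<And>n. norm (qfact p n) \<le> C" "\<And>n. norm (inverse (qfact p n)) \<le> C"
    using qfact_bounds[OF assms] by metis
  have "norm (qfact p l) * (norm (inverse (qfact p m)) * norm (inverse (qfact p n))) \<le> C * (C * C)" for l m n
    using C by (intro mult_mono) (auto intro: mult_nonneg_nonneg less_imp_le)
  then have "norm (central_qbinomial p N k) \<le> C * (C * C)" for N k
    using C(1) by (simp add: central_qbinomial_def divide_inverse norm_mult)
  then show ?thesis using C(1) by (intro that[of "C * (C * C)"]) auto
qed

lemma central_qbinomial_tendsto: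
  fixes p :: "'a::{real_normed_field,banach}"
  assumes p: "norm p < 1"
  shows "(\<lambda>N. central_qbinomial p N k) \<longlonglongrightarrow> 1 / euler_prod p"
proof -
  have lim: "(\<lambda>N. qfact p (f N)) \<longlonglongrightarrow> euler_prod p" if "filterlim f sequentially sequentially" for f
    using qfact_tendsto[OF p] that by (rule filterlim_compose)
  have f1: "filterlim (\<lambda>N. N - k) sequentially sequentially" by (rule filterlim_minus_const_nat_at_top)
  have f2: "filterlim (\<lambda>N. N + k) sequentially sequentially" by (rule filterlim_add_const_nat_at_top)
  have f3: "filterlim (\<lambda>N. 2 * N) sequentially sequentially" by (rule mult_nat_left_at_top) simp
  have "(\<lambda>N. qfact p (2 * N) / (qfact p (N + k) * qfact p (N - k))) \<longlonglongrightarrow> euler_prod p / (euler_prod p * euler_prod p)"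
    using euler_prod_nonzero[OF p] by (intro tendsto_divide tendsto_mult lim f1 f2 f3) auto
  moreover have "\<forall>\<^sub>F N in sequentially. qfact p (2 * N) / (qfact p (N + k) * qfact p (N - k)) = central_qbinomial p N k"
    using eventually_ge_at_top[of k] by eventually_elim (simp add: central_qbinomial_def)
  ultimately show ?thesis
    using euler_prod_nonzero[OF p] by (auto dest: Lim_transform_eventually)
qed

text \<open>The quotient of consecutive terms is x^k y, which tends to 0 for every y.\<close>

lemma summable_power_choose_two:
  fixes x y :: real
  assumes "\<bar>x\<bar> < 1"
  shows "summable (\<lambda>k. norm (x ^ (k choose 2) * y ^ k))"
proof -
  have "(\<lambda>k. x ^ k * y) \<longlonglongrightarrow> 0 * y" using assms by (intro tendsto_intros) auto
  from order_tendstoD(2)[OF tendsto_norm[OF this], of "1/2"]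
  have "\<forall>\<^sub>F k in sequentially. norm (x ^ k * y) < 1/2" by simp
  then obtain K where K: "norm (x ^ k * y) < 1/2" if "k \<ge> K" for k
    unfolding eventually_sequentially by blast
  show ?thesis
  proof (rule summable_ratio_test[of "1/2" K])
    fix n assume "n \<ge> K"
    have "norm (x ^ (Suc n choose 2) * y ^ Suc n) = norm (x ^ n * y) * norm (x ^ (n choose 2) * y ^ n)"
      by (simp add: Suc_choose_two power_add abs_mult mult_ac)
    also have "\<dots> \<le> 1/2 * norm (x ^ (n choose 2) * y ^ n)"
      using K[OF \<open>n \<ge> K\<close>] by (intro mult_right_mono) auto
    finally show "norm (norm (x ^ (Suc n choose 2) * y ^ Suc n)) \<le> 1/2 * norm (norm (x ^ (n choose 2) * y ^ n))"
      by simp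
  qed simp
qed

lemma summable_triple_term:
  fixes a b :: "'a::{real_normed_field,banach}"
  assumes "norm (a * b) < 1"
  shows "summable (\<lambda>k. norm ((a * b) ^ (k choose 2) * a ^ k))" "summable (\<lambda>k. norm ((a * b) ^ (k choose 2) * b ^ k))"
proof -
  have "norm ((a * b) ^ m * c ^ k) = norm (norm (a * b) ^ m * norm c ^ k)" for m k and c :: 'a
    by (simp add: norm_mult norm_power)
  then show "summable (\<lambda>k. norm ((a * b) ^ (k choose 2) * a ^ k))" "summable (\<lambda>k. norm ((a * b) ^ (k choose 2) * b ^ k))"
    using summable_power_choose_two[of "norm (a * b)" "norm a"] summable_power_choose_two[of "norm (a * b)" "norm b"] assms
    by simp_all
qed

text \<open>Each coefficient of the finite form tends to 1/E with E = \<open>euler_prod p\<close>,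
  and the uniform bound on the coefficients lets Tannery's theorem exchange limit and sum. The
  additional factor \<open>qfact p N\<close> on the left tends to E and cancels this 1/E.\<close>

lemma triple_product_nat:
  fixes a b :: "'a::{real_normed_field,banach}"
  defines "p \<equiv> a * b"
  assumes p: "norm p < 1"
  shows "(\<lambda>N. \<Prod>k<N. (1 + a * p ^ k) * (1 + b * p ^ k) * (1 - p ^ Suc k)) \<longlonglongrightarrow> 1 + (\<Sum>k. triple_term a b (Suc k))"
proof -
  have E: "euler_prod p \<noteq> 0" by (rule euler_prod_nonzero[OF p])
  obtain B where B: "B > 0" "\<And>N k. norm (central_qbinomial p N k) \<le> B"
    using central_qbinomial_bounded[OF p] by metis
  define M where "M k = B * (norm (p ^ (Suc k choose 2) * a ^ Suc k) + norm (p ^ (Suc k choose 2) * b ^ Suc k))" for k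
  have "summable M"
    unfolding M_def
    using summable_triple_term[of a b, folded p_def, OF p, THEN summable_ignore_initial_segment, of 1]
    by (intro summable_mult summable_add) simp_all
  have Mb: "norm (central_qbinomial p N (Suc k) * triple_term a b (Suc k)) \<le> M k" for k N
  proof -
    have "norm (triple_term a b (Suc k)) \<le> norm (p ^ (Suc k choose 2) * a ^ Suc k) + norm (p ^ (Suc k choose 2) * b ^ Suc k)"
      unfolding triple_term_def p_def[symmetric] distrib_left by (rule norm_triangle_ineq)
    with B(1) B(2)[of N "Suc k"] show ?thesis
      unfolding M_def norm_mult[of "central_qbinomial p N (Suc k)"] by (intro mult_mono) simp_all
  qed
  have "(\<lambda>N. \<Sum>k. central_qbinomial p N (Suc k) * triple_term a b (Suc k)) \<longlonglongrightarrow> (\<Sum>k. 1 / euler_prod p * triple_term a b (Suc k))"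
  proof (rule tannerys_theorem[THEN conjunct2, THEN conjunct2])
    show "((\<lambda>N. central_qbinomial p N (Suc k) * triple_term a b (Suc k)) \<longlongrightarrow> 1 / euler_prod p * triple_term a b (Suc k)) sequentially" for k
      by (intro tendsto_mult central_qbinomial_tendsto p tendsto_const)
    show "\<forall>\<^sub>F (k, N) in sequentially \<times>\<^sub>F sequentially. norm (central_qbinomial p N (Suc k) * triple_term a b (Suc k)) \<le> M k"
      using Mb by (intro always_eventually) auto
  qed (use \<open>summable M\<close> in auto)
  moreover have "(\<Sum>k. central_qbinomial p N (Suc k) * triple_term a b (Suc k)) = (\<Sum>k<N. central_qbinomial p N (Suc k) * triple_term a b (Suc k))" for N
    by (rule suminf_finite) (auto simp: central_qbinomial_def)
  ultimately have "(\<lambda>N. central_qbinomial p N 0 + (\<Sum>k<N. central_qbinomial p N (Suc k) * triple_term a b (Suc k))) \<longlonglongrightarrow> 1 / euler_prod p + (\<Sum>k. 1 / euler_prod p * triple_term a b (Suc k))"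
    by (intro tendsto_add central_qbinomial_tendsto p) simp
  then have "(\<lambda>N. (\<Prod>k<N. (1 + a * p ^ k) * (1 + b * p ^ k)) * qfact p N) \<longlonglongrightarrow> (1 / euler_prod p + (\<Sum>k. 1 / euler_prod p * triple_term a b (Suc k))) * euler_prod p"
    using finite_triple_product[of a b] p qfact_tendsto[OF p] by (intro tendsto_mult) (simp_all add: p_def)
  moreover have "summable (\<lambda>k. triple_term a b (Suc k))"
  proof (rule summable_comparison_test'[of "\<lambda>k. 1 / B * M k" 0])
    show "summable (\<lambda>k. 1 / B * M k)" using \<open>summable M\<close> by (rule summable_mult)
    show "norm (triple_term a b (Suc n)) \<le> 1 / B * M n" for n
      using B(1) norm_triangle_ineq[of "p ^ (Suc n choose 2) * a ^ Suc n" "p ^ (Suc n choose 2) * b ^ Suc n"]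
      by (simp add: M_def triple_term_def p_def distrib_left)
  qed
  then have "(1 / euler_prod p + (\<Sum>k. 1 / euler_prod p * triple_term a b (Suc k))) * euler_prod p = 1 + (\<Sum>k. triple_term a b (Suc k))"
    using E suminf_mult[of "\<lambda>k. triple_term a b (Suc k)" "1 / euler_prod p"] by (simp add: distrib_right)
  ultimately show ?thesis by (simp add: prod.distrib qfact_def)
qed

section \<open>Bilateral series and the general theta function\<close>

lemma has_sum_int_nat:
  fixes f :: "int \<Rightarrow> 'a::{real_normed_vector,banach}"
  assumes "summable (\<lambda>k. norm (f (int k)))" "summable (\<lambda>k. norm (f (- int (Suc k))))"
  shows "(f has_sum ((\<Sum>k. f (int k)) + (\<Sum>k. f (- int (Suc k))))) UNIV"
proof -
  have b1: "bij_betw int UNIV {0..}"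
    by (rule bij_betwI[of _ _ _ nat]) auto
  have b2: "bij_betw (\<lambda>k. - int (Suc k)) UNIV {..<0}"
    by (rule bij_betwI[of _ _ _ "\<lambda>n. nat (- n - 1)"]) auto
  have "((\<lambda>k. f (int k)) has_sum (\<Sum>k. f (int k))) UNIV"
    by (rule norm_summable_imp_has_sum[OF assms(1) summable_sums[OF summable_norm_cancel[OF assms(1)]]])
  then have 1: "(f has_sum (\<Sum>k. f (int k))) {0..}"
    using has_sum_reindex_bij_betw[OF b1, of f] by simp
  have "((\<lambda>k. f (- int (Suc k))) has_sum (\<Sum>k. f (- int (Suc k)))) UNIV"
    by (rule norm_summable_imp_has_sum[OF assms(2) summable_sums[OF summable_norm_cancel[OF assms(2)]]])
  then have 2: "(f has_sum (\<Sum>k. f (- int (Suc k)))) {..<0}"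
    using has_sum_reindex_bij_betw[OF b2, of f] by simp
  have "{0..} \<union> {..<0::int} = UNIV" "{0..} \<inter> {..<0::int} = {}" by auto
  then show ?thesis using has_sum_Un_disjoint[OF 1 2] by simp
qed

text \<open>Ramanujan's general theta function \<open>f(a,b)\<close>; both exponents are natural numbers, so no
  inverses of \<open>a\<close> and \<open>b\<close> are needed.\<close>
definition ftheta :: "'a::{real_normed_field,banach} \<Rightarrow> 'a \<Rightarrow> 'a" where
  "ftheta a b = (\<Sum>\<^sub>\<infinity>n::int. a ^ nat (n * (n + 1) div 2) * b ^ nat (n * (n - 1) div 2))"

lemma nat_triangular:
  "nat (int k * (int k + 1) div 2) = Suc k choose 2" "nat (int k * (int k - 1) div 2) = k choose 2"
proof -
  have "int (Suc k choose 2) = int k * (int k + 1) div 2"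
    by (simp add: choose_two zdiv_int algebra_simps)
  then show "nat (int k * (int k + 1) div 2) = Suc k choose 2" by linarith
  have "int (k choose 2) = int k * (int k - 1) div 2"
    by (cases k) (simp_all add: choose_two zdiv_int algebra_simps)
  then show "nat (int k * (int k - 1) div 2) = k choose 2" by linarith
qed

lemma ftheta_has_sum:
  fixes a b :: "'a::{real_normed_field,banach}"
  assumes p: "norm (a * b) < 1"
  shows "((\<lambda>n::int. a ^ nat (n * (n + 1) div 2) * b ^ nat (n * (n - 1) div 2)) has_sum ftheta a b) UNIV"
    and "ftheta a b = 1 + (\<Sum>k. triple_term a b (Suc k))"
proof -
  let ?f = "\<lambda>n::int. a ^ nat (n * (n + 1) div 2) * b ^ nat (n * (n - 1) div 2)"
  have pos: "?f (int k) = (a * b) ^ (k choose 2) * a ^ k" for k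
    by (simp add: nat_triangular Suc_choose_two power_add power_mult_distrib mult_ac)
  have neg: "?f (- int k) = (a * b) ^ (k choose 2) * b ^ k" for k
  proof -
    have "- int k * (- int k + 1) = int k * (int k - 1)" "- int k * (- int k - 1) = int k * (int k + 1)"
      by (simp_all add: algebra_simps)
    then have "?f (- int k) = a ^ (k choose 2) * b ^ (Suc k choose 2)" by (simp only: nat_triangular)
    then show ?thesis by (simp add: Suc_choose_two power_add power_mult_distrib mult_ac)
  qed
  note s = summable_triple_term[OF p]
  have s': "summable (\<lambda>k. norm (?f (- int (Suc k))))"
    unfolding neg using s(2)[THEN summable_ignore_initial_segment, of 1] by simp
  have "(?f has_sum ((\<Sum>k. ?f (int k)) + (\<Sum>k. ?f (- int (Suc k))))) UNIV"
    by (rule has_sum_int_nat) (use s s' in \<open>simp_all only: pos neg\<close>)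
  then have hs: "(?f has_sum ((\<Sum>k. (a * b) ^ (k choose 2) * a ^ k) + (\<Sum>k. (a * b) ^ (Suc k choose 2) * b ^ Suc k))) UNIV"
    by (simp only: pos neg)
  then show "(?f has_sum ftheta a b) UNIV"
    unfolding ftheta_def by (intro has_sum_infsum) (rule has_sum_imp_summable)
  have "ftheta a b = (\<Sum>k. (a * b) ^ (k choose 2) * a ^ k) + (\<Sum>k. (a * b) ^ (Suc k choose 2) * b ^ Suc k)"
    unfolding ftheta_def using hs by (rule infsumI)
  also have "(\<Sum>k. (a * b) ^ (k choose 2) * a ^ k) = 1 + (\<Sum>k. (a * b) ^ (Suc k choose 2) * a ^ Suc k)"
    using suminf_split_head[OF summable_norm_cancel[OF s(1)]] by (simp add: binomial_eq_0)
  finally show "ftheta a b = 1 + (\<Sum>k. triple_term a b (Suc k))"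
  proof -
    have s1: "summable (\<lambda>k. (a * b) ^ (Suc k choose 2) * a ^ Suc k)" "summable (\<lambda>k. (a * b) ^ (Suc k choose 2) * b ^ Suc k)"
      using s[THEN summable_norm_cancel, THEN summable_ignore_initial_segment, of 1] by simp_all
    assume "ftheta a b = 1 + (\<Sum>k. (a * b) ^ (Suc k choose 2) * a ^ Suc k) + (\<Sum>k. (a * b) ^ (Suc k choose 2) * b ^ Suc k)"
    then show ?thesis
      unfolding triple_term_def distrib_left using suminf_add[OF s1] by simp
  qed
qed

theorem triple_product:
  fixes a b :: "'a::{real_normed_field,banach}"
  assumes "norm (a * b) < 1"
  shows "(\<lambda>N. \<Prod>k<N. (1 + a * (a * b) ^ k) * (1 + b * (a * b) ^ k) * (1 - (a * b) ^ Suc k)) \<longlonglongrightarrow> ftheta a b"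
  unfolding ftheta_has_sum(2)[OF assms] by (rule triple_product_nat[OF assms])

section \<open>Jacobi's identity and eta products\<close>

text \<open>The finite triple product with \<open>a = -z\<close>, \<open>b = -q/z\<close> contains the factor \<open>1 - z\<close>;
  compare the derivatives of both sides at \<open>z = 1\<close>.\<close>
lemma finite_jacobi:
  fixes q :: real
  assumes q: "\<bar>q\<bar> < 1"
  shows "(\<Sum>k<Suc M. central_qbinomial q (Suc M) (Suc k) *
            ((-1) ^ k * real (Suc k) * (q ^ (Suc k choose 2) - q ^ (Suc (Suc k) choose 2)))) = qfact q M * qfact q (Suc M)"
proof -
  let ?N = "Suc M"
  \<comment> \<open>The factor 1 - z has index 0 in the left product; it is split off, so that
    product has one factor fewer than the right one.\<close>
  define H where "H z = (\<Prod>k<M. 1 - z * q ^ Suc k) * (\<Prod>k<?N. 1 - (q / z) * q ^ k)" for z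
  define F where "F z = central_qbinomial q ?N 0 + (\<Sum>k<?N. central_qbinomial q ?N (Suc k) *
      (q ^ (Suc k choose 2) * ((- z) ^ Suc k + (- (q / z)) ^ Suc k)))" for z
  have FH: "F z = (1 - z) * H z" if "z \<noteq> 0" for z
  proof -
    have p: "(- z) * (- (q / z)) = q" using that by simp
    have "F z = (\<Prod>k<?N. (1 + - z * q ^ k) * (1 + - (q / z) * q ^ k))"
      using finite_triple_product[of "- z" "- (q / z)" ?N] q unfolding p by (simp add: F_def triple_term_def that)
    also have "\<dots> = (1 - z) * H z"
      unfolding H_def prod.distrib by (subst prod.lessThan_Suc_shift) simp
    finally show ?thesis .
  qed
  have "DERIV F 1 :> - H 1"
  proof -
    have "DERIV (\<lambda>z. (1 - z) * H z) 1 :> - H 1"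
      \<comment> \<open>Caratheodory's criterion: F(z) - F(1) is (z - 1) times the function -H,
        which is continuous at 1. The derivative at 1 is therefore -H(1), and the product H need not
        be differentiated.\<close>
      unfolding CARAT_DERIV
    proof (intro exI[of _ "\<lambda>z. - H z"] conjI allI)
      show "isCont (\<lambda>z. - H z) 1"
        unfolding H_def by (intro continuous_intros) auto
    qed (simp_all add: algebra_simps)
    then show ?thesis
      by (rule has_field_derivative_transform_within_open[of _ _ _ "{0<..}"]) (auto simp: FH)
  qed
  moreover have "DERIV F 1 :> (\<Sum>k<?N. central_qbinomial q ?N (Suc k) *
      (q ^ (Suc k choose 2) * (real (Suc k) * (-1) ^ Suc k - real (Suc k) * (-1) ^ Suc k * q ^ Suc k)))"
  proof -
    have d: "((\<lambda>z. (- z) ^ Suc k + (- (q / z)) ^ Suc k) has_real_derivative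
        (real (Suc k) * (-1) ^ Suc k - real (Suc k) * (-1) ^ Suc k * q ^ Suc k)) (at 1)" for k
    proof -
      have 1: "((\<lambda>z. - z) has_real_derivative - 1) (at 1)" "((\<lambda>z. - (q / z)) has_real_derivative q) (at 1)"
        by (auto intro!: derivative_eq_intros)
      have pm: "(- q) ^ k = (-1) ^ k * q ^ k" by (rule power_minus)
      show ?thesis
        by (rule DERIV_cong[OF DERIV_add[OF DERIV_power_Suc[OF 1(1)] DERIV_power_Suc[OF 1(2)]]]) (simp add: pm)
    qed
    show ?thesis
      unfolding F_def
      by (rule DERIV_cong[OF DERIV_add[OF DERIV_const DERIV_sum[OF DERIV_cmult[OF DERIV_cmult[OF d]]]]]) simp
  qed
  ultimately have "- H 1 = (\<Sum>k<?N. central_qbinomial q ?N (Suc k) *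
      (q ^ (Suc k choose 2) * (real (Suc k) * (-1) ^ Suc k - real (Suc k) * (-1) ^ Suc k * q ^ Suc k)))"
    by (rule DERIV_unique)
  also have "\<dots> = - (\<Sum>k<?N. central_qbinomial q ?N (Suc k) *
            ((-1) ^ k * real (Suc k) * (q ^ (Suc k choose 2) - q ^ (Suc (Suc k) choose 2))))"
    unfolding sum_negf[symmetric]
    by (intro sum.cong refl) (simp add: Suc_choose_two[of "Suc _"] power_add algebra_simps del: of_nat_Suc)
  finally show ?thesis by (simp add: H_def qfact_def)
qed

lemma summable_linear_power_choose_two:
  fixes q :: real
  assumes "\<bar>q\<bar> < 1"
  shows "summable (\<lambda>k. real (Suc k) * norm (q ^ (k choose 2)))"
proof (rule summable_comparison_test'[of "\<lambda>k. norm (q ^ (k choose 2) * 2 ^ k)" 0])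
  show "summable (\<lambda>k. norm (q ^ (k choose 2) * 2 ^ k))"
    using summable_power_choose_two[OF assms] .
  have "real (Suc k) \<le> 2 ^ k" for k
    by (induction k) auto
  then show "norm (real (Suc k) * norm (q ^ (k choose 2))) \<le> norm (q ^ (k choose 2) * 2 ^ k)" for k
    by (simp add: abs_mult mult.commute[of "\<bar>q ^ _\<bar>"] mult_right_mono del: of_nat_Suc)
qed

text \<open>The limit of \<open>finite_jacobi\<close> gives a series with weight k + 1 on the
  differences t_k - t_(k+1). Summation by parts turns this into weight (k + 1) + k = 2k + 1 on t_k,
  and the boundary term n t_n tends to 0.\<close>

theorem jacobi_cube_sums:
  fixes q :: real
  assumes q: "\<bar>q\<bar> < 1"
  shows "(\<lambda>k. (-1) ^ k * real (2 * k + 1) * q ^ (Suc k choose 2)) sums (euler_prod q ^ 3)"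
proof -
  define t where "t k = q ^ (Suc k choose 2)" for k
  define d where "d k = (-1) ^ k * real (Suc k) * (t k - t (Suc k))" for k
  have q': "norm q < 1" using q by simp
  obtain B where B: "B > 0" "\<And>N k. norm (central_qbinomial q N k) \<le> B"
    using central_qbinomial_bounded[OF q'] by metis
  have s0: "summable (\<lambda>k. real (Suc k) * norm (q ^ (k choose 2)))"
    by (rule summable_linear_power_choose_two[OF q])
  from s0[THEN summable_ignore_initial_segment, of 1]
  have s1: "summable (\<lambda>k. real (k + 2) * norm (t k))" by (simp add: t_def add_ac)
  from s0[THEN summable_ignore_initial_segment, of 2]
  have s2: "summable (\<lambda>k. real (k + 3) * norm (t (Suc k)))" by (simp add: t_def numeral_2_eq_2 numeral_3_eq_3 add_ac)
  define M where "M k = B * (real (k + 2) * norm (t k) + real (k + 3) * norm (t (Suc k)))" for k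
  have "summable M" unfolding M_def by (intro summable_mult summable_add s1 s2)
  have dM: "norm (d k) \<le> real (k + 2) * norm (t k) + real (k + 3) * norm (t (Suc k))" for k
  proof -
    have "norm (d k) = real (Suc k) * norm (t k - t (Suc k))" by (simp add: d_def abs_mult)
    also have "\<dots> \<le> real (Suc k) * (norm (t k) + norm (t (Suc k)))"
      by (intro mult_left_mono norm_triangle_ineq4) simp
    also have "\<dots> \<le> real (k + 2) * norm (t k) + real (k + 3) * norm (t (Suc k))"
      unfolding distrib_left by (intro add_mono mult_right_mono) auto
    finally show ?thesis .
  qed
  have Mb: "norm (central_qbinomial q N (Suc k) * d k) \<le> M k" for N k
    unfolding M_def norm_mult using B dM by (intro mult_mono) auto
  have "(\<lambda>N. \<Sum>k. central_qbinomial q N (Suc k) * d k) \<longlonglongrightarrow> (\<Sum>k. 1 / euler_prod q * d k)"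
  proof (rule tannerys_theorem[THEN conjunct2, THEN conjunct2])
    show "((\<lambda>N. central_qbinomial q N (Suc k) * d k) \<longlongrightarrow> 1 / euler_prod q * d k) sequentially" for k
      by (intro tendsto_mult central_qbinomial_tendsto q' tendsto_const)
    show "\<forall>\<^sub>F (k, N) in sequentially \<times>\<^sub>F sequentially. norm (central_qbinomial q N (Suc k) * d k) \<le> M k"
      using Mb by (intro always_eventually) auto
  qed (use \<open>summable M\<close> in auto)
  from LIMSEQ_Suc[OF this]
  have "(\<lambda>N. \<Sum>k. central_qbinomial q (Suc N) (Suc k) * d k) \<longlonglongrightarrow> (\<Sum>k. 1 / euler_prod q * d k)" .
  moreover have "(\<Sum>k. central_qbinomial q (Suc N) (Suc k) * d k) = qfact q N * qfact q (Suc N)" for N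
  proof -
    have "(\<Sum>k. central_qbinomial q (Suc N) (Suc k) * d k) = (\<Sum>k<Suc N. central_qbinomial q (Suc N) (Suc k) * d k)"
      by (rule suminf_finite) (auto simp: central_qbinomial_def)
    then show ?thesis using finite_jacobi[OF q, of N] by (simp add: d_def t_def)
  qed
  moreover have "(\<lambda>N. qfact q N * qfact q (Suc N)) \<longlonglongrightarrow> euler_prod q * euler_prod q"
    by (intro tendsto_mult qfact_tendsto q' LIMSEQ_Suc)
  ultimately have "(\<Sum>k. 1 / euler_prod q * d k) = euler_prod q * euler_prod q"
    by (simp add: LIMSEQ_unique)
  moreover have sd: "summable d"
    by (rule summable_comparison_test'[OF summable_add[OF s1 s2], of 0]) (use dM in simp)
  ultimately have d: "d sums (euler_prod q ^ 3)"
    using euler_prod_nonzero[OF q'] suminf_mult[OF sd, of "1 / euler_prod q"]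
    by (simp add: sums_iff field_simps power3_eq_cube)
  have part: "(\<Sum>k<n. (-1) ^ k * real (2 * k + 1) * t k) = (\<Sum>k<n. d k) - (-1) ^ n * real n * t n" for n
    by (induction n) (simp_all add: d_def algebra_simps)
  have z: "(\<lambda>n. real n * norm (t n)) \<longlonglongrightarrow> 0"
    using summable_LIMSEQ_zero[OF s1] by (rule metric_tendsto_imp_tendsto) (auto intro!: always_eventually mult_right_mono simp: abs_mult)
  have "(\<lambda>n. (-1) ^ n * real n * t n) \<longlonglongrightarrow> 0"
    by (rule tendsto_norm_zero_cancel) (use z in \<open>simp add: abs_mult\<close>)
  from tendsto_diff[OF d[unfolded sums_def] this] show ?thesis
    unfolding sums_def part[symmetric] by (simp add: t_def)
qed

section \<open>Theta functions as eta quotients, compared block by block\<close>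

lemma qfact_mult:
  "qfact x (N * k) = (\<Prod>m<N. \<Prod>j<k. 1 - x ^ (m * k + j + 1))"
proof (induction N)
  case (Suc N)
  have "qfact x (N * k + j) = qfact x (N * k) * (\<Prod>i<j. 1 - x ^ (N * k + i + 1))" for j
    by (induction j) (simp_all add: qfact_Suc mult_ac)
  then show ?case using Suc by (simp add: add.commute[of k])
qed simp

lemma euler_prod_subseq:
  fixes x :: "'a::{real_normed_field,banach}"
  assumes "norm x < 1" "k > 0"
  shows "(\<lambda>N. qfact x (N * k)) \<longlonglongrightarrow> euler_prod x"
  using filterlim_compose[OF qfact_tendsto[OF assms(1)] mult_nat_right_at_top[OF assms(2)]] .

lemma norm_power_less_one:
  fixes x :: "'a::{real_normed_field,banach}"
  assumes "norm x < 1" "k > 0"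
  shows "norm (x ^ k) < 1"
  using assms by (simp add: norm_power power_less_one_iff)

text \<open>Products in different bases are cut into blocks of exponents, k being the number of the
  block and m its length. After this normalisation every factor of a block is built from a monomial
  in y = x^k and x, so that two blocks agree by commutativity.\<close>

lemma power_blocks:
  fixes x y :: "'a::comm_monoid_mult"
  assumes y: "y = x ^ k"
  shows "x ^ (k * m + j + 1) = y ^ m * x ^ (j + 1)" "(x ^ i) ^ (k * m + j + 1) = (y ^ m * x ^ (j + 1)) ^ i"
    "(x ^ i) ^ k = y ^ i" "(x ^ i) ^ Suc k = y ^ i * x ^ i"
proof -
  show 1: "x ^ (k * m + j + 1) = y ^ m * x ^ (j + 1)"
    by (simp add: y power_add power_mult mult_ac)
  show "(x ^ i) ^ (k * m + j + 1) = (y ^ m * x ^ (j + 1)) ^ i"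
    unfolding 1[symmetric] by (simp only: power_mult[symmetric] mult.commute)
  show 3: "(x ^ i) ^ k = y ^ i"
    unfolding y by (simp only: power_mult[symmetric] mult.commute)
  show "(x ^ i) ^ Suc k = y ^ i * x ^ i"
    by (simp only: power_Suc 3 mult.commute)
qed

text \<open>The block of the triple product is (1 - x^(2k+1))^2 (1 - x^(2k+2)); the factor from base
  x^2 makes the even part a square too.\<close>

lemma phi_euler_prod:
  fixes x :: "'a::{real_normed_field,banach}"
  assumes x: "norm x < 1"
  shows "ftheta (-x) (-x) * euler_prod (x\<^sup>2) = euler_prod x ^ 2"
proof -
  have n: "norm (x\<^sup>2) < 1" using x by (rule norm_power_less_one) simp
  then have "(\<lambda>N. (\<Prod>k<N. (1 + -x * (-x * -x) ^ k) * (1 + -x * (-x * -x) ^ k) * (1 - (-x * -x) ^ Suc k)) * qfact (x\<^sup>2) N)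
      \<longlonglongrightarrow> ftheta (-x) (-x) * euler_prod (x\<^sup>2)"
    by (intro tendsto_mult triple_product qfact_tendsto) (simp_all add: power2_eq_square)
  moreover have "(\<Prod>k<N. (1 + -x * (-x * -x) ^ k) * (1 + -x * (-x * -x) ^ k) * (1 - (-x * -x) ^ Suc k)) * qfact (x\<^sup>2) N
      = qfact x (N * 2) ^ 2" for N
    unfolding qfact_mult unfolding qfact_def prod.distrib[symmetric] prod_power_distrib
  proof (intro prod.cong refl)
    fix k
    have b: "- x * - x = x\<^sup>2" by (simp add: power2_eq_square)
    show "(1 + -x * (-x * -x) ^ k) * (1 + -x * (-x * -x) ^ k) * (1 - (-x * -x) ^ Suc k) * (1 - (x\<^sup>2) ^ Suc k) =
      (\<Prod>j<2. (1 - x ^ (k * 2 + j + 1))\<^sup>2)"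
      unfolding b power_blocks[OF refl, of x k] by (simp add: eval_nat_numeral mult_ac)
  qed
  moreover have "(\<lambda>N. qfact x (N * 2) ^ 2) \<longlonglongrightarrow> euler_prod x ^ 2"
    by (intro tendsto_power euler_prod_subseq x) simp
  ultimately show ?thesis by (simp add: LIMSEQ_unique)
qed

text \<open>The factors 1 + x^k start at k = 0 in one product and at k = 1 in the other. The
  additional factor 1 + x^N, which tends to 1, evens out this offset, and the leading 1 + x^0 is the
  factor 2.\<close>

lemma psi_euler_prod:
  fixes x :: "'a::{real_normed_field,banach}"
  assumes x: "norm x < 1"
  shows "ftheta 1 x * euler_prod x = 2 * euler_prod (x\<^sup>2) ^ 2"
proof -
  have n: "norm (x\<^sup>2) < 1" using x by (rule norm_power_less_one) simp
  have "(\<lambda>N. (\<Prod>k<N. (1 + 1 * (1 * x) ^ k) * (1 + x * (1 * x) ^ k) * (1 - (1 * x) ^ Suc k)) * qfact x N * (1 + x ^ N))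
      \<longlonglongrightarrow> ftheta 1 x * euler_prod x * (1 + 0)"
    using x by (intro tendsto_mult triple_product qfact_tendsto tendsto_add tendsto_const LIMSEQ_power_zero) simp_all
  moreover have "(\<Prod>k<N. (1 + 1 * (1 * x) ^ k) * (1 + x * (1 * x) ^ k) * (1 - (1 * x) ^ Suc k)) * qfact x N * (1 + x ^ N)
      = 2 * qfact (x\<^sup>2) N ^ 2" for N
  proof (induction N)
    case (Suc N)
    define y where "y = x ^ N"
    have "(\<Prod>k<Suc N. (1 + 1 * (1 * x) ^ k) * (1 + x * (1 * x) ^ k) * (1 - (1 * x) ^ Suc k)) * qfact x (Suc N) * (1 + x ^ Suc N)
      = (\<Prod>k<N. (1 + 1 * (1 * x) ^ k) * (1 + x * (1 * x) ^ k) * (1 - (1 * x) ^ Suc k)) * qfact x N * (1 + x ^ N) * ((1 + x * y) * (1 - x * y)) ^ 2"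
      by (simp add: qfact_Suc y_def power2_eq_square mult_ac)
    also have "(1 + x * y) * (1 - x * y) = 1 - (x\<^sup>2) ^ Suc N"
      by (simp add: y_def algebra_simps power2_eq_square power_mult_distrib)
    finally show ?case unfolding Suc.IH by (simp add: qfact_Suc power_mult_distrib mult_ac)
  qed simp
  moreover have "(\<lambda>N. 2 * qfact (x\<^sup>2) N ^ 2) \<longlonglongrightarrow> 2 * euler_prod (x\<^sup>2) ^ 2"
    by (intro tendsto_intros qfact_tendsto n)
  ultimately show ?thesis by (simp add: LIMSEQ_unique)
qed

lemma pentagonal_euler_prod:
  fixes x :: "'a::{real_normed_field,banach}"
  assumes x: "norm x < 1"
  shows "ftheta (- (x\<^sup>2)) (- x) = euler_prod x"
proof -
  have n: "norm (- (x\<^sup>2) * - x) < 1" using norm_power_less_one[OF x, of 3] by (simp add: eval_nat_numeral mult.assoc)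
  note triple_product[OF n]
  moreover have "(\<Prod>k<N. (1 + - (x\<^sup>2) * (- (x\<^sup>2) * -x) ^ k) * (1 + -x * (- (x\<^sup>2) * -x) ^ k) * (1 - (- (x\<^sup>2) * -x) ^ Suc k))
      = qfact x (N * 3)" for N
    unfolding qfact_mult
  proof (intro prod.cong refl)
    fix k
    have b: "- (x\<^sup>2) * - x = x ^ 3" by (simp add: eval_nat_numeral mult_ac)
    show "(1 + - (x\<^sup>2) * (- (x\<^sup>2) * -x) ^ k) * (1 + -x * (- (x\<^sup>2) * -x) ^ k) * (1 - (- (x\<^sup>2) * -x) ^ Suc k) =
      (\<Prod>j<3. 1 - x ^ (k * 3 + j + 1))"
      unfolding b power_blocks[OF refl, of x k] by (simp add: eval_nat_numeral mult_ac)
  qed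
  moreover have "(\<lambda>N. qfact x (N * 3)) \<longlonglongrightarrow> euler_prod x"
    by (intro euler_prod_subseq x) simp
  ultimately show ?thesis by (simp add: LIMSEQ_unique)
qed

text \<open>The triple product has the exponents congruent to 0, 1 and 5 modulo 6. Inclusion and
  exclusion: remove from E(x) the multiples of 2 and of 3, which cancels multiples of 6 once too
  often, then restore them twice.\<close>

lemma ftheta_5_1_euler_prod:
  fixes x :: "'a::{real_normed_field,banach}"
  assumes x: "norm x < 1"
  shows "ftheta (- (x ^ 5)) (- x) * euler_prod (x\<^sup>2) * euler_prod (x ^ 3) = euler_prod x * euler_prod (x ^ 6) ^ 2"
proof -
  have n: "norm (- (x ^ 5) * - x) < 1" using norm_power_less_one[OF x, of 6] by (simp add: eval_nat_numeral mult_ac)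
  have "(\<lambda>N. (\<Prod>k<N. (1 + - (x^5) * (- (x^5) * -x) ^ k) * (1 + -x * (- (x^5) * -x) ^ k) * (1 - (- (x^5) * -x) ^ Suc k)) *
       qfact (x\<^sup>2) (N * 3) * qfact (x ^ 3) (N * 2)) \<longlonglongrightarrow> ftheta (- (x ^ 5)) (- x) * euler_prod (x\<^sup>2) * euler_prod (x ^ 3)"
    by (intro tendsto_mult triple_product n euler_prod_subseq norm_power_less_one x) auto
  moreover have "(\<Prod>k<N. (1 + - (x^5) * (- (x^5) * -x) ^ k) * (1 + -x * (- (x^5) * -x) ^ k) * (1 - (- (x^5) * -x) ^ Suc k)) *
       qfact (x\<^sup>2) (N * 3) * qfact (x ^ 3) (N * 2) = qfact x (N * 6) * qfact (x ^ 6) N ^ 2" for N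
    unfolding qfact_mult unfolding qfact_def prod.distrib[symmetric] prod_power_distrib
  proof (intro prod.cong refl)
    fix k
    define y where "y = x ^ k"
    have b: "- (x ^ 5) * - x = x ^ 6" by (simp add: eval_nat_numeral mult_ac)

    show "(1 + - (x^5) * (- (x^5) * -x) ^ k) * (1 + -x * (- (x^5) * -x) ^ k) * (1 - (- (x^5) * -x) ^ Suc k) *
       (\<Prod>j<3. 1 - (x\<^sup>2) ^ (k * 3 + j + 1)) * (\<Prod>j<2. 1 - (x ^ 3) ^ (k * 2 + j + 1)) =
       (\<Prod>j<6. 1 - x ^ (k * 6 + j + 1)) * (1 - (x ^ 6) ^ Suc k)\<^sup>2"
      unfolding b power_blocks[OF y_def] by (simp add: eval_nat_numeral mult_ac)
  qed
  moreover have "(\<lambda>N. qfact x (N * 6) * qfact (x ^ 6) N ^ 2) \<longlonglongrightarrow> euler_prod x * euler_prod (x ^ 6) ^ 2"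
    by (intro tendsto_mult tendsto_power qfact_tendsto euler_prod_subseq norm_power_less_one x) auto
  ultimately show ?thesis by (simp add: LIMSEQ_unique)
qed

text \<open>The plus signs disappear through 1 + z = (1 - z^2)/(1 - z), applied to the exponents not
  divisible by 3.\<close>

lemma ftheta_1_2_euler_prod:
  fixes x :: "'a::{real_normed_field,banach}"
  assumes x: "norm x < 1"
  shows "ftheta x (x\<^sup>2) * euler_prod x * euler_prod (x ^ 6) = euler_prod (x\<^sup>2) * euler_prod (x ^ 3) ^ 2"
proof -
  have n: "norm (x * x\<^sup>2) < 1" using norm_power_less_one[OF x, of 3] by (simp add: eval_nat_numeral mult_ac)
  have "(\<lambda>N. (\<Prod>k<N. (1 + x * (x * x\<^sup>2) ^ k) * (1 + x\<^sup>2 * (x * x\<^sup>2) ^ k) * (1 - (x * x\<^sup>2) ^ Suc k)) *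
       qfact x (N * 3) * qfact (x ^ 6) N) \<longlonglongrightarrow> ftheta x (x\<^sup>2) * euler_prod x * euler_prod (x ^ 6)"
    by (intro tendsto_mult triple_product n euler_prod_subseq norm_power_less_one x qfact_tendsto) auto
  moreover have "(\<Prod>k<N. (1 + x * (x * x\<^sup>2) ^ k) * (1 + x\<^sup>2 * (x * x\<^sup>2) ^ k) * (1 - (x * x\<^sup>2) ^ Suc k)) *
       qfact x (N * 3) * qfact (x ^ 6) N = qfact (x\<^sup>2) (N * 3) * qfact (x ^ 3) N ^ 2" for N
    unfolding qfact_mult unfolding qfact_def prod.distrib[symmetric] prod_power_distrib
  proof (intro prod.cong refl)
    fix k
    define y where "y = x ^ k"
    have b: "x * x\<^sup>2 = x ^ 3" by (simp add: eval_nat_numeral)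

    have d: "1 - z ^ 2 = (1 - z) * (1 + z)" for z :: 'a by (simp add: power2_eq_square algebra_simps)
    have d3: "1 - y ^ 6 * x ^ 6 = (1 - y ^ 3 * x ^ 3) * (1 + y ^ 3 * x ^ 3)"
      using d[of "y ^ 3 * x ^ 3"] by (simp add: power_mult_distrib power_mult[symmetric])
    show "(1 + x * (x * x\<^sup>2) ^ k) * (1 + x\<^sup>2 * (x * x\<^sup>2) ^ k) * (1 - (x * x\<^sup>2) ^ Suc k) *
         (\<Prod>j<3. 1 - x ^ (k * 3 + j + 1)) * (1 - (x ^ 6) ^ Suc k) =
         (\<Prod>j<3. 1 - (x\<^sup>2) ^ (k * 3 + j + 1)) * (1 - (x ^ 3) ^ Suc k) ^ 2"
      unfolding b power_blocks[OF y_def] d d3 by (simp add: numeral_3_eq_3 mult_ac power2_eq_square)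
  qed
  moreover have "(\<lambda>N. qfact (x\<^sup>2) (N * 3) * qfact (x ^ 3) N ^ 2) \<longlonglongrightarrow> euler_prod (x\<^sup>2) * euler_prod (x ^ 3) ^ 2"
    by (intro tendsto_mult tendsto_power qfact_tendsto euler_prod_subseq norm_power_less_one x) auto
  ultimately show ?thesis by (simp add: LIMSEQ_unique)
qed

section \<open>Products over the cube roots of unity and change of sign\<close>

lemma cube_root_unity:
  fixes w :: "'a::real_normed_field"
  assumes w: "1 + w + w\<^sup>2 = 0"
  shows "w ^ 3 = 1" "norm w = 1"
proof -
  have "w ^ 3 - 1 = (w - 1) * (1 + w + w\<^sup>2)" by (simp add: algebra_simps eval_nat_numeral)
  then show w3: "w ^ 3 = 1" using w by simp
  then have "norm w ^ 3 = 1" by (metis norm_one norm_power)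
  then show "norm w = 1" using power_eq_iff_eq_base[of 3 "norm w" 1] by simp
qed

text \<open>For n not divisible by 3 the three factors with exponent n multiply to 1 - x^(3n); for n
  = 3m they coincide and give (1 - x^(3m))^3. Together this is E(x^3)/E(x^9) times E(x^3)^3.\<close>

lemma euler_prod_cube_roots:
  fixes x w :: "'a::{real_normed_field,banach}"
  assumes x: "norm x < 1" and w: "1 + w + w\<^sup>2 = 0"
  shows "euler_prod x * euler_prod (w * x) * euler_prod (w\<^sup>2 * x) * euler_prod (x ^ 9) = euler_prod (x ^ 3) ^ 4"
proof -
  note w3 = cube_root_unity(1)[OF w]
  have n: "norm (w * x) < 1" "norm (w\<^sup>2 * x) < 1" using x cube_root_unity(2)[OF w] by (simp_all add: norm_mult norm_power)
  have cub: "(1 - z) * (1 - w * z) * (1 - w\<^sup>2 * z) = 1 - z ^ 3" for z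
  proof -
    have "(1 - z) * (1 - w * z) * (1 - w\<^sup>2 * z) = 1 - w ^ 3 * z ^ 3 - (1 + w + w\<^sup>2) * (z - w * z\<^sup>2)"
      by (simp add: algebra_simps eval_nat_numeral)
    then show ?thesis by (simp add: w w3)
  qed
  have "(\<lambda>N. qfact x (N * 3) * qfact (w * x) (N * 3) * qfact (w\<^sup>2 * x) (N * 3) * qfact (x ^ 9) N) \<longlonglongrightarrow>
      euler_prod x * euler_prod (w * x) * euler_prod (w\<^sup>2 * x) * euler_prod (x ^ 9)"
    by (intro tendsto_mult qfact_tendsto euler_prod_subseq norm_power_less_one x n) auto
  moreover have "qfact x (N * 3) * qfact (w * x) (N * 3) * qfact (w\<^sup>2 * x) (N * 3) * qfact (x ^ 9) N
     = qfact (x ^ 3) (N * 3) * qfact (x ^ 3) N ^ 3" for N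
    unfolding qfact_mult unfolding qfact_def prod.distrib[symmetric] prod_power_distrib
  proof (intro prod.cong refl)
    fix k
    define y where "y = x ^ k"
    have wk: "w ^ (k * 3) = 1" "(w\<^sup>2) ^ (k * 3) = 1"
      by (metis w3 mult.commute power_mult power_one) (metis w3 mult.commute mult.left_commute power_mult power_one)
    have wj: "w ^ (k * 3 + j + 1) = w ^ (j + 1)" "(w\<^sup>2) ^ (k * 3 + j + 1) = (w\<^sup>2) ^ (j + 1)" for j
      by (simp_all only: power_add mult.assoc wk mult_1_left)
    have e: "x ^ (k * 3 + j + 1) = y ^ 3 * x ^ (j + 1)"
      "(w * x) ^ (k * 3 + j + 1) = w ^ (j + 1) * (y ^ 3 * x ^ (j + 1))"
      "(w\<^sup>2 * x) ^ (k * 3 + j + 1) = (w\<^sup>2) ^ (j + 1) * (y ^ 3 * x ^ (j + 1))"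
      "(x ^ 3) ^ (k * 3 + j + 1) = (y ^ 3 * x ^ (j + 1)) ^ 3" "(x ^ i) ^ Suc k = y ^ i * x ^ i" for i j
      by (simp_all only: power_mult_distrib power_blocks[OF y_def] wj)
    have w2: "(w\<^sup>2) ^ 2 = w" "(w\<^sup>2) ^ 3 = 1" using w3 by (simp_all add: eval_nat_numeral) (metis mult.assoc mult_1_right)+
    have j0: "(1 - x ^ (k * 3 + 0 + 1)) * (1 - (w * x) ^ (k * 3 + 0 + 1)) * (1 - (w\<^sup>2 * x) ^ (k * 3 + 0 + 1)) = 1 - (x ^ 3) ^ (k * 3 + 0 + 1)"
      unfolding e using cub[of "y ^ 3 * x"] by simp
    have j1: "(1 - x ^ (k * 3 + 1 + 1)) * (1 - (w * x) ^ (k * 3 + 1 + 1)) * (1 - (w\<^sup>2 * x) ^ (k * 3 + 1 + 1)) = 1 - (x ^ 3) ^ (k * 3 + 1 + 1)"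
      unfolding e one_add_one w2(1) using cub[of "y ^ 3 * x ^ 2"] by (simp only: mult_ac power_one_right)
    have j2: "(1 - x ^ (k * 3 + 2 + 1)) * (1 - (w * x) ^ (k * 3 + 2 + 1)) * (1 - (w\<^sup>2 * x) ^ (k * 3 + 2 + 1)) = (1 - (x ^ 3) ^ Suc k) ^ 3"
      unfolding e using w2(2) w3 by (simp add: power3_eq_cube)
    have j3: "(x ^ 9) ^ Suc k = (x ^ 3) ^ (k * 3 + 2 + 1)"
      by (simp add: power_mult[symmetric] add.commute del: power_Suc)
    have p3: "(\<Prod>j<3. f j) = f 0 * f 1 * f (2::nat)" for f :: "nat \<Rightarrow> 'a" by (simp add: eval_nat_numeral)
    show "(\<Prod>j<3. (1 - x ^ (k * 3 + j + 1)) * (1 - (w * x) ^ (k * 3 + j + 1)) * (1 - (w\<^sup>2 * x) ^ (k * 3 + j + 1))) * (1 - (x ^ 9) ^ Suc k)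
      = (\<Prod>j<3. 1 - (x ^ 3) ^ (k * 3 + j + 1)) * (1 - (x ^ 3) ^ Suc k) ^ 3"
      unfolding p3 j3 j0[symmetric] j1[symmetric] j2[symmetric] by (simp only: mult_ac)
  qed
  moreover have "(\<lambda>N. qfact (x ^ 3) (N * 3) * qfact (x ^ 3) N ^ 3) \<longlonglongrightarrow> euler_prod (x ^ 3) * euler_prod (x ^ 3) ^ 3"
    by (intro tendsto_mult tendsto_power qfact_tendsto euler_prod_subseq norm_power_less_one x) auto
  ultimately show ?thesis by (simp add: LIMSEQ_unique eval_nat_numeral)
qed

text \<open>Factors of odd index n combine to 1 - x^(2n), those of even index are squared. This
  merges the theta values at r and -r into eta quotients of r^2 at the end of the Wronskian
  computation.\<close>

lemma euler_prod_neg: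
  fixes x :: "'a::{real_normed_field,banach}"
  assumes x: "norm x < 1"
  shows "euler_prod (- x) * euler_prod x * euler_prod (x ^ 4) = euler_prod (x\<^sup>2) ^ 3"
proof -
  have n: "norm (- x) < 1" using x by simp
  have "(\<lambda>N. qfact (- x) (N * 2) * qfact x (N * 2) * qfact (x ^ 4) N) \<longlonglongrightarrow> euler_prod (- x) * euler_prod x * euler_prod (x ^ 4)"
    by (intro tendsto_mult qfact_tendsto euler_prod_subseq norm_power_less_one x n) auto
  moreover have "qfact (- x) (N * 2) * qfact x (N * 2) * qfact (x ^ 4) N = qfact (x\<^sup>2) (N * 2) * qfact (x\<^sup>2) N ^ 2" for N
    unfolding qfact_mult unfolding qfact_def prod.distrib[symmetric] prod_power_distrib
  proof (intro prod.cong refl)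
    fix k
    define y where "y = x ^ k"
    have m: "(- x) ^ (k * 2 + j + 1) = (-1) ^ (j + 1) * (y\<^sup>2 * x ^ (j + 1))" for j
      unfolding power_minus[of x] power_blocks(1)[OF y_def] by (simp add: power_add power_mult mult.commute[of k])
    have d: "1 - z ^ 2 = (1 - z) * (1 + z)" for z :: 'a by (simp add: power2_eq_square algebra_simps)
    have d4: "1 - y ^ 4 * x ^ 4 = (1 - (y ^ 2 * x ^ 2)) * (1 + y ^ 2 * x ^ 2)"
      using d[of "y ^ 2 * x ^ 2"] by (simp add: power_mult_distrib power_mult[symmetric])
    show "(\<Prod>j<2. (1 - (- x) ^ (k * 2 + j + 1)) * (1 - x ^ (k * 2 + j + 1))) * (1 - (x ^ 4) ^ Suc k)
      = (\<Prod>j<2. 1 - (x\<^sup>2) ^ (k * 2 + j + 1)) * (1 - (x\<^sup>2) ^ Suc k)\<^sup>2"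
      unfolding m power_blocks[OF y_def] d4 d[of "y\<^sup>2 * x ^ (_ + 1)"] by (simp add: numeral_2_eq_2 mult_ac)
  qed
  moreover have "(\<lambda>N. qfact (x\<^sup>2) (N * 2) * qfact (x\<^sup>2) N ^ 2) \<longlonglongrightarrow> euler_prod (x\<^sup>2) * euler_prod (x\<^sup>2) ^ 2"
    by (intro tendsto_mult tendsto_power qfact_tendsto euler_prod_subseq norm_power_less_one x) auto
  ultimately show ?thesis by (simp add: LIMSEQ_unique eval_nat_numeral)
qed

lemma euler_prod_pos:
  fixes x :: real
  assumes "0 \<le> x" "x < 1"
  shows "euler_prod x > 0"
proof -
  have "qfact x n \<ge> 0" for n
    unfolding qfact_def using assms by (intro prod_nonneg) (auto simp: power_le_one simp del: power_Suc)
  then have "euler_prod x \<ge> 0"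
    using qfact_tendsto[of x] assms by (intro LIMSEQ_le_const[of "qfact x"]) auto
  then show ?thesis using euler_prod_nonzero[of x] assms by simp
qed

section \<open>Theta series over the integers\<close>

text \<open>The sign (-1)^n for an integer n; the power operator takes natural exponents.\<close>

definition int_sign :: "int \<Rightarrow> 'a::ring_1" where
  "int_sign n = (if even n then 1 else -1)"

lemma int_sign_power: "(-1) ^ k = (int_sign (int k) :: 'a::ring_1)"
  by (simp add: int_sign_def minus_one_power_iff)

lemma int_sign_add: "int_sign (m + n) = (int_sign m * int_sign n :: 'a::ring_1)"
  by (auto simp: int_sign_def)

lemma abs_int_sign [simp]: "\<bar>int_sign n :: real\<bar> = 1"
  by (simp add: int_sign_def)

section \<open>Convergence, differentiation and multiplication of theta series\<close>

lemma bounded_linear_times_power: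
  fixes r :: real
  assumes "\<bar>r\<bar> < 1"
  obtains C where "C > 0" "\<And>m. real (m + 1) * \<bar>r\<bar> ^ m \<le> C"
proof -
  have "Bseq (\<lambda>m. of_nat m * \<bar>r\<bar> ^ m)"
    using powser_times_n_limit_0[of "\<bar>r\<bar>"] assms by (intro convergent_imp_Bseq convergentI) auto
  then obtain C where C: "C > 0" "\<And>m. norm (of_nat m * \<bar>r\<bar> ^ m) \<le> C"
    unfolding Bseq_def by blast
  have "real (m + 1) * \<bar>r\<bar> ^ m \<le> C + 1" for m
  proof -
    have "\<bar>r\<bar> ^ m \<le> 1" using assms by (intro power_le_one) auto
    moreover have "real m * \<bar>r\<bar> ^ m \<le> C" using C(2)[of m] by simp
    ultimately show ?thesis by (simp add: distrib_right)
  qed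
  then show ?thesis using C(1) by (intro that[of "C + 1"]) auto
qed

lemma summable_int_geometric:
  fixes r :: real
  assumes "0 \<le> r" "r < 1"
  shows "(\<lambda>n::int. r ^ nat \<bar>n\<bar>) summable_on UNIV"
proof (rule has_sum_imp_summable, rule has_sum_int_nat)
  have "summable (\<lambda>k. r ^ k)" using assms by (simp add: summable_geometric)
  moreover from this have "summable (\<lambda>k. r ^ Suc k)" by (simp add: summable_mult)
  moreover have "nat \<bar>- int (Suc k)\<bar> = Suc k" for k by simp
  ultimately show "summable (\<lambda>k. norm (r ^ nat \<bar>int k\<bar>))" "summable (\<lambda>k. norm (r ^ nat \<bar>- int (Suc k)\<bar>))"
    using assms by (simp_all add: norm_power del: power_Suc)
qed

text \<open>With |x| at most s^2 and s < 1, one factor s^(e n) absorbs the linear weight, and the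
  other is dominated by the two-sided geometric series because of the growth condition on e.\<close>

lemma summable_theta_series:
  fixes c :: "int \<Rightarrow> real" and e :: "int \<Rightarrow> nat"
  assumes x: "\<bar>x\<bar> < 1" and c: "\<And>n. \<bar>c n\<bar> \<le> K * real (e n + 1)" and e: "\<And>n. nat \<bar>n\<bar> \<le> e n + 1"
  shows "(\<lambda>n. c n * x ^ e n) summable_on UNIV"
proof -
  \<comment> \<open>The 1/4 keeps s positive when x = 0; s is divided by below.\<close>
  define s where "s = sqrt (max \<bar>x\<bar> (1/4))"
  have s: "s < 1" "s > 0" "\<bar>x\<bar> \<le> s\<^sup>2"
    using x by (simp_all add: s_def real_sqrt_lt_1_iff less_max_iff_disj le_max_iff_disj)
  obtain C where C: "C > 0" "\<And>m. real (m + 1) * \<bar>s\<bar> ^ m \<le> C"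
    using bounded_linear_times_power[of s] s by auto
  have K: "K \<ge> 0" using order_trans[OF abs_ge_zero c[of 0]] by (simp add: zero_le_mult_iff)
  have "norm (c n * x ^ e n) \<le> (K * C / s) * s ^ nat \<bar>n\<bar>" for n
  proof -
    have "norm (c n * x ^ e n) \<le> (K * real (e n + 1)) * (s\<^sup>2) ^ e n"
      unfolding norm_mult norm_power using c[of n] s(3) K by (intro mult_mono power_mono) auto
    also have "\<dots> = K * (real (e n + 1) * \<bar>s\<bar> ^ e n) * s ^ e n"
      using s(2) by (simp add: power_mult[symmetric] power_add[symmetric] mult_2)
    also have "\<dots> \<le> K * C * s ^ e n"
      using s(2) K C(2) by (intro mult_right_mono mult_left_mono) auto
    also have "\<dots> = K * C / s * s ^ (e n + 1)" using s(2) by simp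
    also have "\<dots> \<le> K * C / s * s ^ nat \<bar>n\<bar>"
      using s e[of n] K C(1) by (intro mult_left_mono power_decreasing divide_nonneg_pos mult_nonneg_nonneg) auto
    finally show ?thesis .
  qed
  moreover have "(\<lambda>n::int. (K * C / s) * s ^ nat \<bar>n\<bar>) summable_on UNIV"
    using s by (intro summable_on_cmult_right summable_int_geometric) auto
  ultimately have "(\<lambda>n. norm (c n * x ^ e n)) summable_on UNIV"
    by (intro Infinite_Sum.abs_summable_on_comparison_test'[of "\<lambda>n. K * C / s * s ^ nat \<bar>n\<bar>"])
  then show ?thesis by (rule abs_summable_summable)
qed

text \<open>The integers are enumerated by \<open>int_decode\<close>, so that termwise
  differentiation of an ordinary series applies; the differentiated series at some R > |x| is the
  uniform majorant. The sum is given for x D, which keeps the original exponents instead of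
  \<open>e n - 1\<close>.\<close>

lemma theta_series_derivative:
  fixes c :: "int \<Rightarrow> real" and e :: "int \<Rightarrow> nat"
  assumes x: "\<bar>x\<bar> < 1" and c: "\<And>n. \<bar>c n\<bar> \<le> K" and e: "\<And>n. nat \<bar>n\<bar> \<le> e n + 1"
  obtains D where "((\<lambda>x. \<Sum>\<^sub>\<infinity>n. c n * x ^ e n) has_real_derivative D) (at x)"
    "((\<lambda>n. c n * real (e n) * x ^ e n) has_sum (x * D)) UNIV"
proof -
  obtain R where R: "\<bar>x\<bar> < R" "R < 1" using dense[OF x] by blast
  then have R0: "R > 0" by linarith
  have K: "K \<ge> 0" using order_trans[OF abs_ge_zero c] by blast
  have sum1: "(\<lambda>n. c n * y ^ e n) summable_on UNIV" if "\<bar>y\<bar> < 1" for y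
  proof (rule summable_theta_series[OF that _ e])
    show "\<bar>c n\<bar> \<le> K * real (e n + 1)" for n
      using c[of n] K mult_left_mono[of 1 "real (e n + 1)" K] by simp
  qed
  have sum2: "(\<lambda>n. (c n * real (e n)) * y ^ e n) summable_on UNIV" if "\<bar>y\<bar> < 1" for y
  proof (rule summable_theta_series[OF that _ e])
    show "\<bar>c n * real (e n)\<bar> \<le> K * real (e n + 1)" for n
      unfolding abs_mult using c[of n] K by (intro mult_mono) auto
  qed
  have bij: "bij_betw int_decode UNIV UNIV" by (rule bij_int_decode)
  define f where "f k y = c (int_decode k) * y ^ e (int_decode k)" for k and y :: real
  define f' where "f' k y = c (int_decode k) * (real (e (int_decode k)) * y ^ (e (int_decode k) - 1))" for k and y :: real
  have fsum: "(\<Sum>\<^sub>\<infinity>n. c n * y ^ e n) = (\<Sum>k. f k y)" "summable (\<lambda>k. f k y)" if "\<bar>y\<bar> < 1" for y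
  proof -
    have "((\<lambda>k. f k y) has_sum (\<Sum>\<^sub>\<infinity>n. c n * y ^ e n)) UNIV"
      unfolding f_def using has_sum_infsum[OF sum1[OF that]] by (subst has_sum_reindex_bij_betw[OF bij])
    then have "(\<lambda>k. f k y) sums (\<Sum>\<^sub>\<infinity>n. c n * y ^ e n)" by (rule has_sum_imp_sums)
    then show "(\<Sum>\<^sub>\<infinity>n. c n * y ^ e n) = (\<Sum>k. f k y)" "summable (\<lambda>k. f k y)" by (simp_all add: sums_iff)
  qed
  define S where "S = {-R<..<R}"
  have M: "summable (\<lambda>k. norm (f' k R))"
  proof -
    have "(\<lambda>n. norm ((c n * real (e n)) * R ^ e n)) summable_on UNIV"
      by (rule summable_on_iff_abs_summable_on_real[THEN iffD1, OF sum2]) (use R R0 in simp)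
    then have "(\<lambda>k. norm ((c (int_decode k) * real (e (int_decode k))) * R ^ e (int_decode k))) summable_on UNIV"
      by (subst summable_on_reindex_bij_betw[OF bij])
    then have "summable (\<lambda>k. 1 / R * norm ((c (int_decode k) * real (e (int_decode k))) * R ^ e (int_decode k)))"
      by (intro summable_mult summable_on_imp_summable)
    moreover have "1 / R * norm (a * real m * R ^ m) = norm (a * (real m * R ^ (m - 1)))" for a m
      using R0 by (cases m) (simp_all add: abs_mult)
    ultimately show ?thesis unfolding f'_def by (simp only: mult.assoc)
  qed
  have der: "((\<lambda>y. \<Sum>k. f k y) has_real_derivative (\<Sum>k. f' k x)) (at x)"
  proof (rule has_field_derivative_series'(2)[of S f f' 0 x])
    show "convex S" by (simp add: S_def)
    show "(f n has_real_derivative f' n y) (at y within S)" for n y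
      unfolding f_def f'_def by (auto intro!: derivative_eq_intros)
    show "uniformly_convergent_on S (\<lambda>n y. \<Sum>i<n. f' i y)"
    proof (rule Weierstrass_m_test'[OF _ M])
      fix n y assume "y \<in> S"
      then have "\<bar>y\<bar> \<le> \<bar>R\<bar>" by (auto simp: S_def)
      then show "norm (f' n y) \<le> norm (f' n R)"
        unfolding f'_def norm_mult norm_power by (intro mult_left_mono power_mono) auto
    qed
    show "0 \<in> S" using R0 by (simp add: S_def)
    show "summable (\<lambda>n. f n 0)" by (rule fsum) simp
    show "x \<in> interior S" using R by (auto simp: S_def)
  qed
  have "((\<lambda>x. \<Sum>\<^sub>\<infinity>n. c n * x ^ e n) has_real_derivative (\<Sum>k. f' k x)) (at x)"
    by (rule has_field_derivative_transform_within_open[OF der, of "{-1<..<1}"]) (use x in \<open>auto simp: fsum(1)\<close>)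
  moreover have "((\<lambda>n. c n * real (e n) * x ^ e n) has_sum (x * (\<Sum>k. f' k x))) UNIV"
  proof -
    have f'x: "x * f' k x = c (int_decode k) * real (e (int_decode k)) * x ^ e (int_decode k)" for k
      unfolding f'_def by (cases "e (int_decode k)") simp_all
    have hs: "((\<lambda>k. x * f' k x) has_sum (\<Sum>\<^sub>\<infinity>n. c n * real (e n) * x ^ e n)) UNIV"
      unfolding f'x using has_sum_infsum[OF sum2[OF x]] by (subst has_sum_reindex_bij_betw[OF bij])
    have "summable (\<lambda>k. f' k x)"
    proof (rule summable_comparison_test'[OF M, of 0])
      show "norm (f' n x) \<le> norm (f' n R)" for n
        unfolding f'_def norm_mult norm_power using R by (intro mult_left_mono power_mono) auto
    qed
    then have "(\<Sum>k. x * f' k x) = x * (\<Sum>k. f' k x)" by (rule suminf_mult)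
    with has_sum_imp_sums[OF hs] have "(\<Sum>\<^sub>\<infinity>n. c n * real (e n) * x ^ e n) = x * (\<Sum>k. f' k x)"
      by (simp add: sums_iff)
    with has_sum_infsum[OF sum2[OF x]] show ?thesis by simp
  qed
  ultimately show ?thesis using that by blast
qed

lemma has_sum_times:
  fixes f :: "'a \<Rightarrow> real" and g :: "'b \<Rightarrow> real"
  assumes f: "(f has_sum a) A" and g: "(g has_sum b) B"
  shows "((\<lambda>(i, j). f i * g j) has_sum (a * b)) (A \<times> B)"
proof -
  have fs: "f summable_on A" "g summable_on B" using f g by (auto intro: has_sum_imp_summable)
  then have fa: "(\<lambda>x. norm (f x)) summable_on A" "(\<lambda>x. norm (g x)) summable_on B"
    by (simp_all only: summable_on_iff_abs_summable_on_real[symmetric])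
  have "(\<lambda>p. norm ((\<lambda>(i, j). f i * g j) p)) summable_on A \<times> B"
  proof (rule Infinite_Sum.abs_summable_on_Sigma_iff[THEN iffD2], intro conjI ballI)
    show "(\<lambda>y. norm ((\<lambda>(i, j). f i * g j) (x, y))) summable_on B" for x
      using fa(2) by (simp add: abs_mult summable_on_cmult_right)
    show "(\<lambda>x. norm (\<Sum>\<^sub>\<infinity>y\<in>B. norm ((\<lambda>(i, j). f i * g j) (x, y)))) summable_on A"
      using fa by (simp add: abs_mult infsum_cmult_right summable_on_cmult_left infsum_nonneg)
  qed
  then have s: "(\<lambda>(i, j). f i * g j) summable_on A \<times> B" by (rule abs_summable_summable)
  have "infsum (\<lambda>(i, j). f i * g j) (A \<times> B) = (\<Sum>\<^sub>\<infinity>i\<in>A. \<Sum>\<^sub>\<infinity>j\<in>B. f i * g j)"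
    using infsum_Sigma'_banach[OF s] by simp
  also have "\<dots> = a * b"
    using f g fs by (simp add: infsum_cmult_right infsum_cmult_left infsumI)
  finally show ?thesis using has_sum_infsum[OF s] by simp
qed

lemma has_sum_antisymmetric:
  fixes f :: "'a \<Rightarrow> real"
  assumes "(f has_sum a) A" "bij_betw h A A" "\<And>x. x \<in> A \<Longrightarrow> f (h x) = - f x"
  shows "a = 0"
proof -
  have "((\<lambda>x. f (h x)) has_sum a) A" using assms(1) by (subst has_sum_reindex_bij_betw[OF assms(2)])
  then have "((\<lambda>x. - f x) has_sum a) A" using assms(3) by (simp cong: has_sum_cong)
  moreover have "((\<lambda>x. - f x) has_sum - a) A" using assms(1) by (simp add: has_sum_uminus)
  ultimately have "a = - a" by (rule has_sum_unique)
  then show ?thesis by simp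
qed

section \<open>Exponents and signs of the particular theta series\<close>

lemma triangular_numbers:
  fixes n :: int
  shows "int (nat (n * (n + 1) div 2)) * 2 = n * (n + 1)" "int (nat (n * (n - 1) div 2)) * 2 = n * (n - 1)"
proof -
  have *: "m * (m + 1) \<ge> 0 \<and> even (m * (m + 1))" for m :: int
    by (cases "m \<ge> 0") (auto simp: zero_le_mult_iff)
  show "int (nat (n * (n + 1) div 2)) * 2 = n * (n + 1)" using *[of n] by simp
  show "int (nat (n * (n - 1) div 2)) * 2 = n * (n - 1)" using *[of "n - 1"] by (simp add: mult.commute)
qed

text \<open>All exponents in use have the form c n^2 + d n with |d| at most c. This provides the
  growth condition for summability, and the nonnegativity under which \<open>nat\<close> loses
  nothing.\<close>

lemma nat_abs_le_square:
  fixes n :: int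
  assumes "c \<ge> 1" "\<bar>d\<bar> \<le> c"
  shows "nat \<bar>n\<bar> \<le> nat (c * n\<^sup>2 + d * n) + 1" "c * n\<^sup>2 + d * n \<ge> 0"
    "\<bar>n\<bar> \<le> c * n\<^sup>2 + d * n + 1"
proof -
  have "\<bar>d * n\<bar> \<le> c * \<bar>n\<bar>" using assms by (simp add: abs_mult mult_right_mono)
  then have "c * n\<^sup>2 + d * n \<ge> c * n\<^sup>2 - c * \<bar>n\<bar>" by linarith
  also have "c * n\<^sup>2 - c * \<bar>n\<bar> = (c * \<bar>n\<bar>) * (\<bar>n\<bar> - 1)"
    by (simp add: algebra_simps power2_eq_square)
  finally have b: "c * n\<^sup>2 + d * n \<ge> (c * \<bar>n\<bar>) * (\<bar>n\<bar> - 1)" .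
  have "(c * \<bar>n\<bar>) * (\<bar>n\<bar> - 1) \<ge> 0 \<and> (c * \<bar>n\<bar>) * (\<bar>n\<bar> - 1) \<ge> \<bar>n\<bar> - 1"
  proof (cases "n = 0")
    case False
    then have "c * \<bar>n\<bar> \<ge> 1 * 1" using assms by (intro mult_mono) auto
    then show ?thesis using False mult_right_mono[of 1 "c * \<bar>n\<bar>" "\<bar>n\<bar> - 1"] by simp
  qed simp
  with b show "nat \<bar>n\<bar> \<le> nat (c * n\<^sup>2 + d * n) + 1" "c * n\<^sup>2 + d * n \<ge> 0"
    "\<bar>n\<bar> \<le> c * n\<^sup>2 + d * n + 1" by linarith+
qed

text \<open>Applied with a and b the two triangular numbers n(n+1)/2 and n(n-1)/2: their sum is n^2,
  so the sign of the term is that of n.\<close>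

lemma signed_power_monomial:
  fixes x :: "'a::comm_ring_1"
  assumes "int a + int b = s" "int k * int a + int l * int b = int m"
  shows "(- (x ^ k)) ^ a * (- (x ^ l)) ^ b = int_sign s * x ^ m"
proof -
  have "(- (x ^ k)) ^ a * (- (x ^ l)) ^ b = (-1) ^ (a + b) * x ^ (k * a + l * b)"
    unfolding power_minus[of "x ^ k"] power_minus[of "x ^ l"] by (simp add: power_add power_mult[symmetric] mult_ac)
  also have "k * a + l * b = m" using assms(2) by (metis of_nat_add of_nat_eq_iff of_nat_mult)
  also have "(-1) ^ (a + b) = (int_sign s :: 'a)" using assms(1) unfolding int_sign_power by simp
  finally show ?thesis .
qed

lemma phi_has_sum:
  fixes x :: "'a::{real_normed_field,banach}"
  assumes "norm x < 1"
  shows "((\<lambda>n. int_sign n * x ^ nat (n\<^sup>2)) has_sum ftheta (- x) (- x)) UNIV"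
proof -
  have "norm (- x * - x) < 1" using assms norm_power_less_one[OF assms, of 2] by (simp add: power2_eq_square)
  from ftheta_has_sum(1)[OF this] show ?thesis
  proof (rule has_sum_cong[THEN iffD1, rotated])
    fix n :: int
    have "(- (x ^ 1)) ^ nat (n * (n + 1) div 2) * (- (x ^ 1)) ^ nat (n * (n - 1) div 2) = int_sign (n\<^sup>2) * x ^ nat (n\<^sup>2)"
      using triangular_numbers[of n] by (intro signed_power_monomial) (simp_all add: power2_eq_square algebra_simps)
    then show "(- x) ^ nat (n * (n + 1) div 2) * (- x) ^ nat (n * (n - 1) div 2) = int_sign n * x ^ nat (n\<^sup>2)"
      by (simp add: int_sign_def)
  qed
qed

lemma ftheta_5_1_has_sum:
  fixes x :: "'a::{real_normed_field,banach}"
  assumes "norm x < 1"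
  shows "((\<lambda>n. int_sign n * x ^ nat (3 * n\<^sup>2 + 2 * n)) has_sum ftheta (- (x ^ 5)) (- x)) UNIV"
proof -
  have "norm (- (x ^ 5) * - x) < 1" using assms norm_power_less_one[OF assms, of 6] by (simp add: eval_nat_numeral mult_ac)
  from ftheta_has_sum(1)[OF this] show ?thesis
  proof (rule has_sum_cong[THEN iffD1, rotated])
    fix n :: int
    have "(- (x ^ 5)) ^ nat (n * (n + 1) div 2) * (- (x ^ 1)) ^ nat (n * (n - 1) div 2) = int_sign (n\<^sup>2) * x ^ nat (3 * n\<^sup>2 + 2 * n)"
      using triangular_numbers[of n] nat_abs_le_square(2)[of 3 2 n]
      by (intro signed_power_monomial) (simp_all add: power2_eq_square algebra_simps)
    then show "(- (x ^ 5)) ^ nat (n * (n + 1) div 2) * (- x) ^ nat (n * (n - 1) div 2) = int_sign n * x ^ nat (3 * n\<^sup>2 + 2 * n)"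
      by (simp add: int_sign_def)
  qed
qed

text \<open>The exponent 6n^2 + 2n is four times a pentagonal number, so this is Euler's theorem in
  base x^4. In this shape it splits off a residue class of the double sum below.\<close>

lemma pentagonal_has_sum:
  fixes x :: "'a::{real_normed_field,banach}"
  assumes "norm x < 1"
  shows "((\<lambda>n. int_sign n * x ^ nat (6 * n\<^sup>2 + 2 * n)) has_sum euler_prod (x ^ 4)) UNIV"
proof -
  have n4: "norm (x ^ 4) < 1" using assms by (rule norm_power_less_one) simp
  have "norm (- ((x ^ 4)\<^sup>2) * - (x ^ 4)) < 1" using norm_power_less_one[OF n4, of 3] by (simp add: eval_nat_numeral mult.assoc)
  from ftheta_has_sum(1)[OF this, unfolded pentagonal_euler_prod[OF n4]] show ?thesis
  proof (rule has_sum_cong[THEN iffD1, rotated])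
    fix n :: int
    have "(- (x ^ 8)) ^ nat (n * (n + 1) div 2) * (- (x ^ 4)) ^ nat (n * (n - 1) div 2) = int_sign (n\<^sup>2) * x ^ nat (6 * n\<^sup>2 + 2 * n)"
      using triangular_numbers[of n] nat_abs_le_square(2)[of 6 2 n]
      by (intro signed_power_monomial) (simp_all add: power2_eq_square algebra_simps)
    then show "(- ((x ^ 4)\<^sup>2)) ^ nat (n * (n + 1) div 2) * (- (x ^ 4)) ^ nat (n * (n - 1) div 2) = int_sign n * x ^ nat (6 * n\<^sup>2 + 2 * n)"
      by (simp add: int_sign_def power_mult[symmetric])
  qed
qed

text \<open>The terms of index i and -1 - i are equal, as sign and weight both change; hence the
  factor 2. The exponent is four times a triangular number.\<close>

lemma jacobi_cube_has_sum:
  fixes r :: real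
  assumes "\<bar>r\<bar> < 1"
  shows "((\<lambda>i. int_sign i * of_int (2 * i + 1) * r ^ nat (2 * i\<^sup>2 + 2 * i)) has_sum (2 * euler_prod (r ^ 4) ^ 3)) UNIV"
proof -
  let ?f = "\<lambda>i::int. int_sign i * of_int (2 * i + 1) * r ^ nat (2 * i\<^sup>2 + 2 * i)"
  have r4: "\<bar>r ^ 4\<bar> < 1" using norm_power_less_one[of r 4] assms by simp
  have e: "4 * (Suc k choose 2) = nat (2 * (int k)\<^sup>2 + 2 * int k)" "4 * (Suc k choose 2) = nat (2 * (- int (Suc k))\<^sup>2 + 2 * (- int (Suc k)))" for k
  proof -
    have "int (4 * (Suc k choose 2)) = 2 * (int k)\<^sup>2 + 2 * int k"
    proof -
      have "(Suc k choose 2) * 2 = k * (k + 1)" unfolding choose_two by (simp add: algebra_simps)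
      then have "int (Suc k choose 2) * 2 = int k * (int k + 1)" by (metis of_nat_mult of_nat_numeral of_nat_add of_nat_1)
      then show ?thesis by (simp add: power2_eq_square algebra_simps)
    qed
    moreover have "2 * (- int (Suc k))\<^sup>2 + 2 * (- int (Suc k)) = 2 * (int k)\<^sup>2 + 2 * int k"
      by (simp add: power2_eq_square algebra_simps)
    ultimately show "4 * (Suc k choose 2) = nat (2 * (int k)\<^sup>2 + 2 * int k)" "4 * (Suc k choose 2) = nat (2 * (- int (Suc k))\<^sup>2 + 2 * (- int (Suc k)))"
      by (metis nat_int)+
  qed
  have f1: "?f (int k) = (-1) ^ k * real (2 * k + 1) * (r ^ 4) ^ (Suc k choose 2)" for k
    unfolding power_mult[symmetric] e(1) int_sign_power by simp
  have f2: "?f (- int (Suc k)) = (-1) ^ k * real (2 * k + 1) * (r ^ 4) ^ (Suc k choose 2)" for k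
    unfolding power_mult[symmetric] e(2) int_sign_power by (simp add: int_sign_def)
  have s: "summable (\<lambda>k. norm ((-1) ^ k * real (2 * k + 1) * (r ^ 4) ^ (Suc k choose 2)))"
  proof (rule summable_comparison_test'[of "\<lambda>k. 2 * (real (Suc (Suc k)) * norm ((r ^ 4) ^ (Suc k choose 2)))" 0])
    show "summable (\<lambda>k. 2 * (real (Suc (Suc k)) * norm ((r ^ 4) ^ (Suc k choose 2))))"
      using summable_linear_power_choose_two[OF r4, THEN summable_ignore_initial_segment, of 1]
      by (intro summable_mult) simp
    show "norm (norm ((-1) ^ k * real (2 * k + 1) * (r ^ 4) ^ (Suc k choose 2))) \<le> 2 * (real (Suc (Suc k)) * norm ((r ^ 4) ^ (Suc k choose 2)))" for k
    proof -
      have "norm (norm ((-1) ^ k * real (2 * k + 1) * (r ^ 4) ^ (Suc k choose 2))) = real (2 * k + 1) * norm ((r ^ 4) ^ (Suc k choose 2))"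
        by (simp add: abs_mult)
      also have "\<dots> \<le> (2 * real (Suc (Suc k))) * norm ((r ^ 4) ^ (Suc k choose 2))"
        by (intro mult_right_mono) auto
      finally show ?thesis by (simp only: mult.assoc)
    qed
  qed
  have "(?f has_sum ((\<Sum>k. ?f (int k)) + (\<Sum>k. ?f (- int (Suc k))))) UNIV"
    by (rule has_sum_int_nat) (use s in \<open>simp_all only: f1 f2\<close>)
  then show ?thesis
    unfolding f1 f2 using jacobi_cube_sums[OF r4] by (simp add: sums_iff)
qed


section \<open>The series of weight 3/2 and the Wronskian of N and D\<close>

lemma has_sum_3_partition:
  fixes f :: "'a \<Rightarrow> 'b::{topological_comm_monoid_add, t2_space}"
  assumes "(f has_sum a) A" "(f has_sum b) B" "(f has_sum c) C"
    "A \<inter> B = {}" "(A \<union> B) \<inter> C = {}" "A \<union> B \<union> C = D"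
  shows "(f has_sum (a + b + c)) D"
  using has_sum_Un_disjoint[OF has_sum_Un_disjoint[OF assms(1,2,4)] assms(3,5)] assms(6) by simp

text \<open>Multiply Jacobi's series in \<open>r^4\<close> by \<open>phi(-r)\<close> and sort the terms \<open>(i, j)\<close> by
  \<open>k = 2i + 1 + j\<close>. Up to a sum that vanishes by symmetry the weight \<open>2i + 1\<close> may be replaced by
  \<open>k\<close>; the terms with \<open>k\<close> divisible by 3 cancel, and the other two residue classes contribute
  equally, each a product with the pentagonal series.\<close>
lemma weighted_theta_euler_prod:
  fixes r :: real
  assumes r: "\<bar>r\<bar> < 1"
  shows "((\<lambda>n. of_int (3 * n + 1) * r ^ nat (3 * n\<^sup>2 + 2 * n)) has_sum (ftheta (- r) (- r) * euler_prod (r ^ 4) ^ 2)) UNIV"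
proof -
  let ?E = "euler_prod (r ^ 4)"
  have nr: "norm r < 1" using r by simp
  have E: "?E \<noteq> 0" using euler_prod_nonzero[of "r ^ 4"] norm_power_less_one[OF nr, of 4] by simp
  note e0 = nat_abs_le_square(2)[of 2 2] nat_abs_le_square(2)[of 3 2] nat_abs_le_square(2)[of 6 2] nat_abs_le_square(2)[of 6 6]
  define G :: "int \<times> int \<Rightarrow> real" where
    "G = (\<lambda>(i, j). int_sign (i + j) * of_int (2 * i + 1 + j) * r ^ nat (2 * i\<^sup>2 + 2 * i + j\<^sup>2))"
  define S where "S = (\<Sum>\<^sub>\<infinity>n. of_int (3 * n + 1) * r ^ nat (3 * n\<^sup>2 + 2 * n))"
  have S: "((\<lambda>n. of_int (3 * n + 1) * r ^ nat (3 * n\<^sup>2 + 2 * n)) has_sum S) UNIV"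
    unfolding S_def
  proof (rule has_sum_infsum, rule summable_theta_series[OF r])
    fix n :: int
    have "\<bar>3 * n + 1\<bar> \<le> 4 * (3 * n\<^sup>2 + 2 * n + 1)"
      using nat_abs_le_square(2,3)[of 3 2 n] by simp
    then have "\<bar>of_int (3 * n + 1) :: real\<bar> \<le> of_int (4 * (3 * n\<^sup>2 + 2 * n + 1))" unfolding of_int_abs[symmetric] of_int_le_iff .
    then show "\<bar>of_int (3 * n + 1) :: real\<bar> \<le> 4 * real (nat (3 * n\<^sup>2 + 2 * n) + 1)"
      using e0(2)[of n] by simp
  qed (use nat_abs_le_square(1)[of 3 2] in simp)
  have phi: "((\<lambda>j. int_sign j * r ^ nat (j\<^sup>2)) has_sum ftheta (- r) (- r)) UNIV"
    by (rule phi_has_sum[OF nr])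
  have G1: "((\<lambda>(i, j). int_sign i * of_int (2 * i + 1) * r ^ nat (2 * i\<^sup>2 + 2 * i) * (int_sign j * r ^ nat (j\<^sup>2))) has_sum (2 * ?E ^ 3 * ftheta (- r) (- r))) (UNIV \<times> UNIV)"
    by (rule has_sum_times[OF jacobi_cube_has_sum[OF r] phi])
  \<comment> \<open>The reflection i -> -1 - i fixes i^2 + i and changes the sign.\<close>
  have zero: "((\<lambda>i. int_sign i * r ^ nat (c * i\<^sup>2 + c * i)) has_sum 0) UNIV" if "c \<ge> 1" for c :: int
  proof -
    have "(\<lambda>i. int_sign i * r ^ nat (c * i\<^sup>2 + c * i)) summable_on UNIV"
      by (rule summable_theta_series[OF r, of _ 1]) (use nat_abs_le_square(1)[of c c] that in auto)
    then obtain z where z: "((\<lambda>i. int_sign i * r ^ nat (c * i\<^sup>2 + c * i)) has_sum z) UNIV"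
      using has_sum_infsum by blast
    moreover have "z = 0"
    proof (rule has_sum_antisymmetric[OF z, of "\<lambda>i. - 1 - i"])
      show "bij_betw (\<lambda>i::int. - 1 - i) UNIV UNIV" by (rule bij_betwI[of _ _ _ "\<lambda>i. - 1 - i"]) auto
      show "int_sign (- 1 - i) * r ^ nat (c * (- 1 - i)\<^sup>2 + c * (- 1 - i)) = - (int_sign i * r ^ nat (c * i\<^sup>2 + c * i))" for i
      proof -
        have "c * (- 1 - i)\<^sup>2 + c * (- 1 - i) = c * i\<^sup>2 + c * i" by (simp add: power2_eq_square algebra_simps)
        then show ?thesis by (simp add: int_sign_def)
      qed
    qed
    ultimately show ?thesis by simp
  qed
  have G0: "((\<lambda>(i, j). int_sign i * r ^ nat (2 * i\<^sup>2 + 2 * i) * (int_sign j * of_int j * r ^ nat (j\<^sup>2))) has_sum 0) (UNIV \<times> UNIV)"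
  proof -
    have "(\<lambda>j::int. int_sign j * of_int j * r ^ nat (j\<^sup>2)) summable_on UNIV"
    proof (rule summable_theta_series[OF r, of _ 1])
      fix n :: int
      have "\<bar>n\<bar> \<le> int (nat (n\<^sup>2)) + 1" "nat \<bar>n\<bar> \<le> nat (n\<^sup>2) + 1" using nat_abs_le_square(1,3)[of 1 0 n] by simp_all
      moreover from this have "\<bar>of_int n :: real\<bar> \<le> of_int (n\<^sup>2 + 1)"
        unfolding of_int_abs[symmetric] of_int_le_iff by simp
      ultimately show "nat \<bar>n\<bar> \<le> nat (n\<^sup>2) + 1" "\<bar>int_sign n * of_int n :: real\<bar> \<le> 1 * real (nat (n\<^sup>2) + 1)"
        by (simp_all add: abs_mult)
    qed
    from has_sum_times[OF zero[of 2] has_sum_infsum[OF this]] show ?thesis by simp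
  qed
  have G: "(G has_sum (2 * ?E ^ 3 * ftheta (- r) (- r))) UNIV"
  proof -
    have "((\<lambda>p. (\<lambda>(i, j). int_sign i * of_int (2 * i + 1) * r ^ nat (2 * i\<^sup>2 + 2 * i) * (int_sign j * r ^ nat (j\<^sup>2))) p
        + (\<lambda>(i, j). int_sign i * r ^ nat (2 * i\<^sup>2 + 2 * i) * (int_sign j * of_int j * r ^ nat (j\<^sup>2))) p)
        has_sum (2 * ?E ^ 3 * ftheta (- r) (- r) + 0)) (UNIV \<times> UNIV)"
      by (rule has_sum_add[OF G1 G0])
    moreover have "(\<lambda>p. (\<lambda>(i, j). int_sign i * of_int (2 * i + 1) * r ^ nat (2 * i\<^sup>2 + 2 * i) * (int_sign j * r ^ nat (j\<^sup>2))) p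
        + (\<lambda>(i, j). int_sign i * r ^ nat (2 * i\<^sup>2 + 2 * i) * (int_sign j * of_int j * r ^ nat (j\<^sup>2))) p) = G"
    proof (rule ext, clarify)
      fix i j :: int
      have "nat (2 * i\<^sup>2 + 2 * i + j\<^sup>2) = nat (2 * i\<^sup>2 + 2 * i) + nat (j\<^sup>2)"
        using e0(1)[of i] by (intro nat_add_distrib) auto
      then show "int_sign i * of_int (2 * i + 1) * r ^ nat (2 * i\<^sup>2 + 2 * i) * (int_sign j * r ^ nat (j\<^sup>2))
        + int_sign i * r ^ nat (2 * i\<^sup>2 + 2 * i) * (int_sign j * of_int j * r ^ nat (j\<^sup>2)) = G (i, j)"
        by (simp add: G_def int_sign_add power_add algebra_simps)
    qed
    ultimately show ?thesis by simp
  qed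
  let ?C = "\<lambda>c. {(i, j). (2 * i + 1 + j) mod 3 = (c::int)}"
  have C1: "(G has_sum (S * ?E)) (?C 1)"
  proof -
    have "((\<lambda>(l, i). of_int (3 * l + 1) * r ^ nat (3 * l\<^sup>2 + 2 * l) * (int_sign i * r ^ nat (6 * i\<^sup>2 + 2 * i))) has_sum (S * ?E)) (UNIV \<times> UNIV)"
      by (rule has_sum_times[OF S pentagonal_has_sum[OF nr]])
    \<comment> \<open>With k = 3l + 1 this substitution completes the square: the exponent separates
      into 3l^2 + 2l and 6i^2 + 2i, and the sign depends on i alone.\<close>
    moreover have b: "bij_betw (\<lambda>(l, i). (i + l, l - 2 * i)) (UNIV \<times> UNIV) (?C 1)"
      by (rule bij_betwI[of _ _ _ "\<lambda>(i, j). ((2 * i + j) div 3, i - (2 * i + j) div 3)"]) (auto; presburger)+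
    moreover have "G ((\<lambda>(l, i). (i + l, l - 2 * i)) p) = (\<lambda>(l, i). of_int (3 * l + 1) * r ^ nat (3 * l\<^sup>2 + 2 * l) * (int_sign i * r ^ nat (6 * i\<^sup>2 + 2 * i))) p" for p
    proof (cases p)
      case (Pair l i)
      have "2 * (i + l)\<^sup>2 + 2 * (i + l) + (l - 2 * i)\<^sup>2 = (3 * l\<^sup>2 + 2 * l) + (6 * i\<^sup>2 + 2 * i)"
        by (simp add: power2_eq_square algebra_simps)
      then have e: "nat (2 * (i + l)\<^sup>2 + 2 * (i + l) + (l - 2 * i)\<^sup>2) = nat (3 * l\<^sup>2 + 2 * l) + nat (6 * i\<^sup>2 + 2 * i)"
        using e0(2)[of l] e0(3)[of i] by (simp add: nat_add_distrib)
      show ?thesis unfolding Pair G_def case_prod_conv e by (simp add: int_sign_def power_add algebra_simps)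
    qed
    ultimately show ?thesis using has_sum_reindex_bij_betw[OF b, of G] by simp
  qed
  have C2: "(G has_sum (S * ?E)) (?C 2)"
  proof -
    \<comment> \<open>Sends k to -k; weight and sign both change, so G is invariant.\<close>
    have b: "bij_betw (\<lambda>(i, j). (- 1 - i, - j)) (?C 1) (?C 2)"
      by (rule bij_betwI[of _ _ _ "\<lambda>(i, j). (- 1 - i, - j)"]) (auto; presburger)+
    have "G ((\<lambda>(i, j). (- 1 - i, - j)) p) = G p" for p
    proof (cases p)
      case (Pair i j)
      have e: "2 * (- 1 - i)\<^sup>2 + 2 * (- 1 - i) + (- j)\<^sup>2 = 2 * i\<^sup>2 + 2 * i + j\<^sup>2"
        by (simp add: power2_eq_square algebra_simps)
      show ?thesis unfolding Pair G_def case_prod_conv e by (simp add: int_sign_def algebra_simps)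
    qed
    then show ?thesis using has_sum_reindex_bij_betw[OF b, of G] C1 by simp
  qed
  have C0: "(G has_sum 0) (?C 0)"
  proof -
    have "(G has_sum infsum G (?C 0)) (?C 0)"
      by (intro has_sum_infsum summable_on_subset_banach[OF has_sum_imp_summable[OF G]]) auto
    moreover have "infsum G (?C 0) = 0"
    proof (rule has_sum_antisymmetric[OF calculation])
      \<comment> \<open>On k = 3l this is i -> 2l - 1 - i with k held fixed. It preserves weight and
        exponent and changes the parity of i + j.\<close>
      let ?h = "\<lambda>(i, j). (2 * ((2 * i + 1 + j) div 3) - 1 - i, 2 * i + 1 - ((2 * i + 1 + j) div 3) :: int)"
      show "bij_betw ?h (?C 0) (?C 0)"
        by (rule bij_betwI[of _ _ _ ?h]) (auto; presburger)+
      fix p assume "p \<in> ?C 0"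
      then obtain i j where p: "p = (i, j)" "(2 * i + 1 + j) mod 3 = 0" by auto
      define l where "l = (2 * i + 1 + j) div 3"
      have j: "j = 3 * l - 1 - 2 * i" using p(2) unfolding l_def by presburger
      have h: "?h p = (2 * l - 1 - i, 2 * i + 1 - l)" unfolding p l_def by simp
      have e: "2 * (2 * l - 1 - i)\<^sup>2 + 2 * (2 * l - 1 - i) + (2 * i + 1 - l)\<^sup>2 = 2 * i\<^sup>2 + 2 * i + (3 * l - 1 - 2 * i)\<^sup>2"
        by (simp add: power2_eq_square algebra_simps)
      show "G (?h p) = - G p"
        unfolding h unfolding p j G_def case_prod_conv e by (simp add: int_sign_def algebra_simps)
    qed
    ultimately show ?thesis by simp
  qed
  have "(G has_sum (S * ?E + S * ?E + 0)) UNIV"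
  proof (rule has_sum_3_partition[OF C1 C2 C0])
    show "?C 1 \<union> ?C 2 \<union> ?C 0 = UNIV" by auto
  qed auto
  from has_sum_unique[OF this G] have "S * ?E = ftheta (- r) (- r) * ?E ^ 2 * ?E"
    by (simp add: power2_eq_square power3_eq_cube mult_ac)
  then show ?thesis using S E by simp
qed

lemma phi_cube_has_sum:
  fixes q :: real
  assumes "\<bar>q\<bar> < 1"
  shows "((\<lambda>n. int_sign n * q ^ nat (3 * n\<^sup>2)) has_sum ftheta (- (q ^ 3)) (- (q ^ 3))) UNIV"
proof -
  have "norm (q ^ 3) < 1" by (rule norm_power_less_one) (use assms in auto)
  moreover have "(q ^ 3) ^ nat (n\<^sup>2) = q ^ nat (3 * n\<^sup>2)" for n :: int
    unfolding power_mult[symmetric] by (simp add: nat_mult_distrib)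
  ultimately show ?thesis using phi_has_sum[of "q ^ 3"] by simp
qed

text \<open>The left side is the double series with weight
  \<open>1 + 3(3m^2+2m) - 9n^2 = (3(m+n)+1)(3(m-n)+1)\<close>. In the variables \<open>s = m+n\<close>, \<open>t = m-n\<close> it runs over
  the pairs with \<open>s + t\<close> even; with \<open>q = r^2\<close> the sum over the odd pairs is antisymmetric under
  swapping \<open>s\<close> and \<open>t\<close>, hence zero, so that the full sum is a product.\<close>
lemma ftheta_wronskian:
  fixes q :: real
  assumes q: "0 \<le> q" "q < 1"
  obtains N' D' where
    "((\<lambda>x. ftheta (- (x ^ 5)) (- x)) has_real_derivative N') (at q)"
    "((\<lambda>x. ftheta (- (x ^ 3)) (- (x ^ 3))) has_real_derivative D') (at q)"
    "ftheta (- (q ^ 5)) (- q) * ftheta (- (q ^ 3)) (- (q ^ 3))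
       + 3 * q * (N' * ftheta (- (q ^ 3)) (- (q ^ 3)) - ftheta (- (q ^ 5)) (- q) * D')
     = euler_prod q ^ 4 * euler_prod (q\<^sup>2) ^ 2"
proof -
  have q1: "\<bar>q\<bar> < 1" "norm q < 1" using q by auto
  define N where "N = ftheta (- (q ^ 5)) (- q)"
  define D where "D = ftheta (- (q ^ 3)) (- (q ^ 3))"
  define r where "r = sqrt q"
  have rq: "r\<^sup>2 = q" "0 \<le> r" "r < 1" using q by (auto simp: r_def)
  have r: "\<bar>r\<bar> < 1" "\<bar>- r\<bar> < 1" "norm r < 1" "norm (- r) < 1" using rq by auto
  have Nx: "ftheta (- (x ^ 5)) (- x) = (\<Sum>\<^sub>\<infinity>n. int_sign n * x ^ nat (3 * n\<^sup>2 + 2 * n))" if "\<bar>x\<bar> < 1" for x :: real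
    using ftheta_5_1_has_sum[of x] that by (simp add: infsumI)
  have Dx: "ftheta (- (x ^ 3)) (- (x ^ 3)) = (\<Sum>\<^sub>\<infinity>n. int_sign n * x ^ nat (3 * n\<^sup>2))" if "\<bar>x\<bar> < 1" for x :: real
    using phi_cube_has_sum[of x] that by (simp add: infsumI)
  have eN: "nat \<bar>n\<bar> \<le> nat (3 * n\<^sup>2 + 2 * n) + 1" for n using nat_abs_le_square(1)[of 3 2 n] by simp
  have eD: "nat \<bar>n\<bar> \<le> nat (3 * n\<^sup>2) + 1" for n using nat_abs_le_square(1)[of 3 0 n] by simp
  obtain N' where N': "((\<lambda>x. \<Sum>\<^sub>\<infinity>n. int_sign n * x ^ nat (3 * n\<^sup>2 + 2 * n)) has_real_derivative N') (at q)"
    "((\<lambda>n. int_sign n * real (nat (3 * n\<^sup>2 + 2 * n)) * q ^ nat (3 * n\<^sup>2 + 2 * n)) has_sum (q * N')) UNIV"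
    using theta_series_derivative[OF q1(1), of int_sign 1, OF _ eN] by auto
  obtain D' where D': "((\<lambda>x. \<Sum>\<^sub>\<infinity>n. int_sign n * x ^ nat (3 * n\<^sup>2)) has_real_derivative D') (at q)"
    "((\<lambda>n. int_sign n * real (nat (3 * n\<^sup>2)) * q ^ nat (3 * n\<^sup>2)) has_sum (q * D')) UNIV"
    using theta_series_derivative[OF q1(1), of int_sign 1, OF _ eD] by auto
  have derN: "((\<lambda>x. ftheta (- (x ^ 5)) (- x)) has_real_derivative N') (at q)"
    by (rule has_field_derivative_transform_within_open[OF N'(1), of "{-1<..<1}"]) (use q in \<open>auto simp: Nx\<close>)
  have derD: "((\<lambda>x. ftheta (- (x ^ 3)) (- (x ^ 3))) has_real_derivative D') (at q)"
    by (rule has_field_derivative_transform_within_open[OF D'(1), of "{-1<..<1}"]) (use q in \<open>auto simp: Dx\<close>)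
  note sN = ftheta_5_1_has_sum[OF q1(2), folded N_def]
  note sD = phi_cube_has_sum[OF q1(1), folded D_def]
  let ?e1 = "\<lambda>n::int. nat (3 * n\<^sup>2 + 2 * n)" and ?e0 = "\<lambda>n::int. nat (3 * n\<^sup>2)"
  have i1: "int (?e1 n) = 3 * n\<^sup>2 + 2 * n" and i0: "int (?e0 n) = 3 * n\<^sup>2" for n
    using nat_abs_le_square(2)[of 3 2 n] by simp_all
  have e1: "real (?e1 n) = of_int (3 * n\<^sup>2 + 2 * n)" for n
    using nat_abs_le_square(2)[of 3 2 n] by simp
  \<comment> \<open>The sign is deliberately attached to s alone: s and t have equal signs on the
    even pairs and opposite signs on the odd ones, and H still factors into a function of s times a
    function of t.\<close>
  define H :: "int \<times> int \<Rightarrow> real" where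
    "H = (\<lambda>(s, t). int_sign s * of_int ((3 * s + 1) * (3 * t + 1)) * r ^ (?e1 s + ?e1 t))"
  let ?P = "{(s, t). even (s + t)} :: (int \<times> int) set" and ?Q = "{(s, t). odd (s + t)} :: (int \<times> int) set"
  have HP: "(H has_sum (N * D + 3 * (q * N') * D - 3 * N * (q * D'))) ?P"
  proof -
    have "((\<lambda>p. (\<lambda>(m, n). int_sign m * q ^ ?e1 m * (int_sign n * q ^ ?e0 n)) p
        + 3 * (\<lambda>(m, n). int_sign m * real (?e1 m) * q ^ ?e1 m * (int_sign n * q ^ ?e0 n)) p
        + (- 3) * (\<lambda>(m, n). int_sign m * q ^ ?e1 m * (int_sign n * real (?e0 n) * q ^ ?e0 n)) p)
        has_sum (N * D + 3 * (q * N' * D) + (- 3) * (N * (q * D')))) (UNIV \<times> UNIV)"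
      by (intro has_sum_add has_sum_cmult_right has_sum_times sN sD N'(2) D'(2))
    moreover have "(\<lambda>(m, n). int_sign m * q ^ ?e1 m * (int_sign n * q ^ ?e0 n)) p
        + 3 * (\<lambda>(m, n). int_sign m * real (?e1 m) * q ^ ?e1 m * (int_sign n * q ^ ?e0 n)) p
        + (- 3) * (\<lambda>(m, n). int_sign m * q ^ ?e1 m * (int_sign n * real (?e0 n) * q ^ ?e0 n)) p
        = H ((\<lambda>(m, n). (m + n, m - n)) p)" for p
    proof (cases p)
      case (Pair m n)
      have "2 * (3 * m\<^sup>2 + 2 * m) + 2 * (3 * n\<^sup>2) = (3 * (m + n)\<^sup>2 + 2 * (m + n)) + (3 * (m - n)\<^sup>2 + 2 * (m - n))"
        by (simp add: power2_eq_square algebra_simps)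
      then have "int (2 * ?e1 m + 2 * ?e0 n) = int (?e1 (m + n) + ?e1 (m - n))"
        by (simp only: of_nat_add of_nat_mult of_nat_numeral i1 i0)
      then have e: "?e1 (m + n) + ?e1 (m - n) = 2 * ?e1 m + 2 * ?e0 n" by linarith
      have pw: "r ^ (2 * ?e1 m + 2 * ?e0 n) = q ^ ?e1 m * q ^ ?e0 n"
        unfolding power_add power_mult rq ..
      have w: "1 + 3 * real (?e1 m) - 3 * real (?e0 n) = of_int ((3 * (m + n) + 1) * (3 * (m - n) + 1))"
        unfolding e1 by (simp add: power2_eq_square algebra_simps)
      have "H (m + n, m - n) = int_sign m * int_sign n * (1 + 3 * real (?e1 m) - 3 * real (?e0 n)) * (q ^ ?e1 m * q ^ ?e0 n)"
        unfolding H_def case_prod_conv e pw w int_sign_add ..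
      then show ?thesis unfolding Pair case_prod_conv by (simp add: algebra_simps)
    qed
    moreover have b: "bij_betw (\<lambda>(m, n). (m + n, m - n)) (UNIV \<times> UNIV) ?P"
      by (rule bij_betwI[of _ _ _ "\<lambda>(s, t). ((s + t) div 2, (s - t) div 2)"]) (auto; presburger)+
    ultimately show ?thesis using has_sum_reindex_bij_betw[OF b, of H] by (simp add: algebra_simps)
  qed
  \<comment> \<open>Since 3n^2 + 2n has the parity of n, the signed series at r is the unsigned one
    at -r.\<close>
  have S1: "((\<lambda>n. int_sign n * of_int (3 * n + 1) * r ^ ?e1 n) has_sum (ftheta r r * euler_prod (r ^ 4) ^ 2)) UNIV"
  proof -
    have "(- r) ^ ?e1 n = int_sign n * r ^ ?e1 n" for n
    proof -
      have "even (?e1 n) \<longleftrightarrow> even n" using nat_abs_le_square(2)[of 3 2 n] by (simp add: even_nat_iff)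
      then show ?thesis by (simp add: power_minus[of r] minus_one_power_iff int_sign_def)
    qed
    then have eq: "of_int (3 * n + 1) * (- r) ^ ?e1 n = int_sign n * of_int (3 * n + 1) * r ^ ?e1 n" for n
      by simp
    show ?thesis using weighted_theta_euler_prod[OF r(2), unfolded eq] by simp
  qed
  have HU: "(H has_sum (ftheta r r * euler_prod (r ^ 4) ^ 2 * (ftheta (- r) (- r) * euler_prod (r ^ 4) ^ 2))) UNIV"
  proof -
    have "H = (\<lambda>(s, t). int_sign s * of_int (3 * s + 1) * r ^ ?e1 s * (of_int (3 * t + 1) * r ^ ?e1 t))"
      by (auto simp: H_def fun_eq_iff power_add)
    then show ?thesis using has_sum_times[OF S1 weighted_theta_euler_prod[OF r(1)]] by simp
  qed
  have HQ: "(H has_sum 0) ?Q"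
  proof -
    have "(H has_sum infsum H ?Q) ?Q"
      by (intro has_sum_infsum summable_on_subset_banach[OF has_sum_imp_summable[OF HU]]) auto
    moreover have "infsum H ?Q = 0"
    proof (rule has_sum_antisymmetric[OF calculation])
      show "bij_betw (\<lambda>(s, t). (t, s)) ?Q ?Q"
        by (rule bij_betwI[of _ _ _ "\<lambda>(s, t). (t, s)"]) auto
      show "H ((\<lambda>(s, t). (t, s)) p) = - H p" if "p \<in> ?Q" for p
        using that by (auto simp: H_def int_sign_def algebra_simps)
    qed
    ultimately show ?thesis by simp
  qed
  have "(H has_sum (N * D + 3 * (q * N') * D - 3 * N * (q * D') + 0)) (?P \<union> ?Q)"
    by (rule has_sum_Un_disjoint[OF HP HQ]) auto
  moreover have "?P \<union> ?Q = UNIV" by auto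
  ultimately have "N * D + 3 * (q * N') * D - 3 * N * (q * D') = ftheta r r * euler_prod (r ^ 4) ^ 2 * (ftheta (- r) (- r) * euler_prod (r ^ 4) ^ 2)"
    using has_sum_unique[OF _ HU] by simp
  also have "r ^ 4 = q\<^sup>2" using rq(1) by (metis power_mult mult_2 numeral_Bit0)
  also have "ftheta r r * euler_prod (q\<^sup>2) ^ 2 * (ftheta (- r) (- r) * euler_prod (q\<^sup>2) ^ 2) = euler_prod q ^ 4 * euler_prod (q\<^sup>2) ^ 2"
  proof -
    have "ftheta r r * euler_prod q = euler_prod (- r) ^ 2" "ftheta (- r) (- r) * euler_prod q = euler_prod r ^ 2"
      using phi_euler_prod[OF r(4)] phi_euler_prod[OF r(3)] by (simp_all add: rq(1))
    moreover have "euler_prod (- r) * euler_prod r * euler_prod (q\<^sup>2) = euler_prod q ^ 3"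
      using euler_prod_neg[OF r(3)] \<open>r ^ 4 = q\<^sup>2\<close> by (simp add: rq(1))
    moreover have "euler_prod q \<noteq> 0" using euler_prod_nonzero[OF q1(2)] .
    \<comment> \<open>Here a and b stand for phi(r) and phi(-r), m and p for E(-r) and E(r), y and z
      for E(q) and E(q^2). Multiplication by y^2 makes the three relations applicable.\<close>
    moreover have "a * z\<^sup>2 * (b * z\<^sup>2) = y ^ 4 * z\<^sup>2" if "a * y = m\<^sup>2" "b * y = p\<^sup>2" "m * p * z = y ^ 3" "y \<noteq> 0" for a b m p y z :: real
    proof -
      have "a * z\<^sup>2 * (b * z\<^sup>2) * y\<^sup>2 = (a * y) * (b * y) * z ^ 4" by (simp add: eval_nat_numeral)
      also have "\<dots> = (m * p * z)\<^sup>2 * z\<^sup>2" unfolding that(1,2) by (simp add: eval_nat_numeral)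
      also have "\<dots> = (y ^ 4 * z\<^sup>2) * y\<^sup>2" unfolding that(3) by (simp add: eval_nat_numeral)
      finally show ?thesis using that(4) by simp
    qed
    ultimately show ?thesis by blast
  qed
  finally have "N * D + 3 * q * (N' * D - N * D') = euler_prod q ^ 4 * euler_prod (q\<^sup>2) ^ 2"
    by (simp add: algebra_simps)
  then show ?thesis using that[OF derN derD] unfolding N_def D_def by blast
qed

section \<open>Cubic identities between eta quotients\<close>

text \<open>The third class is written as -3m - 1 instead of 3m + 2, so that its squares are those
  of 3m + 1 and both classes give the same series in phi.\<close>

lemma int_mod_3_classes:
  "bij_betw (\<lambda>m::int. 3 * m) UNIV {n. n mod 3 = 0}"
  "bij_betw (\<lambda>m::int. 3 * m + 1) UNIV {n. n mod 3 = 1}"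
  "bij_betw (\<lambda>m::int. - 3 * m - 1) UNIV {n. n mod 3 = 2}"
proof -
  show "bij_betw (\<lambda>m::int. 3 * m) UNIV {n. n mod 3 = 0}"
    by (rule bij_betwI[of _ _ _ "\<lambda>n. n div 3"]) auto
  show "bij_betw (\<lambda>m::int. 3 * m + 1) UNIV {n. n mod 3 = 1}"
    by (rule bij_betwI[of _ _ _ "\<lambda>n. n div 3"]) (simp_all, presburger+)
  show "bij_betw (\<lambda>m::int. - 3 * m - 1) UNIV {n. n mod 3 = 2}"
    by (rule bij_betwI[of _ _ _ "\<lambda>n. - ((n + 1) div 3)"]; simp add: Pi_iff; presburger)
qed

lemma has_sum_mod_3:
  fixes f :: "int \<Rightarrow> 'b::{topological_comm_monoid_add, t2_space}"
  assumes "((\<lambda>m. f (3 * m)) has_sum a) UNIV" "((\<lambda>m. f (3 * m + 1)) has_sum b) UNIV" "((\<lambda>m. f (- 3 * m - 1)) has_sum c) UNIV"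
  shows "(f has_sum (a + b + c)) UNIV"
proof (rule has_sum_3_partition)
  show "(f has_sum a) {n. n mod 3 = 0}"
    using assms(1) has_sum_reindex_bij_betw[OF int_mod_3_classes(1), of f] by simp
  show "(f has_sum b) {n. n mod 3 = 1}"
    using assms(2) has_sum_reindex_bij_betw[OF int_mod_3_classes(2), of f] by simp
  show "(f has_sum c) {n. n mod 3 = 2}"
    using assms(3) has_sum_reindex_bij_betw[OF int_mod_3_classes(3), of f] by simp
qed auto

text \<open>Multiples of 3 give phi(-x^9). For n = 3m + 1 and n = -3m - 1 the square is 3(3m^2 + 2m)
  + 1, so each of these classes contributes -x times N at x^3.\<close>

lemma phi_dissection:
  fixes x :: "'a::{real_normed_field,banach}"
  assumes x: "norm x < 1"
  shows "ftheta (- x) (- x) = ftheta (- (x ^ 9)) (- (x ^ 9)) - 2 * x * ftheta (- ((x ^ 3) ^ 5)) (- (x ^ 3))"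
proof -
  let ?N = "ftheta (- ((x ^ 3) ^ 5)) (- (x ^ 3))"
  let ?f = "\<lambda>n. int_sign n * x ^ nat (n\<^sup>2)"
  have n3: "norm (x ^ 3) < 1" "norm (x ^ 9) < 1" using x by (auto intro: norm_power_less_one)
  have "?f (3 * m) = int_sign m * (x ^ 9) ^ nat (m\<^sup>2)" for m
    unfolding power_mult[symmetric] by (simp add: int_sign_def nat_mult_distrib power_mult_distrib)
  then have a: "((\<lambda>m. ?f (3 * m)) has_sum ftheta (- (x ^ 9)) (- (x ^ 9))) UNIV"
    using phi_has_sum[OF n3(2)] by simp
  have "3 * nat (3 * m\<^sup>2 + 2 * m) + 1 = nat ((3 * m + 1)\<^sup>2)" for m
  proof -
    have "int (3 * nat (3 * m\<^sup>2 + 2 * m) + 1) = (3 * m + 1)\<^sup>2"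
      using nat_abs_le_square(2)[of 3 2 m] by (simp add: power2_eq_square algebra_simps)
    then show ?thesis by (metis nat_int)
  qed
  moreover have "(- 3 * m - 1)\<^sup>2 = (3 * m + 1)\<^sup>2" for m :: int by (simp add: power2_eq_square algebra_simps)
  ultimately have "?f (3 * m + 1) = - x * (int_sign m * (x ^ 3) ^ nat (3 * m\<^sup>2 + 2 * m))"
    "?f (- 3 * m - 1) = - x * (int_sign m * (x ^ 3) ^ nat (3 * m\<^sup>2 + 2 * m))" for m
    unfolding power_mult[symmetric] by (simp_all add: int_sign_def flip: power_Suc)
  then have bc: "((\<lambda>m. ?f (3 * m + 1)) has_sum - x * ?N) UNIV" "((\<lambda>m. ?f (- 3 * m - 1)) has_sum - x * ?N) UNIV"
    using has_sum_cmult_right[OF ftheta_5_1_has_sum[OF n3(1)], of "- x"] by simp_all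
  show ?thesis
    using has_sum_unique[OF phi_has_sum[OF x] has_sum_mod_3[OF a bc]] by (simp add: algebra_simps)
qed

lemma psi_has_sum:
  fixes x :: "'a::{real_normed_field,banach}"
  assumes "norm x < 1"
  shows "((\<lambda>n. x ^ nat (n * (n - 1) div 2)) has_sum ftheta 1 x) UNIV"
  using ftheta_has_sum(1)[of 1 x] assms by simp

text \<open>The exponent n(n-1)/2 is invariant under n -> 1 - n, which exchanges the residues 0 and
  1 modulo 3; hence the factor 2. On n = -3m - 1 it is 1 + 9 m(m+1)/2. Note that
  \<open>ftheta 1 x\<close> is 2 psi(x).\<close>

lemma psi_dissection:
  fixes x :: "'a::{real_normed_field,banach}"
  assumes x: "norm x < 1"
  shows "ftheta 1 x = 2 * ftheta (x ^ 3) ((x ^ 3)\<^sup>2) + x * ftheta 1 (x ^ 9)"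
proof -
  let ?F = "ftheta (x ^ 3) ((x ^ 3)\<^sup>2)"
  let ?f = "\<lambda>n. x ^ nat (n * (n - 1) div 2)"
  have n9: "norm (x ^ 9) < 1" and n: "norm (x ^ 3 * (x ^ 3)\<^sup>2) < 1"
    using x norm_power_less_one[OF x, of 9] by (auto simp: power_mult[symmetric] power_add[symmetric])
  have A: "((\<lambda>m::int. (x ^ 3) ^ (nat (m * (m + 1) div 2) + 2 * nat (m * (m - 1) div 2))) has_sum ?F) UNIV"
    using ftheta_has_sum(1)[OF n] by (simp add: power_add power_mult)
  have B: "((\<lambda>m. x * (x ^ 9) ^ nat (m * (m - 1) div 2)) has_sum x * ftheta 1 (x ^ 9)) UNIV"
    by (intro has_sum_cmult_right psi_has_sum n9)
  have e0: "nat ((3 * m) * (3 * m - 1) div 2) = 3 * (nat (m * (m + 1) div 2) + 2 * nat (m * (m - 1) div 2))" for m :: int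
  proof -
    have "int (nat ((3 * m) * (3 * m - 1) div 2)) * 2 = int (3 * (nat (m * (m + 1) div 2) + 2 * nat (m * (m - 1) div 2))) * 2"
      unfolding triangular_numbers using triangular_numbers[of m] by (simp add: algebra_simps)
    then show ?thesis by linarith
  qed
  have e1: "nat ((- 3 * m + 1) * (- 3 * m + 1 - 1) div 2) = nat ((3 * m) * (3 * m - 1) div 2)" for m :: int
    by (simp add: algebra_simps)
  have e2: "nat ((- 3 * m - 1) * (- 3 * m - 1 - 1) div 2) = 1 + 9 * nat ((- m) * (- m - 1) div 2)" for m :: int
  proof -
    have "int (nat ((- 3 * m - 1) * (- 3 * m - 1 - 1) div 2)) * 2 = int (1 + 9 * nat ((- m) * (- m - 1) div 2)) * 2"
      unfolding triangular_numbers using triangular_numbers[of "- m"] by (simp add: algebra_simps)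
    then show ?thesis by (simp only: mult_cancel_right of_nat_eq_iff) simp
  qed
  have neg: "bij_betw uminus (UNIV :: int set) UNIV" by (rule bij_betwI[of _ _ _ uminus]) auto
  have a: "((\<lambda>m. ?f (3 * m)) has_sum ?F) UNIV"
    unfolding e0 power_mult using A .
  have "((\<lambda>m. ?f (- 3 * m + 1)) has_sum ?F) UNIV"
    unfolding e1 by (rule a)
  then have b: "((\<lambda>m. ?f (3 * m + 1)) has_sum ?F) UNIV"
    using has_sum_reindex_bij_betw[OF neg, of "\<lambda>m. ?f (3 * m + 1)"] by simp
  have c: "((\<lambda>m. ?f (- 3 * m - 1)) has_sum x * ftheta 1 (x ^ 9)) UNIV"
    unfolding e2 using B has_sum_reindex_bij_betw[OF neg, of "\<lambda>m. x * (x ^ 9) ^ nat (m * (m - 1) div 2)"]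
    by (simp add: power_mult)
  show ?thesis
    using has_sum_unique[OF psi_has_sum[OF x] has_sum_mod_3[OF a b c]] by simp
qed

section \<open>Cubic identities by multiplying over the cube roots\<close>

lemma prod_linear_cube_roots:
  fixes w a b :: "'a::idom"
  assumes "1 + w + w\<^sup>2 = 0"
  shows "(a + b) * (a + w * b) * (a + w\<^sup>2 * b) = a ^ 3 + b ^ 3"
proof -
  have "(a + b) * (a + w * b) * (a + w\<^sup>2 * b) = a ^ 3 + b ^ 3 + (1 + w + w\<^sup>2) * (a\<^sup>2 * b + w * a * b\<^sup>2 + (w - 1) * b ^ 3)"
    by (simp add: algebra_simps eval_nat_numeral)
  then show ?thesis by (simp add: assms)
qed

text \<open>The two series in each dissection depend on x^3 only, so x -> w x changes just the
  explicit linear factor, and the three dissections multiply to a sum of two cubes. The same product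
  is evaluated by \<open>euler_prod_cube_roots\<close>. In terms of q = x^3, \<open>E k\<close> is
  E(q^k).\<close>

lemma eta_cube_identities_complex:
  fixes x w :: "'a::{real_normed_field,banach}"
  assumes x: "norm x < 1" and w: "1 + w + w\<^sup>2 = 0"
  defines "E \<equiv> \<lambda>k. euler_prod (x ^ (3 * k))"
  shows "(E 3 ^ 2 / E 6) ^ 3 - 8 * x ^ 3 * (E 1 * E 6 ^ 2 / (E 2 * E 3)) ^ 3 = E 1 ^ 8 * E 6 / (E 2 ^ 4 * E 3 ^ 2)"
    and "(E 2 * E 3 ^ 2 / (E 1 * E 6)) ^ 3 + x ^ 3 * (E 6 ^ 2 / E 3) ^ 3 = E 2 ^ 8 * E 3 / (E 1 ^ 4 * E 6 ^ 2)"
proof -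
  note w3 = cube_root_unity(1)[OF w]
  have "w ^ 4 = w ^ 3 * w" by (simp add: eval_nat_numeral)
  then have w4: "w ^ 4 = w" by (simp add: w3)
  have n: "norm (w * x) < 1" "norm (w\<^sup>2 * x) < 1" using x cube_root_unity(2)[OF w] by (simp_all add: norm_mult norm_power)
  have w': "1 + w\<^sup>2 + (w\<^sup>2)\<^sup>2 = 0"
  proof -
    have "(w\<^sup>2)\<^sup>2 = w" unfolding power_mult[symmetric] using w4 by simp
    then show ?thesis using w by (simp only: add_ac)
  qed
  have nk: "norm (x ^ k) < 1" if "k > 0" for k using x that by (rule norm_power_less_one)
  have nz: "E k \<noteq> 0" if "k > 0" for k unfolding E_def using that by (intro euler_prod_nonzero nk) auto
  have pw: "(w * x) ^ 3 = x ^ 3" "(w\<^sup>2 * x) ^ 3 = x ^ 3" "(w * x) ^ 9 = x ^ 9" "(w\<^sup>2 * x) ^ 9 = x ^ 9"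
  proof -
    show 1: "(w * x) ^ 3 = x ^ 3" by (simp add: power_mult_distrib w3)
    have "(w\<^sup>2) ^ 3 = (w ^ 3)\<^sup>2" by (simp only: power_mult[symmetric] mult.commute)
    then show 2: "(w\<^sup>2 * x) ^ 3 = x ^ 3" by (simp only: power_mult_distrib w3 power_one mult_1_left)
    have p9: "y ^ 9 = (y ^ 3) ^ 3" for y :: 'a by (simp add: power_mult[symmetric])
    show "(w * x) ^ 9 = x ^ 9" "(w\<^sup>2 * x) ^ 9 = x ^ 9" by (simp_all only: p9 1 2)
  qed
  have x3: "norm (x ^ 3) < 1" "norm (x ^ 9) < 1" by (simp_all add: nk)
  have EP: "euler_prod x * euler_prod (w * x) * euler_prod (w\<^sup>2 * x) * E 3 = E 1 ^ 4"
    using euler_prod_cube_roots[OF x w] by (simp add: E_def)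
  have EP2: "euler_prod (x\<^sup>2) * euler_prod ((w * x)\<^sup>2) * euler_prod ((w\<^sup>2 * x)\<^sup>2) * E 6 = E 2 ^ 4"
  proof -
    have "(x\<^sup>2) ^ 9 = x ^ (3 * 6)" "(x\<^sup>2) ^ 3 = x ^ (3 * 2)" by (simp_all flip: power_mult)
    moreover have "norm (x\<^sup>2) < 1" by (rule nk) simp
    ultimately show ?thesis
      using euler_prod_cube_roots[of "x\<^sup>2", OF _ w'] by (simp only: E_def power_mult_distrib)
  qed
  have EPd: "euler_prod x * euler_prod (w * x) * euler_prod (w\<^sup>2 * x) = E 1 ^ 4 / E 3"
    "euler_prod (x\<^sup>2) * euler_prod ((w * x)\<^sup>2) * euler_prod ((w\<^sup>2 * x)\<^sup>2) = E 2 ^ 4 / E 6"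
    unfolding EP[symmetric] EP2[symmetric] using nz[of 3] nz[of 6] by simp_all
  define D where "D = ftheta (- (x ^ 9)) (- (x ^ 9))"
  define N where "N = ftheta (- ((x ^ 3) ^ 5)) (- (x ^ 3))"
  define F where "F = ftheta (x ^ 3) ((x ^ 3)\<^sup>2)"
  define P where "P = ftheta 1 (x ^ 9)"
  have D: "D = E 3 ^ 2 / E 6"
    using phi_euler_prod[OF x3(2)] nz[of 6] by (simp add: D_def E_def power_mult[symmetric] field_simps)
  have N: "N = E 1 * E 6 ^ 2 / (E 2 * E 3)"
    using ftheta_5_1_euler_prod[OF x3(1)] nz[of 2] nz[of 3]
    by (simp add: N_def E_def power_mult[symmetric] field_simps)
  have F: "F = E 2 * E 3 ^ 2 / (E 1 * E 6)"
    using ftheta_1_2_euler_prod[OF x3(1)] nz[of 1] nz[of 6]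
    by (simp add: F_def E_def power_mult[symmetric] field_simps)
  have P: "P = 2 * (E 6 ^ 2 / E 3)"
    using psi_euler_prod[OF x3(2)] nz[of 3] by (simp add: P_def E_def power_mult[symmetric] field_simps)
  have prod3: "(f1 * f2 * f3) * (b1 * b2 * b3) = c1 * c2 * c3" if "f1 * b1 = c1" "f2 * b2 = c2" "f3 * b3 = c3" for f1 f2 f3 b1 b2 b3 c1 c2 c3 :: 'a
    unfolding that[symmetric] by (simp only: mult_ac)
  have "D ^ 3 - 8 * x ^ 3 * N ^ 3 = (D + - 2 * x * N) * (D + w * (- 2 * x * N)) * (D + w\<^sup>2 * (- 2 * x * N))"
    unfolding prod_linear_cube_roots[OF w] by (simp add: power_mult_distrib)
  also have "\<dots> = ftheta (- x) (- x) * ftheta (- (w * x)) (- (w * x)) * ftheta (- (w\<^sup>2 * x)) (- (w\<^sup>2 * x))"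
    using phi_dissection[OF x] phi_dissection[OF n(1)] phi_dissection[OF n(2)]
    unfolding pw D_def N_def by (simp add: mult_ac)
  finally have "(D ^ 3 - 8 * x ^ 3 * N ^ 3) * (euler_prod (x\<^sup>2) * euler_prod ((w * x)\<^sup>2) * euler_prod ((w\<^sup>2 * x)\<^sup>2))
     = (euler_prod x * euler_prod (w * x) * euler_prod (w\<^sup>2 * x)) ^ 2"
    using prod3[OF phi_euler_prod[OF x] phi_euler_prod[OF n(1)] phi_euler_prod[OF n(2)]]
    by (simp only: power_mult_distrib[of _ _ 2])
  from this[unfolded EPd] have 1: "(D ^ 3 - 8 * x ^ 3 * N ^ 3) * (E 2 ^ 4 / E 6) = (E 1 ^ 4 / E 3)\<^sup>2" by simp
  show "(E 3 ^ 2 / E 6) ^ 3 - 8 * x ^ 3 * (E 1 * E 6 ^ 2 / (E 2 * E 3)) ^ 3 = E 1 ^ 8 * E 6 / (E 2 ^ 4 * E 3 ^ 2)"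
  proof -
    have "D ^ 3 - 8 * x ^ 3 * N ^ 3 = (E 1 ^ 4 / E 3)\<^sup>2 / (E 2 ^ 4 / E 6)"
    proof -
      have "E 2 ^ 4 / E 6 \<noteq> 0" using nz[of 2] nz[of 6] by simp
      from nonzero_eq_divide_eq[OF this] 1 show ?thesis by blast
    qed
    also have "\<dots> = E 1 ^ 8 * E 6 / (E 2 ^ 4 * E 3 ^ 2)"
      by (simp add: power_divide power_mult[symmetric])
    finally show ?thesis unfolding D N .
  qed
  have "8 * (F ^ 3 + x ^ 3 * (P / 2) ^ 3) = (2 * F + x * P) * (2 * F + w * (x * P)) * (2 * F + w\<^sup>2 * (x * P))"
    unfolding prod_linear_cube_roots[OF w] by (simp add: power_mult_distrib power_divide)
  also have "\<dots> = ftheta 1 x * ftheta 1 (w * x) * ftheta 1 (w\<^sup>2 * x)"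
    using psi_dissection[OF x] psi_dissection[OF n(1)] psi_dissection[OF n(2)]
    unfolding pw F_def P_def by (simp add: mult_ac)
  finally have "8 * (F ^ 3 + x ^ 3 * (P / 2) ^ 3) * (euler_prod x * euler_prod (w * x) * euler_prod (w\<^sup>2 * x))
     = 8 * (euler_prod (x\<^sup>2) * euler_prod ((w * x)\<^sup>2) * euler_prod ((w\<^sup>2 * x)\<^sup>2)) ^ 2"
  proof -
    assume "8 * (F ^ 3 + x ^ 3 * (P / 2) ^ 3) = ftheta 1 x * ftheta 1 (w * x) * ftheta 1 (w\<^sup>2 * x)"
    moreover have "2 * a\<^sup>2 * (2 * b\<^sup>2) * (2 * c\<^sup>2) = 8 * (a * b * c)\<^sup>2" for a b c :: 'a
      by (simp add: power_mult_distrib)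
    ultimately show ?thesis
      using prod3[OF psi_euler_prod[OF x] psi_euler_prod[OF n(1)] psi_euler_prod[OF n(2)]] by metis
  qed
  from this[unfolded EPd, unfolded mult.assoc[of 8]] have 2: "(F ^ 3 + x ^ 3 * (P / 2) ^ 3) * (E 1 ^ 4 / E 3) = (E 2 ^ 4 / E 6)\<^sup>2"
    by (rule mult_left_cancel[THEN iffD1, rotated]) simp
  show "(E 2 * E 3 ^ 2 / (E 1 * E 6)) ^ 3 + x ^ 3 * (E 6 ^ 2 / E 3) ^ 3 = E 2 ^ 8 * E 3 / (E 1 ^ 4 * E 6 ^ 2)"
  proof -
    have "F ^ 3 + x ^ 3 * (P / 2) ^ 3 = (E 2 ^ 4 / E 6)\<^sup>2 / (E 1 ^ 4 / E 3)"
    proof -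
      have "E 1 ^ 4 / E 3 \<noteq> 0" using nz[of 1] nz[of 3] by simp
      from nonzero_eq_divide_eq[OF this] 2 show ?thesis by blast
    qed
    also have "\<dots> = E 2 ^ 8 * E 3 / (E 1 ^ 4 * E 6 ^ 2)"
      by (simp add: power_divide power_mult[symmetric])
    finally show ?thesis unfolding F P by simp
  qed
qed

text \<open>Only q = x^3 occurs in the identities, so they descend to the reals although w is not
  real.\<close>

lemma eta_cube_identities:
  fixes q :: real
  assumes q: "0 \<le> q" "q < 1"
  defines "E \<equiv> \<lambda>k. euler_prod (q ^ k)"
  shows "(E 3 ^ 2 / E 6) ^ 3 - 8 * q * (E 1 * E 6 ^ 2 / (E 2 * E 3)) ^ 3 = E 1 ^ 8 * E 6 / (E 2 ^ 4 * E 3 ^ 2)"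
    and "(E 2 * E 3 ^ 2 / (E 1 * E 6)) ^ 3 + q * (E 6 ^ 2 / E 3) ^ 3 = E 2 ^ 8 * E 3 / (E 1 ^ 4 * E 6 ^ 2)"
proof -
  define x where "x = complex_of_real (root 3 q)"
  define w where "w = Complex (- 1 / 2) (sqrt 3 / 2)"
  have w: "1 + w + w\<^sup>2 = 0"
    by (simp add: w_def power2_eq_square complex_eq_iff)
  have x3: "x ^ 3 = of_real q"
    using q unfolding x_def of_real_power[symmetric] by (simp add: real_root_pow_pos2)
  have "root 3 q < 1" using q by (simp add: real_root_lt_1_iff)
  then have nx: "norm x < 1" using q by (simp add: x_def)
  have E: "euler_prod (x ^ (3 * k)) = of_real (E k)" if "k > 0" for k
  proof -
    have "x ^ (3 * k) = of_real (q ^ k)" by (simp add: power_mult x3)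
    moreover have "\<bar>q ^ k\<bar> < 1" using norm_power_less_one[of q k] q that by simp
    ultimately show ?thesis by (simp only: euler_prod_of_real E_def)
  qed
  have E': "euler_prod (x ^ (3 * 1)) = of_real (E 1)" "euler_prod (x ^ (3 * 2)) = of_real (E 2)"
    "euler_prod (x ^ (3 * 3)) = of_real (E 3)" "euler_prod (x ^ (3 * 6)) = of_real (E 6)"
    by (rule E; simp)+
  note c = eta_cube_identities_complex[OF nx w, unfolded E' x3]
  have "complex_of_real ((E 3 ^ 2 / E 6) ^ 3 - 8 * q * (E 1 * E 6 ^ 2 / (E 2 * E 3)) ^ 3) = of_real (E 1 ^ 8 * E 6 / (E 2 ^ 4 * E 3 ^ 2))"
    using c(1) by simp
  then show "(E 3 ^ 2 / E 6) ^ 3 - 8 * q * (E 1 * E 6 ^ 2 / (E 2 * E 3)) ^ 3 = E 1 ^ 8 * E 6 / (E 2 ^ 4 * E 3 ^ 2)"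
    by (simp only: of_real_eq_iff)
  have "complex_of_real ((E 2 * E 3 ^ 2 / (E 1 * E 6)) ^ 3 + q * (E 6 ^ 2 / E 3) ^ 3) = of_real (E 2 ^ 8 * E 3 / (E 1 ^ 4 * E 6 ^ 2))"
    using c(2) by simp
  then show "(E 2 * E 3 ^ 2 / (E 1 * E 6)) ^ 3 + q * (E 6 ^ 2 / E 3) ^ 3 = E 2 ^ 8 * E 3 / (E 1 ^ 4 * E 6 ^ 2)"
    by (simp only: of_real_eq_iff)
qed

text \<open>The cube of the continued fraction.\<close>
definition cubic_modulus :: "real \<Rightarrow> real" where
  "cubic_modulus q = q * (ftheta (- (q ^ 5)) (- q) / ftheta (- (q ^ 3)) (- (q ^ 3))) ^ 3"

section \<open>The modulus as an eta quotient and its differential equations\<close>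

lemma rphi_eq_ftheta:
  assumes "\<bar>q\<bar> < 1"
  shows "rphi (- q) = ftheta (- q) (- q)"
proof -
  have "(- q) ^ nat (n\<^sup>2) = int_sign n * q ^ nat (n\<^sup>2)" for n
    by (simp add: power_minus[of q] minus_one_power_iff int_sign_def even_nat_iff)
  then show ?thesis unfolding rphi_def using phi_has_sum[of q] assms by (simp add: infsumI)
qed

text \<open>Every triangular exponent occurs twice in the bilateral series, at n and at 1 -
  n.\<close>

lemma rpsi_eq_ftheta:
  assumes "\<bar>q\<bar> < 1"
  shows "rpsi q = ftheta 1 q / 2"
proof -
  have "norm (1 * q) < 1" using assms by simp
  note s = summable_triple_term[OF this, THEN summable_norm_cancel]
  have tri: "n * (n + 1) div 2 = Suc n choose 2" for n unfolding choose_two by (simp add: algebra_simps)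
  define t where "t n = q ^ (Suc n choose 2)" for n
  have t: "summable t" using s(2) by (simp add: t_def[abs_def] Suc_choose_two power_add)
  have "ftheta 1 q = 1 + (\<Sum>k. t k + t (Suc k))"
    unfolding ftheta_has_sum(2)[OF \<open>norm (1 * q) < 1\<close>]
    by (simp add: triple_term_def t_def Suc_choose_two[of "Suc _"] power_add algebra_simps)
  moreover have "(\<Sum>k. t k + t (Suc k)) = suminf t + (\<Sum>k. t (Suc k))"
    using t by (intro suminf_add[symmetric]) (simp_all add: summable_Suc_iff)
  moreover have "(\<Sum>k. t (Suc k)) = suminf t - t 0" by (rule suminf_split_head[OF t])
  moreover have "t 0 = 1" by (simp add: t_def eval_nat_numeral)
  ultimately have "ftheta 1 q = 2 * suminf t" by simp
  then show ?thesis unfolding rpsi_def tri t_def[symmetric] by simp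
qed

lemma eta_quotients:
  fixes q :: real
  assumes q: "0 \<le> q" "q < 1"
  defines "E \<equiv> \<lambda>k. euler_prod (q ^ k)"
  shows "E 1 > 0" "E 2 > 0" "E 3 > 0" "E 6 > 0"
    "ftheta (- q) (- q) = E 1 ^ 2 / E 2"
    "ftheta (- (q ^ 3)) (- (q ^ 3)) = E 3 ^ 2 / E 6"
    "ftheta (- (q ^ 5)) (- q) = E 1 * E 6 ^ 2 / (E 2 * E 3)"
    "rpsi q = E 2 ^ 2 / E 1"
    "rpsi (q ^ 3) = E 6 ^ 2 / E 3"
proof -
  have qk: "0 \<le> q ^ k" "q ^ k < 1" "norm (q ^ k) < 1" if "k > 0" for k
    using q that norm_power_less_one[of q k] by auto
  have pos: "E k > 0" if "k > 0" for k unfolding E_def using qk[OF that] by (intro euler_prod_pos) auto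
  then show p: "E 1 > 0" "E 2 > 0" "E 3 > 0" "E 6 > 0" by simp_all
  have nq: "norm q < 1" "\<bar>q\<bar> < 1" and n3: "norm (q ^ 3) < 1" "\<bar>q ^ 3\<bar> < 1" using q qk[of 3] by auto
  show "ftheta (- q) (- q) = E 1 ^ 2 / E 2"
    using phi_euler_prod[OF nq(1)] p by (simp add: E_def field_simps)
  show "ftheta (- (q ^ 3)) (- (q ^ 3)) = E 3 ^ 2 / E 6"
    using phi_euler_prod[OF n3(1)] p by (simp add: E_def power_mult[symmetric] field_simps)
  show "ftheta (- (q ^ 5)) (- q) = E 1 * E 6 ^ 2 / (E 2 * E 3)"
    using ftheta_5_1_euler_prod[OF nq(1)] p by (simp add: E_def field_simps)
  show "rpsi q = E 2 ^ 2 / E 1"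
    unfolding rpsi_eq_ftheta[OF nq(2)] using psi_euler_prod[OF nq(1)] p by (simp add: E_def field_simps)
  show "rpsi (q ^ 3) = E 6 ^ 2 / E 3"
    unfolding rpsi_eq_ftheta[OF n3(2)] using psi_euler_prod[OF n3(1)] p by (simp add: E_def power_mult[symmetric] field_simps)
qed

text \<open>The modulus u is q (N/D)^3 and also q times the cube of psi(q^3)/f(q,q^2). Dividing the
  first cubic identity by D^3 gives 1 - 8u, dividing the second by f(q,q^2)^3 gives 1 + u.\<close>

lemma cubic_modulus_eta:
  fixes q :: real
  assumes q: "0 \<le> q" "q < 1"
  defines "E \<equiv> \<lambda>k. euler_prod (q ^ k)"
  shows "cubic_modulus q = q * E 1 ^ 3 * E 6 ^ 9 / (E 2 ^ 3 * E 3 ^ 9)"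
    and "1 - 8 * cubic_modulus q = E 1 ^ 8 * E 6 ^ 4 / (E 2 ^ 4 * E 3 ^ 8)"
    and "1 + cubic_modulus q = E 2 ^ 5 * E 6 / (E 1 * E 3 ^ 5)"
proof -
  have E: "euler_prod (q ^ k) = E k" for k by (simp add: E_def)
  note e = eta_quotients[OF q, unfolded E]
  note c = eta_cube_identities[OF q, unfolded E]
  have nz: "E 1 \<noteq> 0" "E 2 \<noteq> 0" "E 3 \<noteq> 0" "E 6 \<noteq> 0" using e(1-4) by auto
  have "b * z\<^sup>2 / (c * d) / (d\<^sup>2 / z) = b * z ^ 3 / (c * d ^ 3)" if "c \<noteq> 0" "d \<noteq> 0" "z \<noteq> 0" for b c d z :: real
    using that by (simp add: field_simps eval_nat_numeral)
  from this[of "E 2" "E 3" "E 6" "E 1"] nz have "E 1 * E 6 ^ 2 / (E 2 * E 3) / (E 3 ^ 2 / E 6) = E 1 * E 6 ^ 3 / (E 2 * E 3 ^ 3)"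
    by blast
  then show u: "cubic_modulus q = q * E 1 ^ 3 * E 6 ^ 9 / (E 2 ^ 3 * E 3 ^ 9)"
    unfolding cubic_modulus_def e(6,7) by (simp add: power_divide power_mult_distrib power_mult[symmetric])
  have 1: "1 - 8 * (y * a ^ 3 * d ^ 9 / (b ^ 3 * c ^ 9)) = a ^ 8 * d ^ 4 / (b ^ 4 * c ^ 8)"
    if "(c ^ 2 / d) ^ 3 - 8 * y * (a * d ^ 2 / (b * c)) ^ 3 = a ^ 8 * d / (b ^ 4 * c ^ 2)" "a \<noteq> 0" "b \<noteq> 0" "c \<noteq> 0" "d \<noteq> 0" for a b c d y :: real
  proof -
    have "1 - 8 * (y * a ^ 3 * d ^ 9 / (b ^ 3 * c ^ 9)) = ((c ^ 2 / d) ^ 3 - 8 * y * (a * d ^ 2 / (b * c)) ^ 3) * (d ^ 3 / c ^ 6)"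
      using that(2-5) by (simp add: field_simps power_mult_distrib power_divide eval_nat_numeral)
    also have "\<dots> = a ^ 8 * d ^ 4 / (b ^ 4 * c ^ 8)"
      unfolding that(1) using that(2-5) by (simp add: field_simps eval_nat_numeral)
    finally show ?thesis .
  qed
  show "1 - 8 * cubic_modulus q = E 1 ^ 8 * E 6 ^ 4 / (E 2 ^ 4 * E 3 ^ 8)"
    unfolding u by (rule 1[OF c(1) nz])
  have 2: "1 + y * a ^ 3 * d ^ 9 / (b ^ 3 * c ^ 9) = b ^ 5 * d / (a * c ^ 5)"
    if "(b * c ^ 2 / (a * d)) ^ 3 + y * (d ^ 2 / c) ^ 3 = b ^ 8 * c / (a ^ 4 * d ^ 2)" "a \<noteq> 0" "b \<noteq> 0" "c \<noteq> 0" "d \<noteq> 0" for a b c d y :: real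
  proof -
    have "1 + y * a ^ 3 * d ^ 9 / (b ^ 3 * c ^ 9) = ((b * c ^ 2 / (a * d)) ^ 3 + y * (d ^ 2 / c) ^ 3) * (a ^ 3 * d ^ 3 / (b ^ 3 * c ^ 6))"
      using that(2-5) by (simp add: field_simps power_mult_distrib power_divide eval_nat_numeral)
    also have "\<dots> = b ^ 5 * d / (a * c ^ 5)"
      unfolding that(1) using that(2-5) by (simp add: field_simps eval_nat_numeral)
    finally show ?thesis .
  qed
  show "1 + cubic_modulus q = E 2 ^ 5 * E 6 / (E 1 * E 3 ^ 5)"
    unfolding u by (rule 2[OF c(2) nz])
qed

lemma cubic_modulus_bounds:
  assumes "0 < q" "q < 1"
  shows "cubic_modulus q > 0" "1 - 8 * cubic_modulus q > 0"
  using cubic_modulus_eta[of q] eta_quotients(1-4)[of q] assms by simp_all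

text \<open>Both formulas are factorisations of u' = E1^6 E6^8 / E3^10, where Ek = E(q^k). The
  second is multiplied by q so that q = 0, the left end of the psi integral, is covered.\<close>

lemma cubic_modulus_derivative:
  assumes q: "0 \<le> q" "q < 1"
  obtains d where "(cubic_modulus has_real_derivative d) (at q)"
    "d = (1 - 8 * cubic_modulus q) * ((rpsi q)\<^sup>2 * (rpsi (q ^ 3))\<^sup>2)"
    "q * d = cubic_modulus q * (1 + cubic_modulus q) * ((rphi (- q))\<^sup>2 * (rphi (- (q ^ 3)))\<^sup>2)"
proof -
  define E where "E k = euler_prod (q ^ k)" for k
  note e = eta_quotients[OF q, folded E_def] and u = cubic_modulus_eta[OF q, folded E_def]
  have nz: "E 1 \<noteq> 0" "E 2 \<noteq> 0" "E 3 \<noteq> 0" "E 6 \<noteq> 0" using e(1-4) by auto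
  define N where "N = ftheta (- (q ^ 5)) (- q)"
  define D where "D = ftheta (- (q ^ 3)) (- (q ^ 3))"
  obtain N' D' where der: "((\<lambda>x. ftheta (- (x ^ 5)) (- x)) has_real_derivative N') (at q)"
    "((\<lambda>x. ftheta (- (x ^ 3)) (- (x ^ 3))) has_real_derivative D') (at q)"
    and "N * D + 3 * q * (N' * D - N * D') = euler_prod q ^ 4 * euler_prod (q\<^sup>2) ^ 2"
    using ftheta_wronskian[OF q] unfolding N_def D_def by blast
  then have W: "N * D + 3 * q * (N' * D - N * D') = E 1 ^ 4 * E 2 ^ 2" by (simp add: E_def)
  have D: "D \<noteq> 0" unfolding D_def e(6) using nz by simp
  define d where "d = N\<^sup>2 / D ^ 4 * (N * D + 3 * q * (N' * D - N * D'))"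
  have "((\<lambda>x. x * (ftheta (- (x ^ 5)) (- x) / ftheta (- (x ^ 3)) (- (x ^ 3))) ^ 3) has_real_derivative
     1 * (N / D) ^ 3 + of_nat 3 * ((N' * D - N * D') / (D * D) * (N / D) ^ (3 - Suc 0)) * q) (at q)"
    unfolding N_def D_def using D by (intro DERIV_mult' DERIV_mult DERIV_ident DERIV_power DERIV_divide der) (simp add: D_def)
  also have "1 * (N / D) ^ 3 + of_nat 3 * ((N' * D - N * D') / (D * D) * (N / D) ^ (3 - Suc 0)) * q = d"
  proof -
    have "(N / D) ^ 3 + 3 * (X / (D * D) * (N / D) ^ 2) * q = N\<^sup>2 / D ^ 4 * (N * D + 3 * q * X)" for X
      using D by (simp add: power_divide divide_simps) (simp add: eval_nat_numeral algebra_simps)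
    then show ?thesis unfolding d_def by simp
  qed
  finally have "(cubic_modulus has_real_derivative d) (at q)" unfolding cubic_modulus_def[abs_def] .
  moreover have d: "d = E 1 ^ 6 * E 6 ^ 8 / E 3 ^ 10"
  proof -
    have "(a * f\<^sup>2 / (b * c))\<^sup>2 / (c\<^sup>2 / f) ^ 4 * (a ^ 4 * b\<^sup>2) = a ^ 6 * f ^ 8 / c ^ 10" if "a \<noteq> 0" "b \<noteq> 0" "c \<noteq> 0" "f \<noteq> 0" for a b c f :: real
      using that by (simp add: power_divide power_mult_distrib power_mult[symmetric] divide_simps)
    note key = this[OF nz]
    have "d = N\<^sup>2 / D ^ 4 * (E 1 ^ 4 * E 2 ^ 2)" unfolding d_def W ..
    also have "\<dots> = E 1 ^ 6 * E 6 ^ 8 / E 3 ^ 10" unfolding N_def D_def e(6,7) by (rule key)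
    finally show ?thesis .
  qed
  moreover have "d = (1 - 8 * cubic_modulus q) * ((rpsi q)\<^sup>2 * (rpsi (q ^ 3))\<^sup>2)"
  proof -
    have "a ^ 6 * f ^ 8 / c ^ 10 = a ^ 8 * f ^ 4 / (b ^ 4 * c ^ 8) * ((b\<^sup>2 / a)\<^sup>2 * (f\<^sup>2 / c)\<^sup>2)" if "a \<noteq> 0" "b \<noteq> 0" "c \<noteq> 0" "f \<noteq> 0" for a b c f :: real
      using that by (simp add: power_divide power_mult_distrib power_mult[symmetric] divide_simps) (simp add: eval_nat_numeral)
    note key = this[OF nz]
    show ?thesis unfolding d u(2) e(8,9) by (rule key)
  qed
  moreover have "q * d = cubic_modulus q * (1 + cubic_modulus q) * ((rphi (- q))\<^sup>2 * (rphi (- (q ^ 3)))\<^sup>2)"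
  proof -
    have "\<bar>q\<bar> < 1" "\<bar>q ^ 3\<bar> < 1" using q norm_power_less_one[of q 3] by auto
    note p = this[THEN rphi_eq_ftheta]
    have "q * (a ^ 6 * f ^ 8 / c ^ 10) = q * a ^ 3 * f ^ 9 / (b ^ 3 * c ^ 9) * (b ^ 5 * f / (a * c ^ 5)) * ((a\<^sup>2 / b)\<^sup>2 * (c\<^sup>2 / f)\<^sup>2)" if "a \<noteq> 0" "b \<noteq> 0" "c \<noteq> 0" "f \<noteq> 0" for a b c f :: real
      using that by (simp add: power_divide power_mult_distrib power_mult[symmetric] divide_simps) (simp add: eval_nat_numeral)
    note key = this[OF nz]
    show ?thesis unfolding d u(3) unfolding u(1) p e(5,6) by (rule key)
  qed
  ultimately show ?thesis using that by blast
qed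

text \<open>Compare the triple products factor by factor. As \<open>K\<close> is arbitrary, this forces
  \<open>phi(-q)/phi(-q^3)\<close> to tend to 0 as \<open>q\<close> tends to 1.\<close>
lemma phi_quotient_le:
  fixes q :: real
  assumes q: "0 < q" "q < 1"
  shows "ftheta (- q) (- q) * (\<Prod>k<K. 1 + q ^ (2 * k + 1)) \<le> ftheta (- (q ^ 3)) (- (q ^ 3))"
proof -
  define g where "g x k = (1 - x ^ (2 * k + 1))\<^sup>2 * (1 - x ^ (2 * k + 2))" for x :: real and k
  have lim: "(\<lambda>n. \<Prod>k<n. g x k) \<longlonglongrightarrow> ftheta (- x) (- x)" if "norm x < 1" for x :: real
  proof -
    have "norm (- x * - x) < 1" using norm_power_less_one[OF that, of 2] by (simp add: power2_eq_square)
    moreover have "(1 + - x * (- x * - x) ^ k) * (1 + - x * (- x * - x) ^ k) * (1 - (- x * - x) ^ Suc k) = g x k" for k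
    proof -
      have "(- x * - x) ^ k = x ^ (2 * k)" "(- x * - x) ^ Suc k = x ^ (2 * k + 2)"
        by (simp_all add: power_mult power_add power2_eq_square)
      then show ?thesis by (simp add: g_def power2_eq_square[of "1 - _"])
    qed
    ultimately show ?thesis using triple_product[of "- x" "- x"] by simp
  qed
  have g: "0 \<le> g q k" "g q k * (1 + q ^ (2 * k + 1)) \<le> g (q ^ 3) k" "g q k \<le> g (q ^ 3) k" for k
  proof -
    define y where "y = q ^ (2 * k + 1)"
    have y: "0 \<le> y" "y < 1" "q ^ (2 * k + 2) = y * q" "0 \<le> y * q"
      using q power_Suc_less_one[of q "2 * k"] by (simp_all add: y_def)
    moreover have "y * q \<le> y * 1" using y(1) q by (intro mult_left_mono) auto
    ultimately have y5: "y * q < 1" by simp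
    show g0: "0 \<le> g q k" unfolding g_def y_def[symmetric] y(3) using y y5 by simp
    have cube: "1 - z ^ 3 = (1 - z) * (1 + z + z\<^sup>2)" for z :: real by (simp add: algebra_simps eval_nat_numeral)
    have pw: "(q ^ 3) ^ j = (q ^ j) ^ 3" for j by (simp flip: power_mult add: mult.commute)
    have g3: "g (q ^ 3) k = g q k * ((1 + y + y\<^sup>2)\<^sup>2 * (1 + y * q + (y * q)\<^sup>2))"
      unfolding g_def pw unfolding y_def[symmetric] y(3) cube by (simp only: power_mult_distrib mult_ac)
    have a: "1 + y \<le> (1 + y + y\<^sup>2)\<^sup>2 * (1 + y * q + (y * q)\<^sup>2)"
    proof -
      have "(1 + y) * 1 * 1 \<le> (1 + y + y\<^sup>2) * (1 + y + y\<^sup>2) * (1 + y * q + (y * q)\<^sup>2)"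
        using y by (intro mult_mono mult_nonneg_nonneg add_nonneg_nonneg) auto
      then show ?thesis by (simp add: power2_eq_square)
    qed
    then show "g q k * (1 + q ^ (2 * k + 1)) \<le> g (q ^ 3) k"
      unfolding g3 y_def[symmetric] using g0 by (rule mult_left_mono)
    have "1 \<le> (1 + y + y\<^sup>2)\<^sup>2 * (1 + y * q + (y * q)\<^sup>2)" using a y(1) by linarith
    from mult_left_mono[OF this g0] show "g q k \<le> g (q ^ 3) k" unfolding g3 by simp
  qed
  have "norm q < 1" "norm (q ^ 3) < 1" using q norm_power_less_one[of q 3] by auto
  note l = this[THEN lim]
  have "(\<Prod>k<n. g q k) * (\<Prod>k<K. 1 + q ^ (2 * k + 1)) \<le> (\<Prod>k<n. g (q ^ 3) k)" if "n \<ge> K" for n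
  proof -
    \<comment> \<open>The sharper bound is spent on the first K factors only; the others use
      \<open>g q k\<close> \<le> \<open>g (q ^ 3) k\<close>.\<close>
    have "(\<Prod>k<K. 1 + q ^ (2 * k + 1)) = (\<Prod>k<n. if k < K then 1 + q ^ (2 * k + 1) else 1)"
      using that by (intro prod.mono_neutral_cong_left) auto
    then have "(\<Prod>k<n. g q k) * (\<Prod>k<K. 1 + q ^ (2 * k + 1)) = (\<Prod>k<n. g q k * (if k < K then 1 + q ^ (2 * k + 1) else 1))"
      by (simp only: prod.distrib)
    also have "\<dots> \<le> (\<Prod>k<n. g (q ^ 3) k)"
      using g q by (intro prod_mono) auto
    finally show ?thesis .
  qed
  then show ?thesis
    by (intro LIMSEQ_le[OF tendsto_mult[OF l(1) tendsto_const] l(2)]) auto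
qed

text \<open>With R = phi(-q)/phi(-q^3) one has 1 - 8u = R^4, so R must tend to 0. For each K, R
  times a product with limit 2^K is at most 1.\<close>

lemma cubic_modulus_tendsto: "(cubic_modulus \<longlongrightarrow> 1 / 8) (at_left 1)"
proof -
  define R where "R q = ftheta (- q) (- q) / ftheta (- (q ^ 3)) (- (q ^ 3))" for q :: real
  have ev: "\<forall>\<^sub>F q in at_left (1::real). 0 < q \<and> q < 1"
    using eventually_at_left_real[of 0 1] by simp
  have R: "0 \<le> R q" "R q * (\<Prod>k<K. 1 + q ^ (2 * k + 1)) \<le> 1" "cubic_modulus q = (1 - R q ^ 4) / 8" if "0 < q" "q < 1" for q K
  proof -
    have q: "0 \<le> q" "q < 1" using that by auto
    define E where "E k = euler_prod (q ^ k)" for k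
    note e = eta_quotients[OF q, folded E_def] and u = cubic_modulus_eta[OF q, folded E_def]
    have D: "ftheta (- (q ^ 3)) (- (q ^ 3)) > 0" unfolding e(6) using e(1-4) by simp
    show "0 \<le> R q" unfolding R_def e(5,6) using e(1-4) by simp
    show "R q * (\<Prod>k<K. 1 + q ^ (2 * k + 1)) \<le> 1"
      unfolding R_def using phi_quotient_le[OF that] D by (simp add: field_simps)
    have "R q ^ 4 = E 1 ^ 8 * E 6 ^ 4 / (E 2 ^ 4 * E 3 ^ 8)"
      unfolding R_def e(5,6) by (simp add: power_divide power_mult_distrib power_mult[symmetric])
    with u(2) show "cubic_modulus q = (1 - R q ^ 4) / 8" by simp
  qed
  have "(R \<longlongrightarrow> 0) (at_left 1)"
  proof (rule order_tendstoI)
    fix a :: real assume "a < 0"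
    then show "\<forall>\<^sub>F q in at_left 1. a < R q"
      using ev by (auto elim!: eventually_mono intro: less_le_trans[OF _ R(1)])
  next
    fix a :: real assume a: "0 < a"
    obtain K where K: "1 / a < 2 ^ K" using real_arch_pow[of 2 "1 / a"] by auto
    have "((\<lambda>q::real. \<Prod>k<K. 1 + q ^ (2 * k + 1)) \<longlongrightarrow> (\<Prod>k<K. 1 + 1 ^ (2 * k + 1))) (at_left 1)"
      by (intro tendsto_intros)
    then have "((\<lambda>q::real. \<Prod>k<K. 1 + q ^ (2 * k + 1)) \<longlongrightarrow> 2 ^ K) (at_left 1)" by simp
    from order_tendstoD(1)[OF this K] ev show "\<forall>\<^sub>F q in at_left 1. R q < a"
    proof eventually_elim
      case (elim q)
      show "R q < a"
      proof (rule ccontr)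
        assume "\<not> R q < a"
        then have "a * (1 / a) < R q * (\<Prod>k<K. 1 + q ^ (2 * k + 1))"
          using elim a by (intro mult_le_less_imp_less) auto
        then show False using R(2)[of q K] elim a by simp
      qed
    qed
  qed
  then have "((\<lambda>q. (1 - R q ^ 4) / 8) \<longlongrightarrow> (1 - 0 ^ 4) / 8) (at_left 1)"
    by (intro tendsto_intros) auto
  then have "((\<lambda>q. (1 - R q ^ 4) / 8) \<longlongrightarrow> 1 / 8) (at_left 1)" by simp
  then show ?thesis
    by (rule Lim_transform_eventually) (use ev in \<open>auto elim!: eventually_mono simp: R(3)\<close>)
qed

section \<open>The continued fraction\<close>

lemma power_even_Suc: "(q::real) ^ (2 * n + 2) = (q\<^sup>2) ^ Suc n"
  by (simp add: power_mult power_add power2_eq_square)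

lemma cf_tail_ge_1:
  assumes "0 \<le> q"
  shows "cf_tail q n k \<ge> 1"
proof (induction k arbitrary: n)
  case (Suc k)
  have "(q ^ n + q ^ (2 * n)) / cf_tail q (Suc n) k \<ge> 0"
    using Suc[of "Suc n"] assms by (intro divide_nonneg_nonneg) auto
  then show ?case by simp
qed simp

text \<open>One level of the fraction multiplies the error by b_i divided by two denominators that
  are at least 1, hence by at most b_i. A single b_i may exceed 1, but b_i tends to 0, so the
  products of the b_i do as well.\<close>

lemma cf_tail_tendsto:
  fixes T :: "nat \<Rightarrow> real"
  assumes q: "0 < q" "q < 1"
    and T: "\<And>n. T n \<ge> 1" "\<And>n. T n = 1 + (q ^ n + q ^ (2 * n)) / T (Suc n)"
  shows "cf_tail q n \<longlonglongrightarrow> T n"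
proof -
  define b where "b i = q ^ i + q ^ (2 * i)" for i
  have b: "0 < b i" "b i \<le> 2" for i
  proof -
    have "0 < q ^ j" "q ^ j \<le> 1" for j using q by (simp_all add: power_le_one)
    from this[of i] this[of "2 * i"] show "0 < b i" "b i \<le> 2" unfolding b_def by linarith+
  qed
  \<comment> \<open>The constant 2 is the case N = 0: the truncated tail is 1, and T n differs from
    1 by at most b n \<le> 2.\<close>
  have err: "\<bar>cf_tail q n N - T n\<bar> \<le> 2 * (\<Prod>i<N. b (n + i))" for N n
  proof (induction N arbitrary: n)
    case 0
    have "b n / T (Suc n) \<le> b n / 1" using b[of n] T(1)[of "Suc n"] by (intro divide_left_mono) auto
    moreover have "0 \<le> b n / T (Suc n)" using b[of n] T(1)[of "Suc n"] by (intro divide_nonneg_nonneg) auto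
    ultimately have "\<bar>1 - T n\<bar> \<le> b n" unfolding T(2)[of n] b_def[symmetric] by simp
    then show ?case using b(2)[of n] by simp
  next
    case (Suc N)
    define c where "c = cf_tail q (Suc n) N"
    define t where "t = T (Suc n)"
    have ct: "c \<ge> 1" "t \<ge> 1" using T(1) cf_tail_ge_1 q unfolding c_def t_def by auto
    then have "1 * 1 \<le> c * t" by (intro mult_mono) auto
    then have ct1: "1 \<le> c * t" by simp
    have "\<bar>cf_tail q n (Suc N) - T n\<bar> = \<bar>b n / c - b n / t\<bar>"
      unfolding T(2)[of n] by (simp add: b_def c_def t_def)
    also have "b n / c - b n / t = b n * (t - c) / (c * t)"
      using ct by (simp add: field_simps)
    also have "\<bar>b n * (t - c) / (c * t)\<bar> = b n * \<bar>c - t\<bar> / (c * t)"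
      using b[of n] ct ct1 by (simp add: abs_mult abs_minus_commute)
    also have "\<dots> \<le> b n * \<bar>c - t\<bar> / 1"
      using b[of n] ct1 by (intro divide_left_mono mult_nonneg_nonneg) auto
    also have "\<dots> \<le> b n * (2 * (\<Prod>i<N. b (Suc n + i)))"
      using Suc.IH[of "Suc n"] b[of n] by (simp add: c_def t_def)
    also have "\<dots> = 2 * (\<Prod>i<Suc N. b (n + i))"
      by (subst prod.lessThan_Suc_shift) simp
    finally show ?case .
  qed
  have "summable (\<lambda>N. \<Prod>i<N. b (n + i))"
  proof -
    have "(\<lambda>i. 2 * q ^ i) \<longlonglongrightarrow> 2 * 0"
      using q by (intro tendsto_mult tendsto_const LIMSEQ_power_zero) simp
    then have ev: "\<forall>\<^sub>F i in sequentially. 2 * q ^ i < 1 / 2" by (rule order_tendstoD) simp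
    have bb: "b i \<le> 2 * q ^ i" for i
      using power_decreasing[of i "2 * i" q] q by (simp add: b_def)
    have "\<forall>\<^sub>F i in sequentially. b i < 1 / 2"
      using ev
    proof eventually_elim
      case (elim i)
      then show ?case using bb[of i] by linarith
    qed
    then obtain M where M: "b i < 1 / 2" if "i \<ge> M" for i unfolding eventually_sequentially by blast
    show ?thesis
    proof (rule summable_ratio_test[of "1/2" M])
      fix k assume "k \<ge> M"
      then have "b (n + k) \<le> 1/2" using M[of "n + k"] by simp
      then have "b (n + k) * (\<Prod>i<k. b (n + i)) \<le> 1/2 * (\<Prod>i<k. b (n + i))"
        using b by (intro mult_right_mono prod_nonneg) (auto intro: less_imp_le)
      moreover have "(\<Prod>i<k. b (n + i)) \<ge> 0" using b by (intro prod_nonneg) (auto intro: less_imp_le)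
      ultimately show "norm (\<Prod>i<Suc k. b (n + i)) \<le> 1/2 * norm (\<Prod>i<k. b (n + i))"
        using b[of "n + k"] by (simp add: abs_mult mult.commute)
    qed simp
  qed
  then have "(\<lambda>N. 2 * (\<Prod>i<N. b (n + i))) \<longlonglongrightarrow> 2 * 0" by (intro tendsto_mult tendsto_const summable_LIMSEQ_zero)
  then have lim: "(\<lambda>N. 2 * (\<Prod>i<N. b (n + i))) \<longlonglongrightarrow> 0" by simp
  have "(\<lambda>N. cf_tail q n N - T n) \<longlonglongrightarrow> 0"
    by (rule Lim_null_comparison[OF _ lim]) (use err in simp)
  then show ?thesis by (simp add: LIM_zero_iff)
qed

text \<open>\<open>cf_series q x\<close> is the power series solution with value 1 at \<open>x = 0\<close> of the recurrence of the
  continued fraction, multiplied by the product of all \<open>1 - x q^k\<close>, \<open>k \<ge> 1\<close>. This form of it comes from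
  Bailey's lemma in base \<open>q^2\<close> with \<open>a = x^2\<close>. The denominator \<open>1 - x\<close> of that formula has been
  cancelled, so that \<open>x = 1\<close> is allowed; this is why the term of index 0 is separate.\<close>
definition cf_coeff :: "real \<Rightarrow> real \<Rightarrow> nat \<Rightarrow> real" where
  "cf_coeff q x n = (-1) ^ Suc n * x ^ (2 * n + 2) * q ^ (3 * (n + 1)\<^sup>2) *
     (\<Prod>j<n. 1 - x\<^sup>2 * q ^ (2 * j + 2)) / qfact (q\<^sup>2) (Suc n)"

definition cf_term :: "real \<Rightarrow> real \<Rightarrow> nat \<Rightarrow> real" where
  "cf_term q x n = (case n of 0 \<Rightarrow> 1 | Suc m \<Rightarrow> cf_coeff q x m * (1 + x) * (1 - x * q ^ (2 * m + 2)))"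

definition cf_series :: "real \<Rightarrow> real \<Rightarrow> real" where
  "cf_series q x = (\<Sum>n. cf_term q x n)"

lemma cf_term_simps [simp]:
  "cf_term q x 0 = 1" "cf_term q x (Suc m) = cf_coeff q x m * (1 + x) * (1 - x * q ^ (2 * m + 2))"
  by (simp_all add: cf_term_def)

section \<open>Bounds, recurrence and positivity of the q-series\<close>

context
  fixes q :: real
  assumes q: "0 < q" "q < 1"
begin

lemma qfact_q2_ge: "0 < euler_prod (q\<^sup>2)" "euler_prod (q\<^sup>2) \<le> qfact (q\<^sup>2) n"
proof -
  have n: "0 \<le> q\<^sup>2" "q\<^sup>2 < 1" using q norm_power_less_one[of q 2] by auto
  then show "0 < euler_prod (q\<^sup>2)" by (rule euler_prod_pos)
  have f: "0 \<le> 1 - (q\<^sup>2) ^ Suc k" "1 - (q\<^sup>2) ^ Suc k \<le> 1" for k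
    using n power_le_one[of "q\<^sup>2" "Suc k"] zero_le_power[of "q\<^sup>2" "Suc k"] by linarith+
  have pos: "0 \<le> qfact (q\<^sup>2) n" for n
    unfolding qfact_def by (intro prod_nonneg f)
  have "qfact (q\<^sup>2) (Suc n) \<le> qfact (q\<^sup>2) n" for n
    unfolding qfact_Suc by (rule mult_left_le[OF f(2) pos])
  then have "decseq (qfact (q\<^sup>2))" by (simp add: decseq_Suc_iff)
  then show "euler_prod (q\<^sup>2) \<le> qfact (q\<^sup>2) n"
    by (rule decseq_ge[OF _ qfact_tendsto]) (use n in simp)
qed

text \<open>The crude estimate of q^(3(n+1)^2) by q^n suffices. The factor x^2 is kept because it
  shows that the series tends to 1 as x tends to 0, the starting point of the positivity
  proof.\<close>

lemma cf_coeff_bound: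
  assumes x: "0 \<le> x" "x \<le> 1"
  shows "\<bar>cf_coeff q x n\<bar> \<le> x\<^sup>2 * (1 / euler_prod (q\<^sup>2)) * q ^ n"
proof -
  have f: "0 \<le> x\<^sup>2 * q ^ (2 * j + 2) \<and> x\<^sup>2 * q ^ (2 * j + 2) \<le> 1" for j
    using x q by (auto intro!: mult_le_one power_le_one)
  have P: "0 \<le> (\<Prod>j<n. 1 - x\<^sup>2 * q ^ (2 * j + 2))" "(\<Prod>j<n. 1 - x\<^sup>2 * q ^ (2 * j + 2)) \<le> 1"
    using f by (auto intro!: prod_nonneg prod_le_1)
  have "\<bar>cf_coeff q x n\<bar> = x\<^sup>2 * x ^ (2 * n) * q ^ (3 * (n + 1)\<^sup>2) * (\<Prod>j<n. 1 - x\<^sup>2 * q ^ (2 * j + 2)) * (1 / qfact (q\<^sup>2) (Suc n))"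
    using x q P qfact_q2_ge(1) qfact_q2_ge(2)[of "Suc n"] by (simp add: cf_coeff_def abs_mult power_add power2_eq_square mult_ac)
  also have "\<dots> \<le> x\<^sup>2 * 1 * q ^ n * 1 * (1 / euler_prod (q\<^sup>2))"
  proof (intro mult_mono)
    show "x ^ (2 * n) \<le> 1" using x by (simp add: power_le_one)
    have "n \<le> 3 * (n + 1)\<^sup>2" by (simp add: power2_eq_square)
    then show "q ^ (3 * (n + 1)\<^sup>2) \<le> q ^ n" using q by (intro power_decreasing) auto
    show "1 / qfact (q\<^sup>2) (Suc n) \<le> 1 / euler_prod (q\<^sup>2)"
      using qfact_q2_ge(1) qfact_q2_ge(2)[of "Suc n"] by (intro divide_left_mono mult_pos_pos) auto
  qed (use x q P qfact_q2_ge(1) qfact_q2_ge(2)[of "Suc n"] in auto)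
  finally show ?thesis by (simp add: mult_ac)
qed

lemma cf_term_bound:
  assumes x: "0 \<le> x" "x \<le> 1"
  shows "norm (cf_term q x (Suc n)) \<le> x\<^sup>2 * (2 / euler_prod (q\<^sup>2)) * q ^ n"
proof -
  have "0 \<le> x * q ^ (2 * n + 2)" "x * q ^ (2 * n + 2) \<le> 1"
    using x q by (auto intro!: mult_le_one power_le_one)
  then have "\<bar>(1 + x) * (1 - x * q ^ (2 * n + 2))\<bar> \<le> 2 * 1"
    unfolding abs_mult using x by (intro mult_mono) auto
  then have "norm (cf_term q x (Suc n)) \<le> \<bar>cf_coeff q x n\<bar> * 2"
    unfolding cf_term_simps real_norm_def mult.assoc abs_mult[of "cf_coeff q x n"] by (intro mult_left_mono) auto
  also have "\<dots> \<le> x\<^sup>2 * (1 / euler_prod (q\<^sup>2)) * q ^ n * 2"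
    using cf_coeff_bound[OF x, of n] by (intro mult_right_mono) auto
  finally show ?thesis by (simp add: mult_ac)
qed

lemma summable_cf_term:
  assumes "0 \<le> x" "x \<le> 1"
  shows "summable (cf_term q x)"
proof -
  have "summable (\<lambda>n. x\<^sup>2 * (2 / euler_prod (q\<^sup>2)) * q ^ n)"
    using q by (intro summable_mult summable_geometric) auto
  then have "summable (\<lambda>n. cf_term q x (Suc n))"
    by (rule summable_comparison_test'[of _ 0]) (use cf_term_bound[OF assms] in auto)
  then show ?thesis by (simp only: summable_Suc_iff)
qed

lemma cf_series_near_1:
  obtains M where "M > 0" "\<And>x. 0 \<le> x \<Longrightarrow> x \<le> 1 \<Longrightarrow> \<bar>cf_series q x - 1\<bar> \<le> x\<^sup>2 * M"
proof -
  define M where "M = 2 / euler_prod (q\<^sup>2) * (1 / (1 - q))"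
  have "M > 0" using qfact_q2_ge(1) q by (simp add: M_def)
  moreover have "\<bar>cf_series q x - 1\<bar> \<le> x\<^sup>2 * M" if x: "0 \<le> x" "x \<le> 1" for x
  proof -
    have "cf_series q x - 1 = (\<Sum>n. cf_term q x (Suc n))"
      unfolding cf_series_def using suminf_split_head[OF summable_cf_term[OF x]] by simp
    also have "norm \<dots> \<le> (\<Sum>n. x\<^sup>2 * (2 / euler_prod (q\<^sup>2)) * q ^ n)"
      using q by (intro norm_suminf_le cf_term_bound[OF x] summable_mult summable_geometric) auto
    also have "\<dots> = x\<^sup>2 * (2 / euler_prod (q\<^sup>2)) * (1 / (1 - q))"
      using q by (subst suminf_mult) (auto simp: suminf_geometric intro!: summable_geometric)
    finally show ?thesis by (simp add: M_def mult_ac)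
  qed
  ultimately show ?thesis using that by blast
qed

text \<open>The certificate on the right was found by comparing coefficients in \<open>X = q^(2m+2)\<close>.\<close>
lemma cf_term_telescope:
  "(\<Sum>n<Suc m. cf_term q x n - (1 - x * q) * cf_term q (x * q) n
       - x * q * (1 + x * q) * (1 - x * q) * (1 - x * q\<^sup>2) * cf_term q (x * q\<^sup>2) n)
   = cf_coeff q x m * (1 - q ^ (2 * m + 2)) * (x\<^sup>2 * q ^ (2 * m + 2) - (1 + x))"
proof (induction m)
  case 0
  have Q: "qfact (q\<^sup>2) (Suc 0) = 1 - q\<^sup>2" by (simp add: qfact_def)
  have "1 - q\<^sup>2 \<noteq> 0" using qfact_q2_ge(1) qfact_q2_ge(2)[of "Suc 0"] unfolding Q by auto
  then have c: "cf_coeff q x 0 * (1 - q ^ (2 * 0 + 2)) = - (x\<^sup>2 * q ^ 3)"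
    unfolding cf_coeff_def Q by (simp add: power2_eq_square)
  have "1 - (1 - x * q) - x * q * (1 + x * q) * (1 - x * q) * (1 - x * q\<^sup>2) = - (x\<^sup>2 * q ^ 3) * (x\<^sup>2 * q\<^sup>2 - (1 + x))"
    by (simp add: algebra_simps eval_nat_numeral)
  then show ?case unfolding c by (simp add: power2_eq_square)
next
  case (Suc m)
  define X where "X = q ^ (2 * m + 2)"
  define P where "P y = (\<Prod>j<m. 1 - y\<^sup>2 * q ^ (2 * j + 2))" for y
  define Q where "Q = qfact (q\<^sup>2) (Suc m)"
  define c where "c = cf_coeff q x m"
  have X1: "1 - q\<^sup>2 * X \<noteq> 0" and QS: "qfact (q\<^sup>2) (Suc (Suc m)) = Q * (1 - q\<^sup>2 * X)"
  proof -
    have "(q\<^sup>2) ^ Suc (Suc m) = q\<^sup>2 * X" by (simp only: X_def power_even_Suc power_Suc)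
    then show "qfact (q\<^sup>2) (Suc (Suc m)) = Q * (1 - q\<^sup>2 * X)" unfolding Q_def qfact_Suc[of _ "Suc m"] by simp
    then show "1 - q\<^sup>2 * X \<noteq> 0" using qfact_q2_ge(1) qfact_q2_ge(2)[of "Suc (Suc m)"] by auto
  qed
  have PS: "(\<Prod>j<Suc m. 1 - y\<^sup>2 * q ^ (2 * j + 2)) = P y * (1 - y\<^sup>2 * X)" for y by (simp add: P_def X_def)
  \<comment> \<open>The substitution y -> y q shifts the product by one factor. No division takes
    place, as x is arbitrary here and 1 - x^2 q^2 may vanish.\<close>
  have Pq: "(1 - y\<^sup>2 * q\<^sup>2) * P (y * q) = P y * (1 - y\<^sup>2 * X)" for y
  proof -
    have "(1 - y\<^sup>2 * q\<^sup>2) * P (y * q) = (\<Prod>j<Suc m. 1 - y\<^sup>2 * q ^ (2 * j + 2))"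
    proof -
      have "(y * q)\<^sup>2 * q ^ (2 * j + 2) = y\<^sup>2 * q ^ (2 * Suc j + 2)" for j
        by (simp add: power_mult_distrib power_add power2_eq_square)
      then show ?thesis unfolding P_def by (subst prod.lessThan_Suc_shift) (simp only: mult_0_right add_0_left)
    qed
    then show ?thesis unfolding PS .
  qed
  have Pq2: "(1 - x\<^sup>2 * q\<^sup>2) * (1 - x\<^sup>2 * q ^ 4) * P (x * q\<^sup>2) = P x * (1 - x\<^sup>2 * X) * (1 - x\<^sup>2 * q\<^sup>2 * X)"
  proof -
    have e: "x * q * q = x * q\<^sup>2" "(x * q)\<^sup>2 * q\<^sup>2 = x\<^sup>2 * q ^ 4" "(x * q)\<^sup>2 * X = x\<^sup>2 * q\<^sup>2 * X"
      by (simp_all add: power_mult_distrib eval_nat_numeral)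
    have "(1 - x\<^sup>2 * q\<^sup>2) * (1 - x\<^sup>2 * q ^ 4) * P (x * q\<^sup>2) = (1 - x\<^sup>2 * q\<^sup>2) * (P (x * q) * (1 - x\<^sup>2 * q\<^sup>2 * X))"
      using Pq[of "x * q"] unfolding e by (simp only: mult.assoc)
    also have "\<dots> = ((1 - x\<^sup>2 * q\<^sup>2) * P (x * q)) * (1 - x\<^sup>2 * q\<^sup>2 * X)" by (simp only: mult.assoc)
    finally show ?thesis unfolding Pq .
  qed
  define k where "k = (-1) ^ Suc m * x ^ (2 * m + 2) * q ^ (3 * (m + 1)\<^sup>2) / Q"
  have cc: "cf_coeff q y m = (-1) ^ Suc m * y ^ (2 * m + 2) * q ^ (3 * (m + 1)\<^sup>2) * P y / Q" for y
    by (simp only: cf_coeff_def P_def Q_def)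
  have cx: "c = k * P x" unfolding c_def cc k_def by (simp only: times_divide_eq_left)
  have "(y * q ^ i) ^ (2 * m + 2) = y ^ (2 * m + 2) * X ^ i" for y i
    by (simp only: X_def power_mult_distrib power_mult[symmetric] mult.commute[of i])
  from this[of x 1] this[of x 2]
  have qp: "(x * q) ^ (2 * m + 2) = x ^ (2 * m + 2) * X" "(x * q\<^sup>2) ^ (2 * m + 2) = x ^ (2 * m + 2) * X\<^sup>2"
    by (simp_all only: power_one_right)
  have cq: "cf_coeff q (x * q) m = k * X * P (x * q)" "cf_coeff q (x * q\<^sup>2) m = k * X\<^sup>2 * P (x * q\<^sup>2)"
    unfolding cc qp k_def by (simp_all only: times_divide_eq_left times_divide_eq_right mult_ac)
  have cS: "cf_coeff q x (Suc m) * (1 - q\<^sup>2 * X) = - c * x\<^sup>2 * q ^ 3 * X ^ 3 * (1 - x\<^sup>2 * X)"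
  proof -
    have e: "q ^ (3 * (Suc m + 1)\<^sup>2) = q ^ (3 * (m + 1)\<^sup>2) * (q ^ 3 * X ^ 3)"
      unfolding X_def power_mult[symmetric] power_add[symmetric] by (rule arg_cong[where f = "\<lambda>n. q ^ n"]) (simp add: power2_eq_square)
    have e2: "x ^ (2 * Suc m + 2) = x ^ (2 * m + 2) * x\<^sup>2" by (simp add: power_add power2_eq_square)
    have e3: "(-1) ^ Suc (Suc m) = - ((-1) ^ Suc m :: real)" by simp
    have key: "- s * (a * x2) * (b * (e1 * e2)) * (p * f) / (Q * t) * t = - (s * a * b / Q * p) * x2 * e1 * e2 * f" if "t \<noteq> 0" for s a x2 b e1 e2 p f t :: real
      using that by simp
    show ?thesis
      unfolding cx k_def unfolding cf_coeff_def QS PS e e2 e3 by (rule key[OF X1])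
  qed
  have t1: "cf_term q x (Suc m) = c * ((1 + x) * (1 - x * X))" by (simp add: c_def X_def)
  have t2: "(1 - x * q) * cf_term q (x * q) (Suc m) = c * (X * (1 - x\<^sup>2 * X) * (1 - x * q * X))"
  proof -
    have "(1 - x * q) * cf_term q (x * q) (Suc m) = k * X * ((1 - x\<^sup>2 * q\<^sup>2) * P (x * q)) * (1 - x * q * X)"
      unfolding cf_term_simps cq X_def[symmetric] by (simp add: algebra_simps power2_eq_square)
    then show ?thesis unfolding Pq cx by (simp add: mult_ac)
  qed
  have t3: "x * q * (1 + x * q) * (1 - x * q) * (1 - x * q\<^sup>2) * cf_term q (x * q\<^sup>2) (Suc m)
      = c * (x * q * X\<^sup>2 * (1 - x\<^sup>2 * X) * (1 - x\<^sup>2 * q\<^sup>2 * X) * (1 - x * q\<^sup>2 * X))"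
  proof -
    have a: "(1 + x * q) * (1 - x * q) = 1 - x\<^sup>2 * q\<^sup>2" "(1 - x * q\<^sup>2) * (1 + x * q\<^sup>2) = 1 - x\<^sup>2 * q ^ 4"
      by (simp_all add: algebra_simps eval_nat_numeral)
    have "x * q * (1 + x * q) * (1 - x * q) * (1 - x * q\<^sup>2) * cf_term q (x * q\<^sup>2) (Suc m)
       = x * q * k * X\<^sup>2 * (((1 + x * q) * (1 - x * q)) * ((1 - x * q\<^sup>2) * (1 + x * q\<^sup>2)) * P (x * q\<^sup>2)) * (1 - x * q\<^sup>2 * X)"
      unfolding cf_term_simps cq X_def[symmetric] by (simp only: mult_ac)
    then show ?thesis unfolding a Pq2 cx by (simp only: mult_ac)
  qed
  \<comment> \<open>With all products expressed through P x, the induction step is c times this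
    polynomial identity in x, q and X.\<close>
  have poly: "(1 + x) * (1 - x * X) - X * (1 - x\<^sup>2 * X) * (1 - x * q * X)
      - x * q * X\<^sup>2 * (1 - x\<^sup>2 * X) * (1 - x\<^sup>2 * q\<^sup>2 * X) * (1 - x * q\<^sup>2 * X) + (1 - X) * (x\<^sup>2 * X - (1 + x))
      = - (x\<^sup>2 * q ^ 3 * X ^ 3 * (1 - x\<^sup>2 * X)) * (x\<^sup>2 * (q\<^sup>2 * X) - (1 + x))"
    by (simp add: algebra_simps eval_nat_numeral)
  have XS: "q ^ (2 * Suc m + 2) = q\<^sup>2 * X" by (simp add: X_def power_add eval_nat_numeral)
  have "c * ((1 + x) * (1 - x * X)) - c * (X * (1 - x\<^sup>2 * X) * (1 - x * q * X))
      - c * (x * q * X\<^sup>2 * (1 - x\<^sup>2 * X) * (1 - x\<^sup>2 * q\<^sup>2 * X) * (1 - x * q\<^sup>2 * X)) + c * (1 - X) * (x\<^sup>2 * X - (1 + x))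
      = c * ((1 + x) * (1 - x * X) - X * (1 - x\<^sup>2 * X) * (1 - x * q * X)
      - x * q * X\<^sup>2 * (1 - x\<^sup>2 * X) * (1 - x\<^sup>2 * q\<^sup>2 * X) * (1 - x * q\<^sup>2 * X) + (1 - X) * (x\<^sup>2 * X - (1 + x)))"
  proof -
    have "c * a - c * b - c * d + c * u * v = c * (a - b - d + u * v)" for a b d u v
      by (simp add: algebra_simps)
    then show ?thesis .
  qed
  also have "\<dots> = - c * x\<^sup>2 * q ^ 3 * X ^ 3 * (1 - x\<^sup>2 * X) * (x\<^sup>2 * (q\<^sup>2 * X) - (1 + x))"
    unfolding poly by (simp only: mult_minus_left mult_minus_right mult.assoc)
  finally show ?case
    unfolding sum.lessThan_Suc[of _ "Suc m"] Suc.IH XS c_def[symmetric] X_def[symmetric] t1 t2 t3 cS by simp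
qed

text \<open>The telescoped remainder tends to 0 with the coefficients. At x = q^m, division by (1 -
  q^(m+1)) times the series at q^(m+1) turns the relation into the recurrence of the tails.\<close>

lemma cf_series_recurrence:
  assumes x: "0 \<le> x" "x \<le> 1"
  shows "cf_series q x = (1 - x * q) * cf_series q (x * q)
    + x * q * (1 + x * q) * (1 - x * q) * (1 - x * q\<^sup>2) * cf_series q (x * q\<^sup>2)"
proof -
  have xq: "0 \<le> x * q" "x * q \<le> 1" "0 \<le> x * q\<^sup>2" "x * q\<^sup>2 \<le> 1"
    using x q by (auto intro!: mult_le_one simp: power_le_one)
  let ?d = "\<lambda>n. cf_term q x n - (1 - x * q) * cf_term q (x * q) n
       - x * q * (1 + x * q) * (1 - x * q) * (1 - x * q\<^sup>2) * cf_term q (x * q\<^sup>2) n"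
  have "?d sums (cf_series q x - (1 - x * q) * cf_series q (x * q)
       - x * q * (1 + x * q) * (1 - x * q) * (1 - x * q\<^sup>2) * cf_series q (x * q\<^sup>2))"
    unfolding cf_series_def
    by (intro sums_diff sums_mult summable_sums summable_cf_term x xq)
  then have "(\<lambda>m. \<Sum>n<Suc m. ?d n) \<longlonglongrightarrow> cf_series q x - (1 - x * q) * cf_series q (x * q)
       - x * q * (1 + x * q) * (1 - x * q) * (1 - x * q\<^sup>2) * cf_series q (x * q\<^sup>2)"
    unfolding sums_def by (rule LIMSEQ_Suc)
  moreover have "(\<lambda>m. cf_coeff q x m * (1 - q ^ (2 * m + 2)) * (x\<^sup>2 * q ^ (2 * m + 2) - (1 + x))) \<longlonglongrightarrow> 0 * (1 - 0) * (x\<^sup>2 * 0 - (1 + x))"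
  proof (intro tendsto_mult tendsto_diff tendsto_const)
    have "(\<lambda>m. x\<^sup>2 * (1 / euler_prod (q\<^sup>2)) * q ^ m) \<longlonglongrightarrow> x\<^sup>2 * (1 / euler_prod (q\<^sup>2)) * 0"
      using q by (intro tendsto_mult tendsto_const LIMSEQ_power_zero) auto
    then have lim: "(\<lambda>m. x\<^sup>2 * (1 / euler_prod (q\<^sup>2)) * q ^ m) \<longlonglongrightarrow> 0" by simp
    show "cf_coeff q x \<longlonglongrightarrow> 0"
      by (rule Lim_null_comparison[OF _ lim]) (use cf_coeff_bound[OF x] in simp)
    have "(\<lambda>m. (q\<^sup>2) ^ Suc m) \<longlonglongrightarrow> 0"
      by (intro LIMSEQ_Suc LIMSEQ_power_zero) (use q norm_power_less_one[of q 2] in auto)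
    moreover have "q ^ (2 * m + 2) = (q\<^sup>2) ^ Suc m" for m by (simp add: power_mult power_add power2_eq_square)
    ultimately show "(\<lambda>m. q ^ (2 * m + 2)) \<longlonglongrightarrow> 0" "(\<lambda>m. q ^ (2 * m + 2)) \<longlonglongrightarrow> 0"
      by simp_all
  qed
  ultimately show ?thesis
    unfolding cf_term_telescope using LIMSEQ_unique by fastforce
qed

text \<open>For large m the series is close to 1. The recurrence has positive coefficients at powers
  of q and carries positivity down to m = 0; as it has three terms, two consecutive values are
  carried along.\<close>

lemma cf_series_pos: "cf_series q (q ^ m) > 0"
proof -
  obtain M where M: "M > 0" "\<And>x. 0 \<le> x \<Longrightarrow> x \<le> 1 \<Longrightarrow> \<bar>cf_series q x - 1\<bar> \<le> x\<^sup>2 * M"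
    using cf_series_near_1 by blast
  have qm: "0 \<le> q ^ m" "q ^ m \<le> 1" for m using q by (auto simp: power_le_one)
  have "(\<lambda>m. q ^ m * M) \<longlonglongrightarrow> 0 * M" using q by (intro tendsto_mult tendsto_const LIMSEQ_power_zero) auto
  then have "\<forall>\<^sub>F m in sequentially. q ^ m * M < 1" by (intro order_tendstoD) auto
  then obtain K where K: "q ^ m * M < 1" if "m \<ge> K" for m unfolding eventually_sequentially by blast
  have large: "cf_series q (q ^ m) > 0" if "m \<ge> K" for m
  proof -
    have "(q ^ m)\<^sup>2 * M \<le> q ^ m * M"
      using qm[of m] M(1) by (intro mult_right_mono) (auto simp: power2_eq_square mult_left_le)
    then show ?thesis using K[OF that] M(2)[OF qm[of m]] by linarith
  qed
  have "cf_series q (q ^ m) > 0 \<and> cf_series q (q ^ Suc m) > 0" if "m \<le> K" for m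
    using that
  proof (induction rule: inc_induct)
    case base
    then show ?case using large[of K] large[of "Suc K"] by simp
  next
    case (step m)
    have e: "q ^ m * q = q ^ Suc m" "q ^ m * q\<^sup>2 = q ^ Suc (Suc m)" by (simp_all add: power2_eq_square)
    have l: "q ^ Suc m < 1" "q ^ Suc (Suc m) < 1" "q ^ Suc m > 0" using q by (auto intro: power_Suc_less_one simp del: power_Suc)
    have "cf_series q (q ^ m) = (1 - q ^ Suc m) * cf_series q (q ^ Suc m) + q ^ Suc m * (1 + q ^ Suc m) * (1 - q ^ Suc m) * (1 - q ^ Suc (Suc m)) * cf_series q (q ^ Suc (Suc m))"
      using cf_series_recurrence[OF qm[of m]] unfolding e by simp
    also have "\<dots> > 0"
      using step.IH l by (intro add_pos_pos mult_pos_pos) (auto simp del: power_Suc)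
    finally show ?case using step.IH by simp
  qed
  then show ?thesis using large[of m] by (cases "m \<le> K") auto
qed

end

section \<open>Values of the q-series at x = 1 and x = q\<close>

lemma has_sum_int_nat_conv:
  fixes f :: "int \<Rightarrow> real"
  assumes "(f has_sum S) UNIV"
  shows "summable (\<lambda>k. f (int k))" "summable (\<lambda>k. f (- int (Suc k)))"
    "S = (\<Sum>k. f (int k)) + (\<Sum>k. f (- int (Suc k)))"
proof -
  have fs: "f summable_on A" for A
    using summable_on_subset_banach[OF has_sum_imp_summable[OF assms]] by simp
  have b1: "bij_betw int UNIV {0..}"
    by (rule bij_betwI[of _ _ _ nat]) auto
  have b2: "bij_betw (\<lambda>k. - int (Suc k)) UNIV {..<0}"
    by (rule bij_betwI[of _ _ _ "\<lambda>n. nat (- n - 1)"]) auto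
  have s: "(\<lambda>k. f (int k)) summable_on UNIV" "(\<lambda>k. f (- int (Suc k))) summable_on UNIV"
    unfolding summable_on_reindex_bij_betw[OF b1] summable_on_reindex_bij_betw[OF b2] by (rule fs)+
  then have n: "(\<lambda>k. norm (f (int k))) summable_on UNIV" "(\<lambda>k. norm (f (- int (Suc k)))) summable_on UNIV"
    by (simp_all only: summable_on_iff_abs_summable_on_real[symmetric])
  show "summable (\<lambda>k. f (int k))" "summable (\<lambda>k. f (- int (Suc k)))"
    by (rule summable_on_imp_summable[OF s(1)], rule summable_on_imp_summable[OF s(2)])
  have "(f has_sum ((\<Sum>k. f (int k)) + (\<Sum>k. f (- int (Suc k))))) UNIV"
    by (rule has_sum_int_nat) (rule summable_on_imp_summable[OF n(1)], rule summable_on_imp_summable[OF n(2)])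
  then show "S = (\<Sum>k. f (int k)) + (\<Sum>k. f (- int (Suc k)))"
    by (rule has_sum_unique[OF assms])
qed

text \<open>At x = 1 the product cancels against the denominator up to 1 - q^(2n+2), which the last
  factor of the term removes. The factor 1 + x = 2 accounts for the indices n + 1 and -(n +
  1).\<close>

lemma cf_series_at_1:
  assumes q: "0 < q" "q < 1"
  shows "cf_series q 1 = ftheta (- (q ^ 3)) (- (q ^ 3))"
proof -
  define f where "f n = int_sign n * q ^ nat (3 * n\<^sup>2)" for n
  have "\<bar>q\<bar> < 1" using q by simp
  note hs = has_sum_int_nat_conv[OF phi_cube_has_sum[OF this, folded f_def]]
  have "cf_coeff q 1 n * (1 - 1 * q ^ (2 * n + 2)) = (-1) ^ Suc n * q ^ (3 * (n + 1)\<^sup>2)" for n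
  proof -
    have P: "(\<Prod>j<n. 1 - 1\<^sup>2 * q ^ (2 * j + 2)) = qfact (q\<^sup>2) n"
      by (simp only: qfact_def power_even_Suc power_one mult_1_left)
    have "qfact (q\<^sup>2) (Suc n) \<noteq> 0" using qfact_q2_ge(1)[OF q] qfact_q2_ge(2)[OF q, of "Suc n"] by auto
    then have nz: "qfact (q\<^sup>2) n \<noteq> 0" "1 - (q\<^sup>2) ^ Suc n \<noteq> 0" unfolding qfact_Suc by auto
    have "b * 1 * z * Q / (Q * t) * t = b * z" if "Q \<noteq> 0" "t \<noteq> 0" for b z Q t :: real
      using that by simp
    from this[OF nz] show ?thesis
      unfolding cf_coeff_def P unfolding qfact_Suc power_even_Suc power_one mult_1_left .
  qed
  moreover have fn: "f (- int (Suc n)) = (-1) ^ Suc n * q ^ (3 * (n + 1)\<^sup>2)" "f (int (Suc n)) = (-1) ^ Suc n * q ^ (3 * (n + 1)\<^sup>2)" for n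
  proof -
    have "3 * (int (Suc n))\<^sup>2 = int (3 * (n + 1)\<^sup>2)" by (simp add: add.commute)
    then have "nat (3 * (int (Suc n))\<^sup>2) = 3 * (n + 1)\<^sup>2" by (simp only: nat_int)
    then show "f (int (Suc n)) = (-1) ^ Suc n * q ^ (3 * (n + 1)\<^sup>2)" unfolding f_def int_sign_power by simp
    moreover have "f (- int (Suc n)) = f (int (Suc n))" unfolding f_def power2_minus by (simp add: int_sign_def)
    ultimately show "f (- int (Suc n)) = (-1) ^ Suc n * q ^ (3 * (n + 1)\<^sup>2)" by simp
  qed
  ultimately have t: "cf_term q 1 (Suc n) = f (- int (Suc n)) + f (int (Suc n))" for n
    unfolding cf_term_simps by (simp add: mult_ac)
  have s: "summable (\<lambda>n. f (int (Suc n)))" using hs(1) summable_Suc_iff[of "\<lambda>k. f (int k)"] by simp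
  have "cf_series q 1 = 1 + (\<Sum>n. cf_term q 1 (Suc n))"
    unfolding cf_series_def using suminf_split_head[OF summable_cf_term[OF q, of 1]] cf_term_simps(1) by simp
  also have "(\<Sum>n. cf_term q 1 (Suc n)) = (\<Sum>n. f (- int (Suc n))) + (\<Sum>n. f (int (Suc n)))"
    unfolding t by (rule suminf_add[OF hs(2) s, symmetric])
  also have "(\<Sum>n. f (int (Suc n))) = (\<Sum>n. f (int n)) - 1"
    using suminf_split_head[OF hs(1)] by (simp add: f_def int_sign_def)
  finally show ?thesis using hs(3) by simp
qed

text \<open>At x = q the factors 1 - q and 1 + q join to 1 - q^2, which completes the product to the
  denominator. What remains, 1 - q^(2n+1), pairs the indices n and -1 - n.\<close>

lemma cf_series_at_q:
  assumes q: "0 < q" "q < 1"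
  shows "(1 - q) * cf_series q q = ftheta (- (q ^ 5)) (- q)"
proof -
  define f where "f n = int_sign n * q ^ nat (3 * n\<^sup>2 + 2 * n)" for n
  have "norm q < 1" using q by simp
  note hs = has_sum_int_nat_conv[OF ftheta_5_1_has_sum[OF this, folded f_def]]
  have fp: "f (int n) = (-1) ^ n * q ^ (3 * n\<^sup>2 + 2 * n)" for n
  proof -
    have "nat (3 * (int n)\<^sup>2 + 2 * int n) = 3 * n\<^sup>2 + 2 * n"
    proof -
      have "3 * (int n)\<^sup>2 + 2 * int n = int (3 * n\<^sup>2 + 2 * n)" by simp
      then show ?thesis by (simp only: nat_int)
    qed
    then show ?thesis unfolding f_def int_sign_power by simp
  qed
  have fm: "f (- int (Suc n)) = - ((-1) ^ n * q ^ (3 * n\<^sup>2 + 2 * n) * q ^ (2 * n + 1))" for n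
  proof -
    have "3 * (- int (Suc n))\<^sup>2 + 2 * (- int (Suc n)) = int (3 * n\<^sup>2 + 2 * n + (2 * n + 1))"
      by (simp add: power2_eq_square algebra_simps)
    then have "nat (3 * (- int (Suc n))\<^sup>2 + 2 * (- int (Suc n))) = 3 * n\<^sup>2 + 2 * n + (2 * n + 1)" by (simp only: nat_int)
    moreover have "int_sign (- int (Suc n)) = (- ((-1) ^ n) :: real)" unfolding int_sign_power by (simp add: int_sign_def)
    ultimately show ?thesis unfolding f_def by (simp only: power_add mult_minus_left mult.assoc)
  qed
  have t: "(1 - q) * cf_term q q n = f (int n) + f (- int (Suc n))" for n
  proof (cases n)
    case 0
    then show ?thesis using cf_term_simps(1) by (simp add: f_def int_sign_def)
  next
    case (Suc m)
    define Q where "Q = qfact (q\<^sup>2) (Suc m)"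
    have Q: "Q \<noteq> 0" using qfact_q2_ge(1)[OF q] qfact_q2_ge(2)[OF q, of "Suc m"] by (auto simp: Q_def)
    have "(1 - q\<^sup>2) * (\<Prod>j<m. 1 - q\<^sup>2 * q ^ (2 * j + 2)) = Q"
      unfolding Q_def qfact_def power_even_Suc by (subst prod.lessThan_Suc_shift) simp
    then have P: "(1 - q) * ((1 + q) * (\<Prod>j<m. 1 - q\<^sup>2 * q ^ (2 * j + 2))) = Q"
      by (simp add: algebra_simps power2_eq_square)
    have "(1 - q) * cf_term q q n = (-1) ^ Suc m * (q ^ (2 * m + 2) * q ^ (3 * (m + 1)\<^sup>2)) * ((1 - q) * ((1 + q) * (\<Prod>j<m. 1 - q\<^sup>2 * q ^ (2 * j + 2)))) / Q * (1 - q * q ^ (2 * m + 2))"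
      unfolding Suc cf_term_simps cf_coeff_def Q_def by (simp add: mult_ac)
    also have "\<dots> = (-1) ^ Suc m * q ^ (3 * (m + 1)\<^sup>2 + 2 * (m + 1)) * (1 - q ^ (2 * (m + 1) + 1))"
      unfolding P using Q by (simp add: power_add[symmetric] add_ac)
    also have "\<dots> = f (int n) + f (- int (Suc n))"
      unfolding fp fm Suc by (simp add: algebra_simps)
    finally show ?thesis .
  qed
  have "(1 - q) * cf_series q q = (\<Sum>n. f (int n) + f (- int (Suc n)))"
    unfolding t[symmetric] cf_series_def using q by (intro suminf_mult[symmetric] summable_cf_term[OF q]) auto
  also have "\<dots> = ftheta (- (q ^ 5)) (- q)" unfolding hs(3) by (rule suminf_add[OF hs(1,2), symmetric])
  finally show ?thesis .
qed

text \<open>Positivity of the series makes the quotients T n well defined and positive; their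
  recurrence then makes them at least 1, as \<open>cf_tail_tendsto\<close> demands.\<close>

theorem cubic_cf_approx_tendsto:
  assumes q: "0 < q" "q < 1"
  shows "cubic_cf_approx q \<longlonglongrightarrow> root 3 q * (ftheta (- (q ^ 5)) (- q) / ftheta (- (q ^ 3)) (- (q ^ 3)))"
proof -
  define A where "A m = cf_series q (q ^ m)" for m
  have A: "A m > 0" for m unfolding A_def by (rule cf_series_pos[OF q])
  have qm: "0 < q ^ m" "q ^ m \<le> 1" "q ^ Suc m < 1" for m
    using q by (auto simp: power_le_one intro: power_Suc_less_one simp del: power_Suc)
  \<comment> \<open>Only \<open>T n\<close> with \<open>n \<ge> 1\<close> matters; the value at 0 merely extends the recurrence.\<close>
  define T where "T n = (case n of 0 \<Rightarrow> 1 + 2 * ((1 - q) * A 1 / A 0) | Suc m \<Rightarrow> A m / ((1 - q ^ Suc m) * A (Suc m)))" for n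
  have Tpos: "T n > 0" for n
    using A qm q by (cases n) (auto simp: T_def intro!: add_pos_pos mult_pos_pos divide_pos_pos simp del: power_Suc)
  have rec: "T n = 1 + (q ^ n + q ^ (2 * n)) / T (Suc n)" for n
  proof (cases n)
    case 0
    then show ?thesis by (simp add: T_def)
  next
    case (Suc m)
    define y where "y = q ^ Suc m"
    have "q ^ (2 * n) = y\<^sup>2" unfolding y_def Suc power_mult[symmetric] by (simp only: mult.commute)
    then have e: "q ^ m * q = y" "q ^ m * q\<^sup>2 = q ^ Suc (Suc m)" "q ^ (2 * n) = y\<^sup>2" "q ^ n = y"
      by (simp_all add: y_def Suc power2_eq_square)
    have Am: "A m = (1 - y) * A (Suc m) + y * (1 + y) * (1 - y) * (1 - q ^ Suc (Suc m)) * A (Suc (Suc m))"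
      unfolding A_def using cf_series_recurrence[OF q, of "q ^ m"] qm[of m] unfolding e y_def[symmetric] by simp
    have key: "(a1 * b1 + y * (1 + y) * a1 * a2 * b2) / (a1 * b1) = 1 + (y + y\<^sup>2) / (b1 / (a2 * b2))"
      if "a1 > 0" "a2 > 0" "b1 > 0" "b2 > 0" for a1 a2 b1 b2 :: real
      using that by (simp add: field_simps power2_eq_square)
    have Tn: "T n = A m / ((1 - y) * A (Suc m))" "T (Suc n) = A (Suc m) / ((1 - q ^ Suc (Suc m)) * A (Suc (Suc m)))"
      by (simp_all add: T_def Suc y_def)
    show ?thesis unfolding e Tn Am
      by (rule key) (use A qm(3)[of m] qm(3)[of "Suc m"] in \<open>simp_all add: y_def\<close>)
  qed
  have T1: "T n \<ge> 1" for n
  proof -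
    have "(q ^ n + q ^ (2 * n)) / T (Suc n) \<ge> 0" using Tpos[of "Suc n"] q by (intro divide_nonneg_nonneg) auto
    then show ?thesis using rec[of n] by simp
  qed
  have lim: "cf_tail q 1 \<longlonglongrightarrow> T 1" by (rule cf_tail_tendsto[OF q T1 rec])
  have "T 1 = ftheta (- (q ^ 3)) (- (q ^ 3)) / ftheta (- (q ^ 5)) (- q)"
    using cf_series_at_1[OF q] cf_series_at_q[OF q] by (simp add: T_def A_def)
  moreover have "(\<lambda>N. root 3 q / cf_tail q 1 N) \<longlonglongrightarrow> root 3 q / T 1"
    using Tpos[of 1] by (intro tendsto_divide tendsto_const lim) auto
  ultimately show ?thesis unfolding cubic_cf_approx_def[abs_def] by (simp add: mult.commute)
qed

section \<open>The integral representations\<close>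

lemma root_cubic_modulus:
  "root 3 (cubic_modulus q) = root 3 q * (ftheta (- (q ^ 5)) (- q) / ftheta (- (q ^ 3)) (- (q ^ 3)))"
  unfolding cubic_modulus_def real_root_mult by (simp add: odd_real_root_power_cancel)

text \<open>The derivative of -ln(1 + 1/u) is u'/(u (1 + u)). Dividing by 9 inside the logarithm
  makes the antiderivative tend to 0 at the upper limit, where u tends to 1/8.\<close>

lemma exp_integral_phi:
  assumes q: "0 < q" "q < 1"
  shows "9 * exp (integral {q..1} (\<lambda>t. (rphi (-t))\<^sup>2 * (rphi (-(t^3)))\<^sup>2 / t)) = 1 + 1 / cubic_modulus q"
proof -
  \<comment> \<open>The derivative is available for t < 1 only. At 1 the function F is set to its
    limit, since the fundamental theorem for the interior asks just for continuity there.\<close>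
  define F where "F t = (if t < 1 then - ln ((1 + 1 / cubic_modulus t) / 9) else 0)" for t
  have der: "(F has_real_derivative (rphi (-t))\<^sup>2 * (rphi (-(t^3)))\<^sup>2 / t) (at t)" if t: "0 < t" "t < 1" for t
  proof -
    have "0 \<le> t" using t by simp
    then obtain d where d: "(cubic_modulus has_real_derivative d) (at t)"
      "t * d = cubic_modulus t * (1 + cubic_modulus t) * ((rphi (- t))\<^sup>2 * (rphi (- (t ^ 3)))\<^sup>2)"
      using cubic_modulus_derivative[of t] t(2) by metis
    define u where "u = cubic_modulus t"
    have u: "u > 0" using cubic_modulus_bounds(1)[OF t] by (simp add: u_def)
    have pos: "(1 + 1 / u) / 9 > 0" using u by (simp add: add_pos_pos)
    have "((\<lambda>t. - ln ((1 + 1 / cubic_modulus t) / 9)) has_real_derivative d / (u * (1 + u))) (at t)"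
    proof -
      have h: "((\<lambda>t. (1 + 1 / cubic_modulus t) / 9) has_real_derivative (0 + (0 * u - 1 * d) / (u * u)) / 9) (at t)"
        unfolding u_def using u
        by (intro DERIV_cdivide DERIV_add DERIV_const DERIV_divide d(1)) (simp add: u_def)
      have eq: "- (inverse ((1 + 1 / u) / 9) * ((0 + (0 * u - 1 * d) / (u * u)) / 9)) = d / (u * (1 + u))"
        using u by (simp add: divide_simps)
      show ?thesis
        unfolding u_def
        by (rule DERIV_cong[OF DERIV_minus[OF DERIV_chain2[OF DERIV_ln[OF pos[unfolded u_def]] h[unfolded u_def]]] eq[unfolded u_def]])
    qed
    moreover have "d / (u * (1 + u)) = (rphi (-t))\<^sup>2 * (rphi (-(t^3)))\<^sup>2 / t"
      using d(2) t u unfolding u_def[symmetric] by (simp add: divide_simps mult_ac)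
    ultimately show ?thesis
      by (auto intro: has_field_derivative_transform_within_open[of _ _ _ "{..<1}"] simp: F_def t)
  qed
  have "continuous_on {q..1} F"
    unfolding continuous_on_eq_continuous_within
  proof
    fix t assume t: "t \<in> {q..1}"
    show "continuous (at t within {q..1}) F"
    proof (cases "t = 1")
      case False
      then have "isCont F t" using t q by (intro DERIV_isCont[OF der]) auto
      then show ?thesis by (rule continuous_at_imp_continuous_at_within)
    next
      case True
      have "((\<lambda>t. - ln ((1 + 1 / cubic_modulus t) / 9)) \<longlongrightarrow> - ln ((1 + 1 / (1/8)) / 9)) (at_left 1)"
        by (intro tendsto_intros cubic_modulus_tendsto) auto
      then have "((\<lambda>t. - ln ((1 + 1 / cubic_modulus t) / 9)) \<longlongrightarrow> 0) (at_left 1)" by simp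
      then have "(F \<longlongrightarrow> 0) (at_left 1)"
        by (rule Lim_transform_eventually) (auto simp: F_def eventually_at_filter)
      moreover have "at 1 within {q..1} = at_left 1"
        using q by (intro at_within_Icc_at_left) auto
      ultimately show ?thesis by (simp add: True continuous_within F_def)
    qed
  qed
  then have "((\<lambda>t. (rphi (-t))\<^sup>2 * (rphi (-(t^3)))\<^sup>2 / t) has_integral (F 1 - F q)) {q..1}"
    using q by (intro fundamental_theorem_of_calculus_interior)
      (auto simp flip: has_real_derivative_iff_has_vector_derivative intro!: der)
  then have "integral {q..1} (\<lambda>t. (rphi (-t))\<^sup>2 * (rphi (-(t^3)))\<^sup>2 / t) = ln ((1 + 1 / cubic_modulus q) / 9)"
    using q by (simp add: integral_unique F_def)
  moreover have "(1 + 1 / cubic_modulus q) / 9 > 0"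
    using cubic_modulus_bounds(1)[OF q] by (simp add: add_pos_pos)
  ultimately show ?thesis by simp
qed

text \<open>The antiderivative -ln(1 - 8u)/8 vanishes at 0 together with u, and it is differentiable
  at 0 itself.\<close>

lemma exp_integral_psi:
  assumes q: "0 < q" "q < 1"
  shows "exp (-8 * integral {0..q} (\<lambda>t. (rpsi t)\<^sup>2 * (rpsi (t^3))\<^sup>2)) = 1 - 8 * cubic_modulus q"
proof -
  define G where "G t = - ln (1 - 8 * cubic_modulus t) / 8" for t
  have pos: "1 - 8 * cubic_modulus t > 0" if "0 \<le> t" "t < 1" for t
    using cubic_modulus_bounds(2)[of t] that by (cases "t = 0") (auto simp: cubic_modulus_def)
  have "(G has_real_derivative (rpsi t)\<^sup>2 * (rpsi (t^3))\<^sup>2) (at t)" if t: "0 \<le> t" "t < 1" for t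
  proof -
    obtain d where d: "(cubic_modulus has_real_derivative d) (at t)"
      "d = (1 - 8 * cubic_modulus t) * ((rpsi t)\<^sup>2 * (rpsi (t ^ 3))\<^sup>2)"
      using cubic_modulus_derivative[OF t] by metis
    show ?thesis
      unfolding G_def using pos[OF t] by (auto intro!: derivative_eq_intros d(1) simp: d(2))
  qed
  then have "((\<lambda>t. (rpsi t)\<^sup>2 * (rpsi (t^3))\<^sup>2) has_integral (G q - G 0)) {0..q}"
    using q by (intro fundamental_theorem_of_calculus)
      (auto simp flip: has_real_derivative_iff_has_vector_derivative intro: has_field_derivative_at_within)
  then have "-8 * integral {0..q} (\<lambda>t. (rpsi t)\<^sup>2 * (rpsi (t^3))\<^sup>2) = ln (1 - 8 * cubic_modulus q)"
    by (simp add: integral_unique G_def cubic_modulus_def[of 0])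
  then show ?thesis using pos[of q] q by simp
qed

text \<open>Convergence is asserted separately because an equation for \<open>lim\<close> does not
  by itself say that the limit exists.\<close>

theorem theorem2p1:
  fixes q :: real
  assumes "0 < q" and "q < 1"
  shows "cubic_cf_approx q \<longlonglongrightarrow>
           1 / root 3 (-1 + 9 * exp (integral {q..1}
                 (\<lambda>t. (rphi (-t))^2 * (rphi (-(t^3)))^2 / t)))
       \<and> cubic_cf q = 1 / root 3 (-1 + 9 * exp (integral {q..1}
                 (\<lambda>t. (rphi (-t))^2 * (rphi (-(t^3)))^2 / t)))
       \<and> cubic_cf q = 1/2 * root 3 (1 - exp (-8 * integral {0..q}
                 (\<lambda>t. (rpsi t)^2 * (rpsi (t^3))^2)))"
proof -
  have lim: "cubic_cf_approx q \<longlonglongrightarrow> root 3 (cubic_modulus q)"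
    using cubic_cf_approx_tendsto[OF assms] root_cubic_modulus by simp
  then have "cubic_cf q = root 3 (cubic_modulus q)" unfolding cubic_cf_def by (rule limI)
  moreover have "1 / root 3 (-1 + (1 + 1 / cubic_modulus q)) = root 3 (cubic_modulus q)"
    by (simp add: real_root_divide)
  moreover have "root 3 8 = (2::real)"
    using real_root_pos_unique[of 3 2 8] by simp
  then have "1/2 * root 3 (1 - (1 - 8 * cubic_modulus q)) = root 3 (cubic_modulus q)"
    by (simp add: real_root_mult)
  ultimately show ?thesis
    unfolding exp_integral_phi[OF assms] exp_integral_psi[OF assms] using lim by simp
qed

end
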